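(* For every mixed field $(A,B)$ on a principal circle bundle $Z$ over a closed oriented Riemannian surface $(\Sigma,h)$, with respect to the induced $L^2$-metric, $$\mathrm{YM}(A,B)=|\mu(A,B)|^2.$$
   Context: Factors of $2\pi i$ are suppressed; $\mathbb T=\mathbb R/\mathbb Z$. $\pi:Z\to\Sigma$ is a principal $\mathbb T$-bundle, $v$ the generator of the circle action, $A$ a connection $1$-form ($A(v)=1$) with curvature $F_A=dA$, and $B$ a $\mathbb T$-invariant $B$-field, i.e. local $\mathbb T$-invariant $2$-forms $B_\alpha$ on $\pi^{-1}(U_\alpha)$, for a good cover $\{U_\alpha\}$ of $\Sigma$, forming a curving of a $\mathbb T$-invariant gerbe, with global $\mathbb T$-invariant flux $H=dB_\alpha$. The metric on $Z$ is $h_A=\pi^*h+A\odot A$, with volume form $d\mathrm{vol}_{h_A}=A\wedge\pi^*d\mathrm{vol}_h$ (fibres have length $1$). The twisted Yang--Mills functional is $$\mathrm{YM}(A,B)=\int_\Sigma|F_A|^2\,d\mathrm{vol}_h+\int_ZH\wedge*_{h_A}H.$$ The moment map $\mu(A,B)\in\mathfrak g_1^*\oplus\mathfrak g_2^*$, with $\mathfrak g_1=C^\infty(\Sigma,\mathbb R)$ and $\mathfrak g_2=\Omega^1(Z)^{\mathbb T}$ (the $\mathbb T$-invariant $1$-forms), is $$\langle\mu(A,B),(f,\omega)\rangle=\int_\Sigma fF_A+\int_\Sigma(\iota_vH)(\iota_v\omega).$$ The induced $L^2$-metric: $\mathfrak g_1$ carries the $L^2$ inner product from $d\mathrm{vol}_h$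 and $\mathfrak g_2$ the $L^2$ inner product on $1$-forms from $h_A$; the norm of a functional represented by $L^2$ pairing is the $L^2$-norm of its representative, and the norm squared on the direct sum is the sum of the squares. *)

theory Defs
  imports "HOL-Analysis.Analysis" "HOL-Combinatorics.Permutations"
begin

section \<open>Smooth maps between open subsets of normed spaces\<close>

text \<open>Only used for open sets; on a finite-dimensional domain this is the usual
  notion of a function all of whose iterated partial derivatives exist and are continuous.\<close>

primrec Ck_on :: "nat \<Rightarrow> 'a::real_normed_vector set \<Rightarrow> ('a \<Rightarrow> 'b::real_normed_vector) \<Rightarrow> bool" where
  "Ck_on 0 S f \<longleftrightarrow> continuous_on S f"
| "Ck_on (Suc k) S f \<longleftrightarrow>
     (\<forall>x\<in>S. f differentiable (at x)) \<and>
     (\<forall>v. Ck_on k S (\<lambda>x. frechet_derivative f (at x) v))"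

definition smooth_on :: "'a::real_normed_vector set \<Rightarrow> ('a \<Rightarrow> 'b::real_normed_vector) \<Rightarrow> bool" where
  "smooth_on S f \<longleftrightarrow> (\<forall>k. Ck_on k S f)"


section \<open>Manifolds\<close>

text \<open>A manifold is a whole type carrying an atlas (not required to be maximal). A chart is a
  pair of its domain and its coordinate map; values of the latter off the domain are irrelevant.\<close>

type_synonym ('m, 'n) chart = "'m set \<times> ('m \<Rightarrow> real^'n)"
type_synonym ('m, 'n) atlas = "('m, 'n) chart set"

abbreviation cdom :: "('m, 'n) chart \<Rightarrow> 'm set" where "cdom c \<equiv> fst c"
abbreviation cmap :: "('m, 'n) chart \<Rightarrow> 'm \<Rightarrow> real^'n" where "cmap c \<equiv> snd c"

definition cinv :: "('m, 'n) chart \<Rightarrow> real^'n \<Rightarrow> 'm" where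
  "cinv c = inv_into (cdom c) (cmap c)"

definition smooth_manifold ::
    "('m::{t2_space, second_countable_topology}, 'n::finite) atlas \<Rightarrow> bool" where
  "smooth_manifold \<A> \<longleftrightarrow>
     (\<Union>c\<in>\<A>. cdom c) = UNIV \<and>
     (\<forall>c\<in>\<A>. open (cdom c) \<and> open (cmap c ` cdom c) \<and>
        homeomorphism (cdom c) (cmap c ` cdom c) (cmap c) (cinv c)) \<and>
     (\<forall>c\<in>\<A>. \<forall>c'\<in>\<A>. smooth_on (cmap c ` (cdom c \<inter> cdom c')) (cmap c' \<circ> cinv c))"

text \<open>An orientation is given by an atlas with orientation preserving changes of chart.\<close>

definition oriented_atlas :: "('m, 'n::finite) atlas \<Rightarrow> bool" where
  "oriented_atlas \<A> \<longleftrightarrow>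
     (\<forall>c\<in>\<A>. \<forall>c'\<in>\<A>. \<forall>p \<in> cdom c \<inter> cdom c'.
        det (matrix (frechet_derivative (cmap c' \<circ> cinv c) (at (cmap c p)))) > 0)"

text \<open>The tangent space at \<open>p\<close> is modelled by coordinate vectors \<open>real^'n\<close> with respect to one
  fixed chart of the atlas around \<open>p\<close>, its preferred chart. Derivatives of maps are therefore
  taken with respect to the preferred charts at the point and at its image.\<close>

definition chart_at :: "('m, 'n) atlas \<Rightarrow> 'm \<Rightarrow> ('m, 'n) chart" where
  "chart_at \<A> p = (SOME c. c \<in> \<A> \<and> p \<in> cdom c)"

definition mderiv ::
    "('m, 'n::finite) atlas \<Rightarrow> ('p, 'k::finite) atlas \<Rightarrow> ('m \<Rightarrow> 'p) \<Rightarrow> 'm \<Rightarrow> real^'n \<Rightarrow> real^'k" where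
  "mderiv \<A> \<B> f p =
     frechet_derivative (cmap (chart_at \<B> (f p)) \<circ> f \<circ> cinv (chart_at \<A> p))
       (at (cmap (chart_at \<A> p) p))"

definition mderiv_fun ::
    "('m, 'n::finite) atlas \<Rightarrow> ('m \<Rightarrow> 'b::real_normed_vector) \<Rightarrow> 'm \<Rightarrow> real^'n \<Rightarrow> 'b" where
  "mderiv_fun \<A> f p = frechet_derivative (f \<circ> cinv (chart_at \<A> p)) (at (cmap (chart_at \<A> p) p))"

definition smooth_fun_on ::
    "('m, 'n::finite) atlas \<Rightarrow> 'm set \<Rightarrow> ('m \<Rightarrow> 'b::real_normed_vector) \<Rightarrow> bool" where
  "smooth_fun_on \<A> W f \<longleftrightarrow> (\<forall>c\<in>\<A>. smooth_on (cmap c ` (cdom c \<inter> W)) (f \<circ> cinv c))"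

definition smooth_map_on ::
    "('m::topological_space, 'n::finite) atlas \<Rightarrow> ('p::topological_space, 'k::finite) atlas \<Rightarrow>
     'm set \<Rightarrow> ('m \<Rightarrow> 'p) \<Rightarrow> bool" where
  "smooth_map_on \<A> \<B> W f \<longleftrightarrow> continuous_on W f \<and>
     (\<forall>c\<in>\<A>. \<forall>c'\<in>\<B>. smooth_on (cmap c ` (cdom c \<inter> W \<inter> f -` cdom c')) (cmap c' \<circ> f \<circ> cinv c))"


section \<open>Differential forms\<close>

text \<open>A \<open>k\<close>-form at a point takes a list of \<open>k\<close> tangent vectors. It is required to vanish on
  lists of any other length, so that equality of forms is equality of functions.\<close>

definition alt_form :: "nat \<Rightarrow> ('v::real_vector list \<Rightarrow> real) \<Rightarrow> bool" where
  "alt_form k a \<longleftrightarrow>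
     (\<forall>vs. length vs \<noteq> k \<longrightarrow> a vs = 0) \<and>
     (\<forall>vs i. length vs = k \<and> i < k \<longrightarrow> linear (\<lambda>v. a (vs[i := v]))) \<and>
     (\<forall>vs i j. length vs = k \<and> i < j \<and> j < k \<and> vs ! i = vs ! j \<longrightarrow> a vs = 0)"

definition wedge :: "nat \<Rightarrow> nat \<Rightarrow> ('v list \<Rightarrow> real) \<Rightarrow> ('v list \<Rightarrow> real) \<Rightarrow> 'v list \<Rightarrow> real" where
  "wedge k l a b vs =
     (if length vs = k + l
      then (\<Sum>\<sigma> | \<sigma> permutes {..<k + l}.
              of_int (sign \<sigma>) * a (map (\<lambda>i. vs ! \<sigma> i) [0..<k])
                              * b (map (\<lambda>i. vs ! \<sigma> i) [k..<k + l])) / (fact k * fact l)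
      else 0)"

type_synonym ('m, 'n) form = "'m \<Rightarrow> (real^'n) list \<Rightarrow> real"

definition in_chart :: "('m, 'n::finite) atlas \<Rightarrow> ('m, 'n) chart \<Rightarrow> ('m, 'n) form \<Rightarrow> (real^'n, 'n) form" where
  "in_chart \<A> c \<omega> x vs =
     \<omega> (cinv c x) (map (frechet_derivative (cmap (chart_at \<A> (cinv c x)) \<circ> cinv c) (at x)) vs)"

definition smooth_form_on :: "('m, 'n::finite) atlas \<Rightarrow> 'm set \<Rightarrow> nat \<Rightarrow> ('m, 'n) form \<Rightarrow> bool" where
  "smooth_form_on \<A> W k \<omega> \<longleftrightarrow> (\<forall>p\<in>W. alt_form k (\<omega> p)) \<and>
     (\<forall>c\<in>\<A>. \<forall>vs. length vs = k \<longrightarrow> smooth_on (cmap c ` (cdom c \<inter> W)) (\<lambda>x. in_chart \<A> c \<omega> x vs))"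

definition pullback ::
    "('m, 'n::finite) atlas \<Rightarrow> ('p, 'k::finite) atlas \<Rightarrow> ('m \<Rightarrow> 'p) \<Rightarrow> ('p, 'k) form \<Rightarrow> ('m, 'n) form" where
  "pullback \<A> \<B> f \<omega> p vs = \<omega> (f p) (map (mderiv \<A> \<B> f p) vs)"

definition contract :: "('m \<Rightarrow> real^'n) \<Rightarrow> ('m, 'n) form \<Rightarrow> ('m, 'n) form" where
  "contract X \<omega> p vs = \<omega> p (X p # vs)"

text \<open>The coordinate formula
  \<open>(d\<omega>)(v\<^sub>0, \<dots>, v\<^sub>k) = \<Sum>i. (-1)^i (\<partial>\<^bsub>v\<^sub>i\<^esub> \<omega>)(v\<^sub>0, \<dots>, v\<^sub>i omitted, \<dots>, v\<^sub>k)\<close>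
  with the \<open>v\<^sub>i\<close> extended to constant fields, in the preferred chart at the point.\<close>

definition ext_d :: "('m, 'n::finite) atlas \<Rightarrow> ('m, 'n) form \<Rightarrow> ('m, 'n) form" where
  "ext_d \<A> \<omega> p vs =
     (\<Sum>i<length vs. (-1) ^ i *
        frechet_derivative
          (\<lambda>x. in_chart \<A> (chart_at \<A> p) \<omega> x (take i vs @ drop (Suc i) vs))
          (at (cmap (chart_at \<A> p) p)) (vs ! i))"


section \<open>Integration of top degree forms\<close>

definition std_frame :: "(real^'n::{finite, comm_ring_1}) list" where
  "std_frame = map (\<lambda>i. axis (of_nat i) 1) [1..<Suc CARD('n)]"

text \<open>The integral over a compact manifold with an oriented atlas: cut the manifold into finitely
  many Borel pieces, each lying in the domain of a chart, and integrate the coordinate expressions.\<close>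

definition has_form_integral ::
    "('m::topological_space, 'n::{finite, comm_ring_1}) atlas \<Rightarrow> ('m, 'n) form \<Rightarrow> real \<Rightarrow> bool" where
  "has_form_integral \<A> \<eta> I \<longleftrightarrow>
     (\<exists>cs E. finite cs \<and> cs \<subseteq> \<A> \<and>
        (\<forall>c\<in>cs. E c \<in> sets borel \<and> E c \<subseteq> cdom c) \<and>
        disjoint_family_on E cs \<and> (\<Union>c\<in>cs. E c) = UNIV \<and>
        (\<forall>c\<in>cs. (\<lambda>x. in_chart \<A> c \<eta> x std_frame) absolutely_integrable_on (cmap c ` E c)) \<and>
        I = (\<Sum>c\<in>cs. integral (cmap c ` E c) (\<lambda>x. in_chart \<A> c \<eta> x std_frame)))"

definition form_integral ::
    "('m::topological_space, 'n::{finite, comm_ring_1}) atlas \<Rightarrow> ('m, 'n) form \<Rightarrow> real" where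
  "form_integral \<A> \<eta> = (THE I. has_form_integral \<A> \<eta> I)"


section \<open>Riemannian metrics\<close>

type_synonym ('m, 'n) metric = "'m \<Rightarrow> real^'n \<Rightarrow> real^'n \<Rightarrow> real"

definition riemannian_metric :: "('m, 'n::finite) atlas \<Rightarrow> ('m, 'n) metric \<Rightarrow> bool" where
  "riemannian_metric \<A> h \<longleftrightarrow>
     (\<forall>p. bilinear (h p) \<and> (\<forall>v w. h p v w = h p w v) \<and> (\<forall>v. v \<noteq> 0 \<longrightarrow> h p v v > 0)) \<and>
     (\<forall>c\<in>\<A>. \<forall>v w. smooth_on (cmap c ` cdom c)
        (\<lambda>x. in_chart \<A> c (\<lambda>p vs. h p (vs ! 0) (vs ! 1)) x [v, w]))"

text \<open>\<open>sqrt (det h) dx\<^sup>1 \<and> \<dots> \<and> dx\<^sup>n\<close>; the standard orientation of the tangent space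
  \<open>real^'n\<close> at \<open>p\<close> is the given one when the atlas is oriented.\<close>

definition riem_vol :: "('m, 'n::{finite, comm_ring_1}) metric \<Rightarrow> ('m, 'n) form" where
  "riem_vol h p vs =
     (if length vs = CARD('n)
      then sqrt (det (\<chi> i j. h p (axis i 1) (axis j 1))) * det (vector vs)
      else 0)"

definition on_frame :: "(real^'n \<Rightarrow> real^'n \<Rightarrow> real) \<Rightarrow> (real^'n::finite) list" where
  "on_frame g = (SOME es. length es = CARD('n) \<and>
     (\<forall>i<CARD('n). \<forall>j<CARD('n). g (es ! i) (es ! j) = (if i = j then 1 else 0)))"

text \<open>The inner product of \<open>k\<close>-forms in which wedges of \<open>k\<close> elements of an orthonormal
  coframe with increasing indices are orthonormal (so a unit area form has norm 1); summing over all
  index lists counts each of them \<open>k!\<close> times.\<close>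

definition form_inner ::
    "(real^'n \<Rightarrow> real^'n \<Rightarrow> real) \<Rightarrow> nat \<Rightarrow> ((real^'n::finite) list \<Rightarrow> real) \<Rightarrow> ((real^'n) list \<Rightarrow> real) \<Rightarrow> real" where
  "form_inner g k a b =
     (\<Sum>js | length js = k \<and> set js \<subseteq> {..<CARD('n)}.
        a (map (\<lambda>j. on_frame g ! j) js) * b (map (\<lambda>j. on_frame g ! j) js)) / fact k"

definition hodge ::
    "(real^'n \<Rightarrow> real^'n \<Rightarrow> real) \<Rightarrow> ((real^'n) list \<Rightarrow> real) \<Rightarrow> nat \<Rightarrow>
     ((real^'n::finite) list \<Rightarrow> real) \<Rightarrow> (real^'n) list \<Rightarrow> real" where
  "hodge g vol k b = (THE c. alt_form (CARD('n) - k) c \<and>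
     (\<forall>a. alt_form k a \<longrightarrow> wedge k (CARD('n) - k) a c = (\<lambda>vs. form_inner g k a b * vol vs)))"


section \<open>Principal circle bundles over a closed oriented surface\<close>

text \<open>An action of \<open>\<real>/\<int>\<close> is written as an action of \<open>\<real>\<close> in which \<open>1\<close> acts trivially.\<close>

record ('s, 'z) circle_bundle =
  base :: "('s, 2) atlas"
  total :: "('z, 3) atlas"
  proj :: "'z \<Rightarrow> 's"
  act :: "real \<Rightarrow> 'z \<Rightarrow> 'z"

definition generator :: "('s, 'z) circle_bundle \<Rightarrow> 'z \<Rightarrow> real^3" where
  "generator P z = vector_derivative (\<lambda>t. cmap (chart_at (total P) z) (act P t z)) (at 0)"

text \<open>The map \<open>(x, t) \<mapsto> act t (s x)\<close> is an equivariant diffeomorphism from \<open>U \<times> \<real>/\<int>\<close> onto the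
  part of the bundle over \<open>U\<close>; its inverse is \<open>(proj, \<tau>)\<close>, where \<open>\<real>/\<int>\<close> is identified with the
  unit circle by \<open>t \<mapsto> cis (2 \<pi> t)\<close>. In particular the action is free.\<close>

definition local_trivialization ::
    "('s::topological_space, 'z::topological_space) circle_bundle \<Rightarrow> 's set \<Rightarrow> ('s \<Rightarrow> 'z) \<Rightarrow> ('z \<Rightarrow> complex) \<Rightarrow> bool" where
  "local_trivialization P U s \<tau> \<longleftrightarrow> open U \<and>
     smooth_map_on (base P) (total P) U s \<and> (\<forall>x\<in>U. proj P (s x) = x) \<and>
     smooth_fun_on (total P) (proj P -` U) \<tau> \<and>
     (\<forall>x\<in>U. \<forall>t. \<tau> (act P t (s x)) = cis (2 * pi * t)) \<and>
     (\<forall>z \<in> proj P -` U. \<exists>t. z = act P t (s (proj P z)))"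

definition principal_circle_bundle ::
    "('s::{t2_space, second_countable_topology}, 'z::{t2_space, second_countable_topology}) circle_bundle \<Rightarrow> bool" where
  "principal_circle_bundle P \<longleftrightarrow>
     smooth_manifold (base P) \<and> smooth_manifold (total P) \<and>
     smooth_map_on (total P) (base P) UNIV (proj P) \<and>
     (\<forall>z. act P 0 z = z) \<and> (\<forall>z. act P 1 z = z) \<and>
     (\<forall>s t z. act P (s + t) z = act P s (act P t z)) \<and>
     (\<forall>t z. proj P (act P t z) = proj P z) \<and>
     continuous_on UNIV (\<lambda>(t, z). act P t z) \<and>
     (\<forall>c\<in>total P. \<forall>c'\<in>total P.
        smooth_on {(t, x). x \<in> cmap c ` cdom c \<and> act P t (cinv c x) \<in> cdom c'}
          (\<lambda>(t, x). cmap c' (act P t (cinv c x)))) \<and>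
     (\<forall>x. \<exists>U s \<tau>. x \<in> U \<and> local_trivialization P U s \<tau>)"

text \<open>The total space carries the fibre-first orientation, that of \<open>A \<and> \<pi>\<^sup>*dvol\<^sub>h\<close>.\<close>

definition fibre_first_oriented :: "('s, 'z) circle_bundle \<Rightarrow> bool" where
  "fibre_first_oriented P \<longleftrightarrow> oriented_atlas (base P) \<and> oriented_atlas (total P) \<and>
     (\<forall>z w\<^sub>1 w\<^sub>2.
        det (vector [mderiv (total P) (base P) (proj P) z w\<^sub>1,
                     mderiv (total P) (base P) (proj P) z w\<^sub>2] :: real^2^2) > 0 \<longrightarrow>
        det (vector [generator P z, w\<^sub>1, w\<^sub>2] :: real^3^3) > 0)"

definition closed_oriented_surface_bundle ::
    "('s::{t2_space, second_countable_topology}, 'z::{t2_space, second_countable_topology}) circle_bundle \<Rightarrow> bool" where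
  "closed_oriented_surface_bundle P \<longleftrightarrow>
     principal_circle_bundle P \<and> fibre_first_oriented P \<and> compact (UNIV :: 's set)"

definition invariant_on :: "('s, 'z) circle_bundle \<Rightarrow> 's set \<Rightarrow> ('z, 3) form \<Rightarrow> bool" where
  "invariant_on P U \<omega> \<longleftrightarrow>
     (\<forall>t. \<forall>z \<in> proj P -` U. pullback (total P) (total P) (act P t) \<omega> z = \<omega> z)"

text \<open>The unique form on the base whose pullback is the given basic \<open>k\<close>-form.\<close>

definition descend :: "('s, 'z) circle_bundle \<Rightarrow> nat \<Rightarrow> ('z, 3) form \<Rightarrow> ('s, 2) form" where
  "descend P k \<eta> = (THE \<beta>. (\<forall>x. alt_form k (\<beta> x)) \<and> pullback (total P) (base P) (proj P) \<beta> = \<eta>)"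


section \<open>Mixed fields\<close>

definition connection_form :: "('s, 'z) circle_bundle \<Rightarrow> ('z, 3) form \<Rightarrow> bool" where
  "connection_form P A \<longleftrightarrow> smooth_form_on (total P) UNIV 1 A \<and> invariant_on P UNIV A \<and>
     (\<forall>z. A z [generator P z] = 1)"

definition curvature :: "('s, 'z) circle_bundle \<Rightarrow> ('z, 3) form \<Rightarrow> ('s, 2) form" where
  "curvature P A = descend P 2 (ext_d (total P) A)"

definition good_cover :: "('i \<Rightarrow> 's::topological_space set) \<Rightarrow> bool" where
  "good_cover U \<longleftrightarrow> (\<forall>i. open (U i)) \<and> (\<Union>i. U i) = UNIV \<and>
     (\<forall>J. finite J \<and> J \<noteq> {} \<and> (\<Inter>i\<in>J. U i) \<noteq> {} \<longrightarrow>
        contractible_space (top_of_set (\<Inter>i\<in>J. U i)))"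

text \<open>Gerbe data relative to the preimages of a cover of the base, with the convention
  \<open>\<real>/\<int> \<cong> U(1)\<close>, \<open>t \<mapsto> exp (2 \<pi> i t)\<close>, for the cocycle.\<close>

record ('i, 's, 'z) gerbe_field =
  cover :: "'i \<Rightarrow> 's set"
  cocycle :: "'i \<Rightarrow> 'i \<Rightarrow> 'i \<Rightarrow> 'z \<Rightarrow> complex"
  connective :: "'i \<Rightarrow> 'i \<Rightarrow> ('z, 3) form"
  curving :: "'i \<Rightarrow> ('z, 3) form"

definition invariant_gerbe ::
    "('s::topological_space, 'z) circle_bundle \<Rightarrow> ('i, 's, 'z) gerbe_field \<Rightarrow> bool" where
  "invariant_gerbe P B \<longleftrightarrow>
     good_cover (cover B) \<and>
     (\<forall>i j k. let W = cover B i \<inter> cover B j \<inter> cover B k in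
        smooth_fun_on (total P) (proj P -` W) (cocycle B i j k) \<and>
        (\<forall>z \<in> proj P -` W. cmod (cocycle B i j k z) = 1 \<and>
           (\<forall>w. complex_of_real (connective B i j z [w] + connective B j k z [w] - connective B i k z [w])
                = mderiv_fun (total P) (cocycle B i j k) z w / (2 * pi * \<i> * cocycle B i j k z)))) \<and>
     (\<forall>i j k l. \<forall>z \<in> proj P -` (cover B i \<inter> cover B j \<inter> cover B k \<inter> cover B l).
        cocycle B j k l z * cocycle B i j l z = cocycle B i k l z * cocycle B i j k z) \<and>
     (\<forall>i j. let W = cover B i \<inter> cover B j in
        smooth_form_on (total P) (proj P -` W) 1 (connective B i j) \<and>
        invariant_on P W (connective B i j))"

definition invariant_b_field ::
    "('s::topological_space, 'z) circle_bundle \<Rightarrow> ('i, 's, 'z) gerbe_field \<Rightarrow> bool" where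
  "invariant_b_field P B \<longleftrightarrow> invariant_gerbe P B \<and>
     (\<forall>i. smooth_form_on (total P) (proj P -` cover B i) 2 (curving B i) \<and>
          invariant_on P (cover B i) (curving B i)) \<and>
     (\<forall>i j. \<forall>z \<in> proj P -` (cover B i \<inter> cover B j). \<forall>vs.
        curving B j z vs - curving B i z vs = ext_d (total P) (connective B i j) z vs) \<and>
     (\<exists>H. smooth_form_on (total P) UNIV 3 H \<and> invariant_on P UNIV H \<and>
        (\<forall>i. \<forall>z \<in> proj P -` cover B i. H z = ext_d (total P) (curving B i) z))"

definition flux :: "('s, 'z) circle_bundle \<Rightarrow> ('i, 's, 'z) gerbe_field \<Rightarrow> ('z, 3) form" where
  "flux P B = (THE H. \<forall>i. \<forall>z \<in> proj P -` cover B i. H z = ext_d (total P) (curving B i) z)"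

definition mixed_field ::
    "('s::topological_space, 'z) circle_bundle \<Rightarrow> ('z, 3) form \<Rightarrow> ('i, 's, 'z) gerbe_field \<Rightarrow> bool" where
  "mixed_field P A B \<longleftrightarrow> connection_form P A \<and> invariant_b_field P B"


section \<open>The twisted Yang--Mills functional and the moment map\<close>

definition total_metric ::
    "('s, 'z) circle_bundle \<Rightarrow> ('s, 2) metric \<Rightarrow> ('z, 3) form \<Rightarrow> ('z, 3) metric" where
  "total_metric P h A z v w =
     h (proj P z) (mderiv (total P) (base P) (proj P) z v) (mderiv (total P) (base P) (proj P) z w)
     + A z [v] * A z [w]"

definition total_vol ::
    "('s, 'z) circle_bundle \<Rightarrow> ('s, 2) metric \<Rightarrow> ('z, 3) form \<Rightarrow> ('z, 3) form" where
  "total_vol P h A z = wedge 1 2 (A z) (pullback (total P) (base P) (proj P) (riem_vol h) z)"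

definition YM ::
    "('s::topological_space, 'z::topological_space) circle_bundle \<Rightarrow> ('s, 2) metric \<Rightarrow> ('z, 3) form \<Rightarrow>
     ('i, 's, 'z) gerbe_field \<Rightarrow> real" where
  "YM P h A B =
     form_integral (base P)
       (\<lambda>x vs. form_inner (h x) 2 (curvature P A x) (curvature P A x) * riem_vol h x vs)
     + form_integral (total P)
       (\<lambda>z. wedge 3 0 (flux P B z) (hodge (total_metric P h A z) (total_vol P h A z) 3 (flux P B z)))"

definition g1 :: "('s, 'z) circle_bundle \<Rightarrow> ('s \<Rightarrow> real) set" where
  "g1 P = {f. smooth_fun_on (base P) UNIV f}"

definition g2 :: "('s, 'z) circle_bundle \<Rightarrow> ('z, 3) form set" where
  "g2 P = {\<omega>. smooth_form_on (total P) UNIV 1 \<omega> \<and> invariant_on P UNIV \<omega>}"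

definition moment_map ::
    "('s::topological_space, 'z) circle_bundle \<Rightarrow> ('z, 3) form \<Rightarrow> ('i, 's, 'z) gerbe_field \<Rightarrow>
     ('s \<Rightarrow> real) \<times> ('z, 3) form \<Rightarrow> real" where
  "moment_map P A B = (\<lambda>(f, \<omega>).
     form_integral (base P) (\<lambda>x vs. f x * curvature P A x vs)
     + form_integral (base P)
         (descend P 2 (\<lambda>z vs. contract (generator P) (flux P B) z vs * \<omega> z [generator P z])))"

definition l2_fun ::
    "('s::topological_space, 'z) circle_bundle \<Rightarrow> ('s, 2) metric \<Rightarrow> ('s \<Rightarrow> real) \<Rightarrow> ('s \<Rightarrow> real) \<Rightarrow> real" where
  "l2_fun P h f f' = form_integral (base P) (\<lambda>x vs. f x * f' x * riem_vol h x vs)"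

definition l2_one_form ::
    "('s, 'z::topological_space) circle_bundle \<Rightarrow> ('s, 2) metric \<Rightarrow> ('z, 3) form \<Rightarrow>
     ('z, 3) form \<Rightarrow> ('z, 3) form \<Rightarrow> real" where
  "l2_one_form P h A \<omega> \<omega>' =
     form_integral (total P)
       (\<lambda>z vs. form_inner (total_metric P h A z) 1 (\<omega> z) (\<omega>' z) * total_vol P h A z vs)"

text \<open>The squared norm of a functional on \<open>V\<close> that is represented, through the inner product \<open>ip\<close>,
  by an element of \<open>V\<close>; unspecified for functionals without a representative.\<close>

definition dual_norm_sq :: "'a set \<Rightarrow> ('a \<Rightarrow> 'a \<Rightarrow> real) \<Rightarrow> ('a \<Rightarrow> real) \<Rightarrow> real" where
  "dual_norm_sq V ip \<phi> = (THE r. \<exists>u\<in>V. (\<forall>w\<in>V. \<phi> w = ip u w) \<and> r = ip u u)"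

definition moment_norm_sq ::
    "('s::topological_space, 'z::topological_space) circle_bundle \<Rightarrow> ('s, 2) metric \<Rightarrow> ('z, 3) form \<Rightarrow>
     ('i, 's, 'z) gerbe_field \<Rightarrow> real" where
  "moment_norm_sq P h A B =
     dual_norm_sq (g1 P) (l2_fun P h) (\<lambda>f. moment_map P A B (f, \<lambda>z vs. 0))
     + dual_norm_sq (g2 P) (l2_one_form P h A) (\<lambda>\<omega>. moment_map P A B (\<lambda>x. 0, \<omega>))"

end

theory Submission
  imports Defs
begin

text \<open>
  In terms of the area form of \<open>h\<close> write the curvature as \<open>F\<^sub>A = f dvol\<^sub>h\<close> and the flux as
  \<open>H = \<phi> A \<and> \<pi>\<^sup>*dvol\<^sub>h\<close>. Both parts of the Yang--Mills functional are then pointwise squares, of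
  \<open>f\<close> and of \<open>\<phi>\<close>. The two components of the moment map are represented by \<open>f\<close> and by the one-form
  \<open>\<phi> A\<close>: since \<open>A\<close> is dual to the vertical unit vector \<open>v\<close>, the inner product of \<open>\<phi> A\<close> with \<open>\<omega>\<close> is
  \<open>\<phi> \<omega>(v)\<close>, and integrating this invariant function over fibres of length one gives
  \<open>\<integral>\<^sub>\<Sigma> (\<iota>\<^sub>v H)(\<iota>\<^sub>v \<omega>)\<close>.
\<close>

text \<open>Vectors at a point are written in its preferred chart, a choice that jumps from point to
  point, so components in preferred charts cannot be differentiated. Everything is therefore
  differentiated along parametrizations, with one chart fixed near each point. In a local product
  the connection is \<open>dt + \<alpha>\<close> with \<alpha> independent of \<open>t\<close>;
  naturality of the exterior derivative, which rests on the symmetry of second derivatives, then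
  shows that \<open>dA\<close> is a multiple of the pulled back area form and descends. Integrals,
  Hodge star, flux, descended forms and dual norms are definite descriptions, so existence and
  uniqueness precede every computation. For integrals, uniqueness comes from common refinements and
  oriented changes of chart, existence from compactness, which has to be transferred from the base
  to the total space. The flux term and the norm of \<open>\<phi> A\<close> are integrals over the
  same space; integration along fibres only serves to show that \<open>\<phi> A\<close> represents
  the second component. Smoothness of both coefficients is needed for the representatives to lie in
  \<open>g1\<close> and \<open>g2\<close>.\<close>

section \<open>Calculus of C^k maps on open sets\<close>

lemma has_derivative_cong_open:
  assumes "open S" "x \<in> S" "\<And>y. y \<in> S \<Longrightarrow> f y = g y"
  shows "(f has_derivative D) (at x) \<longleftrightarrow> (g has_derivative D) (at x)"
  using assms has_derivative_transform_within_open[of f D x UNIV S g]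
    has_derivative_transform_within_open[of g D x UNIV S f] by auto

lemma differentiable_cong_open:
  assumes "open S" "x \<in> S" "\<And>y. y \<in> S \<Longrightarrow> f y = g y"
  shows "f differentiable (at x) \<longleftrightarrow> g differentiable (at x)"
  unfolding differentiable_def using has_derivative_cong_open[OF assms] by auto

lemma frechet_derivative_cong_open:
  assumes "open S" "x \<in> S" "\<And>y. y \<in> S \<Longrightarrow> f y = g y"
  shows "frechet_derivative f (at x) = frechet_derivative g (at x)"
  unfolding frechet_derivative_def using has_derivative_cong_open[OF assms] by auto

lemma has_frechet_derivative:
  "f differentiable (at x) \<Longrightarrow> (f has_derivative frechet_derivative f (at x)) (at x)"
  by (simp add: frechet_derivative_works)

lemma frechet_derivative_eqI:
  "(f has_derivative D) (at x) \<Longrightarrow> frechet_derivative f (at x) = D"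
  using frechet_derivative_at by metis

text \<open>Openness lets equality on the set pass to the derivatives, which are taken with the full
  filter at each point.\<close>

lemma Ck_on_cong:
  assumes "open S" "\<And>y. y \<in> S \<Longrightarrow> f y = g y"
  shows "Ck_on k S f \<longleftrightarrow> Ck_on k S g"
  using assms(2)
proof (induction k arbitrary: f g)
  case 0
  then show ?case by (auto intro: continuous_on_eq)
next
  case (Suc k)
  have "Ck_on k S (\<lambda>x. frechet_derivative f (at x) v) \<longleftrightarrow> Ck_on k S (\<lambda>x. frechet_derivative g (at x) v)" for v
    by (rule Suc.IH) (use frechet_derivative_cong_open[OF assms(1) _ Suc.prems] in auto)
  moreover have "(\<forall>x\<in>S. f differentiable (at x)) \<longleftrightarrow> (\<forall>x\<in>S. g differentiable (at x))"
    by (intro ball_cong refl differentiable_cong_open[OF assms(1) _ Suc.prems])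
  ultimately show ?case by simp
qed

lemma Ck_on_subset: "Ck_on k T f \<Longrightarrow> S \<subseteq> T \<Longrightarrow> Ck_on k S f"
  by (induction k arbitrary: f) (auto intro: continuous_on_subset)

text \<open>Smoothness is later proved near each point, in a chart chosen for that point; this glues
  the results.\<close>

lemma Ck_on_local:
  assumes "\<And>x. x \<in> S \<Longrightarrow> \<exists>T. open T \<and> x \<in> T \<and> Ck_on k T f"
  shows "Ck_on k S f"
  using assms
proof (induction k arbitrary: f)
  case 0
  have "continuous (at x) f" if "x \<in> S" for x
    using 0[OF that] by (auto simp: continuous_on_eq_continuous_at)
  then show ?case by (simp add: continuous_at_imp_continuous_on)
next
  case (Suc k)
  have "Ck_on k S (\<lambda>x. frechet_derivative f (at x) v)" for v
    by (rule Suc.IH) (use Suc.prems in fastforce)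
  moreover have "\<forall>x\<in>S. f differentiable (at x)" using Suc.prems by fastforce
  ultimately show ?case by simp
qed

lemma Ck_on_Suc_imp: "Ck_on (Suc k) S f \<Longrightarrow> Ck_on k S f"
proof (induction k arbitrary: f)
  case 0
  then have "\<forall>x\<in>S. continuous (at x) f"
    by (simp add: differentiable_imp_continuous_within)
  then show ?case by (simp add: continuous_at_imp_continuous_on)
next
  case (Suc k)
  then show ?case by simp
qed

lemma Ck_on_const: "Ck_on k S (\<lambda>x. c)"
proof (induction k arbitrary: c)
  case (Suc k)
  then show ?case by (simp add: frechet_derivative_const)
qed simp

lemma Ck_on_bounded_linear:
  assumes "bounded_linear f"
  shows "Ck_on k S f"
proof -
  have d: "(f has_derivative f) (at x)" for x
    using bounded_linear_imp_has_derivative[OF assms] .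
  have "f differentiable (at x)" for x
    using d by (rule differentiableI)
  moreover have "frechet_derivative f (at x) = f" for x
    using d by (rule frechet_derivative_eqI)
  ultimately show ?thesis
    using assms by (cases k) (simp_all add: linear_continuous_on Ck_on_const)
qed

lemma Ck_on_add:
  assumes "open S" "Ck_on k S f" "Ck_on k S g"
  shows "Ck_on k S (\<lambda>x. f x + g x)"
  using assms(2,3)
proof (induction k arbitrary: f g)
  case 0
  then show ?case by (auto intro: continuous_on_add)
next
  case (Suc k)
  have d: "((\<lambda>x. f x + g x) has_derivative
      (\<lambda>v. frechet_derivative f (at x) v + frechet_derivative g (at x) v)) (at x)" if "x \<in> S" for x
    using Suc.prems that by (intro has_derivative_add has_frechet_derivative) simp_all
  have "Ck_on k S (\<lambda>x. frechet_derivative (\<lambda>x. f x + g x) (at x) v)" for v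
    by (subst Ck_on_cong[OF assms(1) frechet_derivative_eqI[OF d, THEN fun_cong]]) (use Suc in auto)
  then show ?case using d by (auto simp: differentiable_def)
qed

lemma Ck_on_linear_comp:
  assumes "open S" "bounded_linear L" "Ck_on k S f"
  shows "Ck_on k S (\<lambda>x. L (f x))"
  using assms(3)
proof (induction k arbitrary: f)
  case 0
  then show ?case using assms(2) by (auto intro: bounded_linear.continuous_on)
next
  case (Suc k)
  have d: "((\<lambda>x. L (f x)) has_derivative (\<lambda>v. L (frechet_derivative f (at x) v))) (at x)" if "x \<in> S" for x
    using Suc.prems that by (intro bounded_linear.has_derivative[OF assms(2)] has_frechet_derivative) simp
  have "Ck_on k S (\<lambda>x. frechet_derivative (\<lambda>x. L (f x)) (at x) v)" for v
    by (subst Ck_on_cong[OF assms(1) frechet_derivative_eqI[OF d, THEN fun_cong]]) (use Suc in auto)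
  then show ?case using d by (auto simp: differentiable_def)
qed

text \<open>The Leibniz rule pairs each factor with a derivative of the other, so the induction step
  also needs the undifferentiated factors one order lower, supplied by
  \<open>Ck_on_Suc_imp\<close>.\<close>

lemma Ck_on_bilinear:
  assumes "open S" "bounded_bilinear prd" "Ck_on k S f" "Ck_on k S g"
  shows "Ck_on k S (\<lambda>x. prd (f x) (g x))"
  using assms(3,4)
proof (induction k arbitrary: f g)
  case 0
  then show ?case using assms(2) by (auto intro: bounded_bilinear.continuous_on)
next
  case (Suc k)
  have d: "((\<lambda>x. prd (f x) (g x)) has_derivative
      (\<lambda>v. prd (f x) (frechet_derivative g (at x) v) + prd (frechet_derivative f (at x) v) (g x))) (at x)"
    if "x \<in> S" for x
    using Suc.prems that by (intro bounded_bilinear.FDERIV[OF assms(2)] has_frechet_derivative) simp_all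
  have "Ck_on k S (\<lambda>x. frechet_derivative (\<lambda>x. prd (f x) (g x)) (at x) v)" for v
    by (subst Ck_on_cong[OF assms(1) frechet_derivative_eqI[OF d, THEN fun_cong]])
      (use Suc Ck_on_Suc_imp[OF Suc.prems(1)] Ck_on_Suc_imp[OF Suc.prems(2)] in
        \<open>auto intro!: Ck_on_add[OF assms(1)]\<close>)
  then show ?case using d by (auto simp: differentiable_def)
qed

lemma Ck_on_sum:
  assumes "open S" "\<And>i. i \<in> I \<Longrightarrow> Ck_on k S (f i)"
  shows "Ck_on k S (\<lambda>x. \<Sum>i\<in>I. f i x)"
  using assms(2)
  by (induction I rule: infinite_finite_induct) (auto intro!: Ck_on_add[OF assms(1)] Ck_on_const)

lemma frechet_derivative_expand:
  fixes g :: "'b::euclidean_space \<Rightarrow> 'c::real_normed_vector"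
  assumes "g differentiable (at y)"
  shows "frechet_derivative g (at y) w = (\<Sum>i\<in>Basis. (w \<bullet> i) *\<^sub>R frechet_derivative g (at y) i)"
proof -
  interpret bounded_linear "frechet_derivative g (at y)"
    using has_frechet_derivative[OF assms] by (rule has_derivative_bounded_linear)
  have "frechet_derivative g (at y) (\<Sum>i\<in>Basis. (w \<bullet> i) *\<^sub>R i)
      = (\<Sum>i\<in>Basis. (w \<bullet> i) *\<^sub>R frechet_derivative g (at y) i)"
    by (simp add: sum scaleR)
  then show ?thesis by (simp add: euclidean_representation)
qed

lemma frechet_derivative_chain:
  assumes "f differentiable (at x)" "g differentiable (at (f x))"
  shows "((g \<circ> f) has_derivative (frechet_derivative g (at (f x)) \<circ> frechet_derivative f (at x))) (at x)"
  using assms by (auto intro!: diff_chain_at has_frechet_derivative)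

text \<open>In the chain rule the outer derivative is taken in a direction that moves with the
  point, whereas \<open>Ck_on\<close> speaks of fixed directions. Expanding the direction in a basis
  of the intermediate space restores fixed directions, to which the induction hypothesis
  applies.\<close>

lemma Ck_on_compose:
  fixes g :: "'b::euclidean_space \<Rightarrow> 'c::real_normed_vector" and f :: "'a::real_normed_vector \<Rightarrow> 'b"
  assumes "open S" "f ` S \<subseteq> T" "Ck_on k S f" "Ck_on k T g"
  shows "Ck_on k S (g \<circ> f)"
  using assms(3,4)
proof (induction k arbitrary: g)
  case 0
  then show ?case using assms(2) by (auto simp: o_def intro: continuous_on_compose2)
next
  case (Suc k)
  have fd: "f differentiable (at x)" "g differentiable (at (f x))" if "x \<in> S" for x
    using Suc.prems that assms(2) by auto
  have d: "frechet_derivative (g \<circ> f) (at x) v =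
      (\<Sum>i\<in>Basis. (frechet_derivative f (at x) v \<bullet> i) *\<^sub>R ((\<lambda>y. frechet_derivative g (at y) i) \<circ> f) x)"
    if "x \<in> S" for x v
    using frechet_derivative_eqI[OF frechet_derivative_chain[OF fd[OF that]]]
      frechet_derivative_expand[OF fd(2)[OF that], of "frechet_derivative f (at x) v"] by simp
  have "Ck_on k S (\<lambda>x. frechet_derivative (g \<circ> f) (at x) v)" for v
  proof (subst Ck_on_cong[OF assms(1) d], assumption, rule Ck_on_sum[OF assms(1)])
    fix i :: 'b assume "i \<in> Basis"
    have "Ck_on k S ((\<lambda>y. frechet_derivative g (at y) i) \<circ> f)"
      by (rule Suc.IH) (use Suc.prems Ck_on_Suc_imp[OF Suc.prems(1)] in auto)
    moreover have "Ck_on k S (\<lambda>x. frechet_derivative f (at x) v \<bullet> i)"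
      by (rule Ck_on_linear_comp[OF assms(1) bounded_linear_inner_left]) (use Suc.prems in simp)
    ultimately show "Ck_on k S (\<lambda>x. (frechet_derivative f (at x) v \<bullet> i) *\<^sub>R
        ((\<lambda>y. frechet_derivative g (at y) i) \<circ> f) x)"
      by (intro Ck_on_bilinear[OF assms(1) bounded_bilinear_scaleR])
  qed
  moreover have "(g \<circ> f) differentiable (at x)" if "x \<in> S" for x
    using frechet_derivative_chain[OF fd[OF that]] by (rule differentiableI)
  ultimately show ?case unfolding Ck_on.simps by blast
qed

text \<open>Arbitrary exponents close the induction, since differentiating a power gives a multiple
  of another power. The exponents 1/2 and -1 then yield square roots and quotients.\<close>

lemma Ck_on_powr: "Ck_on k {0<..} (\<lambda>x::real. x powr a)"
proof (induction k arbitrary: a)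
  case 0
  then show ?case by (auto intro!: continuous_intros)
next
  case (Suc k)
  have d: "((\<lambda>x. x powr a) has_derivative (\<lambda>v. (a * x powr (a - 1)) * v)) (at x)" if "x > 0" for x :: real
    using that has_real_derivative_powr[of x a] by (simp add: has_field_derivative_def)
  have "Ck_on k {0<..} (\<lambda>x. frechet_derivative (\<lambda>x. x powr a) (at x) v)" for v
  proof (subst Ck_on_cong)
    show "frechet_derivative (\<lambda>x. x powr a) (at y) v = a * y powr (a - 1) * v" if "y \<in> {0<..}" for y
      using frechet_derivative_eqI[OF d[of y]] that by simp
    show "Ck_on k {0<..} (\<lambda>x. a * x powr (a - 1) * v)"
      by (intro Ck_on_linear_comp[OF _ bounded_linear_mult_left]
          Ck_on_linear_comp[OF _ bounded_linear_mult_right] Suc open_greaterThan)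
  qed auto
  then show ?case using d by (auto simp: differentiable_def)
qed

subsection \<open>Rules for smooth maps\<close>

lemma smooth_on_cong: "open S \<Longrightarrow> (\<And>y. y \<in> S \<Longrightarrow> f y = g y) \<Longrightarrow> smooth_on S f \<longleftrightarrow> smooth_on S g"
  unfolding smooth_on_def using Ck_on_cong by blast

lemma smooth_on_subset: "smooth_on T f \<Longrightarrow> S \<subseteq> T \<Longrightarrow> smooth_on S f"
  unfolding smooth_on_def using Ck_on_subset by blast

lemma smooth_on_local: "(\<And>x. x \<in> S \<Longrightarrow> \<exists>T. open T \<and> x \<in> T \<and> smooth_on T f) \<Longrightarrow> smooth_on S f"
  unfolding smooth_on_def by (intro allI Ck_on_local) blast

lemma smooth_on_const: "smooth_on S (\<lambda>x. c)"
  unfolding smooth_on_def using Ck_on_const by blast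

lemma smooth_on_bounded_linear: "bounded_linear f \<Longrightarrow> smooth_on S f"
  unfolding smooth_on_def using Ck_on_bounded_linear by blast

lemma smooth_on_add: "open S \<Longrightarrow> smooth_on S f \<Longrightarrow> smooth_on S g \<Longrightarrow> smooth_on S (\<lambda>x. f x + g x)"
  unfolding smooth_on_def using Ck_on_add by blast

lemma smooth_on_linear_comp:
  "open S \<Longrightarrow> bounded_linear L \<Longrightarrow> smooth_on S f \<Longrightarrow> smooth_on S (\<lambda>x. L (f x))"
  unfolding smooth_on_def using Ck_on_linear_comp by blast

lemma smooth_on_mult:
  fixes f g :: "'a::real_normed_vector \<Rightarrow> real"
  shows "open S \<Longrightarrow> smooth_on S f \<Longrightarrow> smooth_on S g \<Longrightarrow> smooth_on S (\<lambda>x. f x * g x)"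
  unfolding smooth_on_def using Ck_on_bilinear[OF _ bounded_bilinear_mult] by blast

lemma smooth_on_diff:
  assumes "open S" "smooth_on S f" "smooth_on S g"
  shows "smooth_on S (\<lambda>x. f x - g x)"
  using smooth_on_add[OF assms(1,2) smooth_on_linear_comp[OF assms(1) bounded_linear_minus[OF bounded_linear_ident] assms(3)]]
  by simp

lemma smooth_on_sum:
  "open S \<Longrightarrow> (\<And>i. i \<in> I \<Longrightarrow> smooth_on S (f i)) \<Longrightarrow> smooth_on S (\<lambda>x. \<Sum>i\<in>I. f i x)"
  by (simp add: smooth_on_def Ck_on_sum)

lemma smooth_on_compose:
  fixes g :: "'b::euclidean_space \<Rightarrow> 'c::real_normed_vector"
  shows "open S \<Longrightarrow> f ` S \<subseteq> T \<Longrightarrow> smooth_on S f \<Longrightarrow> smooth_on T g \<Longrightarrow> smooth_on S (g \<circ> f)"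
  unfolding smooth_on_def by (intro allI Ck_on_compose) auto

lemma smooth_on_powr:
  fixes f :: "'a::real_normed_vector \<Rightarrow> real"
  assumes "open S" "smooth_on S f" "\<And>x. x \<in> S \<Longrightarrow> f x > 0"
  shows "smooth_on S (\<lambda>x. f x powr a)"
proof -
  have "smooth_on {0<..} (\<lambda>x::real. x powr a)" by (simp add: smooth_on_def Ck_on_powr)
  then have "smooth_on S ((\<lambda>x. x powr a) \<circ> f)"
    using assms by (intro smooth_on_compose[where T = "{0<..}"]) auto
  then show ?thesis by (simp add: o_def)
qed

lemma smooth_on_sqrt:
  fixes f :: "'a::real_normed_vector \<Rightarrow> real"
  assumes "open S" "smooth_on S f" "\<And>x. x \<in> S \<Longrightarrow> f x > 0"
  shows "smooth_on S (\<lambda>x. sqrt (f x))"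
proof (subst smooth_on_cong[OF assms(1)])
  show "smooth_on S (\<lambda>x. f x powr (1/2))" by (rule smooth_on_powr[OF assms])
  show "sqrt (f y) = f y powr (1/2)" if "y \<in> S" for y
    using assms(3)[OF that] by (simp add: powr_half_sqrt)
qed

lemma smooth_on_divide:
  fixes f g :: "'a::real_normed_vector \<Rightarrow> real"
  assumes "open S" "smooth_on S f" "smooth_on S g" "\<And>x. x \<in> S \<Longrightarrow> g x > 0"
  shows "smooth_on S (\<lambda>x. f x / g x)"
proof -
  have "smooth_on S (\<lambda>x. f x * g x powr (-1))"
    by (intro smooth_on_mult smooth_on_powr assms)
  then show ?thesis
    by (subst smooth_on_cong[OF assms(1), of _ "\<lambda>x. f x * g x powr (-1)"])
      (use assms(4) in \<open>auto simp: powr_minus_divide less_imp_le\<close>)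
qed

lemma smooth_on_imp_continuous_on: "smooth_on S f \<Longrightarrow> continuous_on S f"
  unfolding smooth_on_def by (drule spec[of _ 0]) simp

lemma smooth_on_imp_differentiable: "smooth_on S f \<Longrightarrow> x \<in> S \<Longrightarrow> f differentiable (at x)"
  unfolding smooth_on_def by (drule spec[of _ 1]) simp

lemma smooth_on_frechet_derivative:
  "smooth_on S f \<Longrightarrow> smooth_on S (\<lambda>x. frechet_derivative f (at x) v)"
  unfolding smooth_on_def using Ck_on.simps(2)[of _ S f] by blast

lemma smooth_on_component:
  fixes f :: "'a::real_normed_vector \<Rightarrow> real^'n::finite"
  shows "open S \<Longrightarrow> smooth_on S f \<Longrightarrow> smooth_on S (\<lambda>x. f x $ i)"
  by (rule smooth_on_linear_comp[OF _ bounded_linear_vec_nth])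

lemma smooth_on_Pair:
  fixes f :: "'a::real_normed_vector \<Rightarrow> 'b::real_normed_vector"
    and g :: "'a \<Rightarrow> 'c::real_normed_vector"
  assumes "open S" "smooth_on S f" "smooth_on S g"
  shows "smooth_on S (\<lambda>x. (f x, g x))"
proof -
  have L: "bounded_linear (\<lambda>a::'b. (a, 0::'c))" "bounded_linear (\<lambda>b::'c. (0::'b, b))"
    by (rule bounded_linear_Pair[OF bounded_linear_ident bounded_linear_zero]
        bounded_linear_Pair[OF bounded_linear_zero bounded_linear_ident])+
  have "smooth_on S (\<lambda>x. (f x, 0) + (0, g x))"
    by (rule smooth_on_add[OF assms(1) smooth_on_linear_comp[OF assms(1) L(1) assms(2)]
          smooth_on_linear_comp[OF assms(1) L(2) assms(3)]])
  then show ?thesis by simp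
qed

subsection \<open>Symmetry of second derivatives\<close>

text \<open>The mean value theorem is applied twice: in direction \<open>a\<close> to the increment
  of \<open>f\<close> along \<open>t b\<close>, then in direction \<open>b\<close> to the derivative
  of \<open>f\<close> along \<open>a\<close>.\<close>

lemma second_difference_mvt:
  fixes f :: "'a::real_normed_vector \<Rightarrow> real"
  assumes S: "\<And>s r. 0 \<le> s \<Longrightarrow> s \<le> t \<Longrightarrow> 0 \<le> r \<Longrightarrow> r \<le> t \<Longrightarrow> x + s *\<^sub>R a + r *\<^sub>R b \<in> S" and "0 < t"
    and f: "Ck_on 2 S f"
  obtains s r where "0 \<le> s" "s \<le> t" "0 \<le> r" "r \<le> t"
    "f (x + t *\<^sub>R a + t *\<^sub>R b) - f (x + t *\<^sub>R a) - f (x + t *\<^sub>R b) + f x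
      = t\<^sup>2 * frechet_derivative (\<lambda>x. frechet_derivative f (at x) a) (at (x + s *\<^sub>R a + r *\<^sub>R b)) b"
proof -
  define fa where "fa = (\<lambda>x. frechet_derivative f (at x) a)"
  have d1: "(f has_derivative frechet_derivative f (at y)) (at y)" if "y \<in> S" for y
    using f that by (intro has_frechet_derivative) (simp add: numeral_2_eq_2)
  have d2: "(fa has_derivative frechet_derivative fa (at y)) (at y)" if "y \<in> S" for y
    using f that unfolding fa_def by (intro has_frechet_derivative) (simp add: numeral_2_eq_2)
  define g where "g s = f (x + s *\<^sub>R a + t *\<^sub>R b) - f (x + s *\<^sub>R a)" for s
  have dg: "(g has_real_derivative (fa (x + s *\<^sub>R a + t *\<^sub>R b) - fa (x + s *\<^sub>R a))) (at s)"
    if "0 \<le> s" "s \<le> t" for s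
  proof -
    have c: "((\<lambda>s. f (x + s *\<^sub>R a + r *\<^sub>R b)) has_derivative
       (\<lambda>h. frechet_derivative f (at (x + s *\<^sub>R a + r *\<^sub>R b)) (h *\<^sub>R a))) (at s)" if "0 \<le> r" "r \<le> t" for r
      by (rule has_derivative_compose[OF _ d1]) (use that \<open>0 \<le> s\<close> \<open>s \<le> t\<close> in \<open>auto intro!: derivative_eq_intros S\<close>)
    have l: "linear (frechet_derivative f (at y))" if "y \<in> S" for y
      using d1[OF that] has_derivative_linear by blast
    have *: "((\<lambda>s. f (x + s *\<^sub>R a + r *\<^sub>R b)) has_real_derivative
       fa (x + s *\<^sub>R a + r *\<^sub>R b)) (at s)" if "0 \<le> r" "r \<le> t" for r
      using c[OF that] linear_cmul[OF l[OF S[OF \<open>0 \<le> s\<close> \<open>s \<le> t\<close> that]], of _ a]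
      by (simp add: fa_def has_field_derivative_def mult_commute_abs)
    show ?thesis unfolding g_def
      using DERIV_diff[OF *[of t] *[of 0]] \<open>0 < t\<close> by simp
  qed
  obtain s where s: "0 < s" "s < t" "g t - g 0 = t * (fa (x + s *\<^sub>R a + t *\<^sub>R b) - fa (x + s *\<^sub>R a))"
    using MVT2[OF \<open>0 < t\<close> dg] by auto
  have dk: "((\<lambda>r. fa (x + s *\<^sub>R a + r *\<^sub>R b)) has_real_derivative
      (frechet_derivative fa (at (x + s *\<^sub>R a + r *\<^sub>R b)) b)) (at r)" if "0 \<le> r" "r \<le> t" for r
  proof -
    have y: "x + s *\<^sub>R a + r *\<^sub>R b \<in> S" using s that by (intro S) auto
    have "((\<lambda>r. fa (x + s *\<^sub>R a + r *\<^sub>R b)) has_derivative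
       (\<lambda>h. frechet_derivative fa (at (x + s *\<^sub>R a + r *\<^sub>R b)) (h *\<^sub>R b))) (at r)"
      by (rule has_derivative_compose[of "\<lambda>r. x + s *\<^sub>R a + r *\<^sub>R b", OF _ d2[OF y]]) (auto intro!: derivative_eq_intros)
    moreover have "linear (frechet_derivative fa (at (x + s *\<^sub>R a + r *\<^sub>R b)))"
      using d2[OF y] has_derivative_linear by blast
    ultimately show ?thesis
      unfolding has_field_derivative_def by (simp add: linear_cmul mult_commute_abs)
  qed
  obtain r where r: "0 < r" "r < t" "fa (x + s *\<^sub>R a + t *\<^sub>R b) - fa (x + s *\<^sub>R a + 0 *\<^sub>R b)
      = t * frechet_derivative fa (at (x + s *\<^sub>R a + r *\<^sub>R b)) b"
    using MVT2[OF \<open>0 < t\<close> dk] by auto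
  show ?thesis
    by (rule that[of s r]) (use s r in \<open>auto simp: g_def fa_def power2_eq_square algebra_simps\<close>)
qed

text \<open>The second difference is symmetric in \<open>a\<close> and \<open>b\<close>; the mean
  value form turns it into values of the two mixed derivatives near \<open>x\<close>, which
  continuity brings together.\<close>

lemma symmetric_second_derivative:
  fixes f :: "'a::real_normed_vector \<Rightarrow> real"
  assumes "open S" "x \<in> S" "Ck_on 2 S f"
  shows "frechet_derivative (\<lambda>x. frechet_derivative f (at x) a) (at x) b
       = frechet_derivative (\<lambda>x. frechet_derivative f (at x) b) (at x) a"
proof -
  define F where "F a b y = frechet_derivative (\<lambda>x. frechet_derivative f (at x) a) (at y) b" for a b y
  have cont: "isCont (F a b) x" for a b
    using assms unfolding F_def by (auto simp: numeral_2_eq_2 continuous_on_eq_continuous_at)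
  have "F a b x = F b a x"
  proof (rule ccontr)
    assume "F a b x \<noteq> F b a x"
    \<comment> \<open>Half the gap: a common value cannot be within \<open>e\<close> of both
      sides.\<close>
    define e where "e = \<bar>F a b x - F b a x\<bar> / 2"
    have "e > 0" using \<open>F a b x \<noteq> F b a x\<close> by (simp add: e_def)
    obtain d0 where d0: "d0 > 0" "ball x d0 \<subseteq> S" using assms open_contains_ball by blast
    have "\<exists>d>0. \<forall>y. dist y x < d \<longrightarrow> \<bar>F a b y - F a b x\<bar> < e" for a b
      using cont[of a b] \<open>e > 0\<close> unfolding continuous_at_eps_delta by (auto simp: dist_real_def)
    then obtain d1 d2 where d1: "d1 > 0" "\<And>y. dist y x < d1 \<Longrightarrow> \<bar>F a b y - F a b x\<bar> < e"
      and d2: "d2 > 0" "\<And>y. dist y x < d2 \<Longrightarrow> \<bar>F b a y - F b a x\<bar> < e" by metis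
    define d where "d = min d0 (min d1 d2)"
    have "d > 0" using d0 d1 d2 by (simp add: d_def)
    \<comment> \<open>Small enough for the whole parallelogram with sides \<open>t a\<close> and
      \<open>t b\<close> to stay within \<open>d\<close> of \<open>x\<close>; the summand 1 keeps
      the denominator positive when both vectors vanish.\<close>
    define t where "t = d / (2 * (norm a + norm b + 1))"
    have np: "norm a + norm b + 1 > 0" by (simp add: add_nonneg_pos)
    have "t > 0" using \<open>d > 0\<close> np by (simp add: t_def)
    have tb: "t * (norm a + norm b) < d"
    proof -
      have "t * (norm a + norm b) \<le> t * (norm a + norm b + 1)" using \<open>t > 0\<close> by simp
      also have "\<dots> = d / 2" using np by (simp add: t_def field_simps)
      finally show ?thesis using \<open>d > 0\<close> by simp
    qed
    have near: "dist (x + s *\<^sub>R a + r *\<^sub>R b) x < d" if "0 \<le> s" "s \<le> t" "0 \<le> r" "r \<le> t" for s r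
    proof -
      have "dist (x + s *\<^sub>R a + r *\<^sub>R b) x \<le> norm (s *\<^sub>R a) + norm (r *\<^sub>R b)"
        unfolding dist_norm by (metis add.assoc add_diff_cancel_left' norm_triangle_ineq)
      also have "\<dots> \<le> t * norm a + t * norm b" using that by (auto intro!: add_mono mult_right_mono)
      also have "\<dots> < d" using tb by (simp add: algebra_simps)
      finally show ?thesis .
    qed
    have inS: "x + s *\<^sub>R a + r *\<^sub>R b \<in> S" "x + s *\<^sub>R b + r *\<^sub>R a \<in> S" if "0 \<le> s" "s \<le> t" "0 \<le> r" "r \<le> t" for s r
    proof -
      have "dist x (x + s *\<^sub>R a + r *\<^sub>R b) < d0" "dist x (x + r *\<^sub>R a + s *\<^sub>R b) < d0"
        using near[OF that] near[OF that(3,4,1,2)] by (auto simp: d_def dist_commute)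
      then show "x + s *\<^sub>R a + r *\<^sub>R b \<in> S" "x + s *\<^sub>R b + r *\<^sub>R a \<in> S"
        using d0 by (auto simp: algebra_simps)
    qed
    obtain s r where sr: "0 \<le> s" "s \<le> t" "0 \<le> r" "r \<le> t"
      "f (x + t *\<^sub>R a + t *\<^sub>R b) - f (x + t *\<^sub>R a) - f (x + t *\<^sub>R b) + f x = t\<^sup>2 * F a b (x + s *\<^sub>R a + r *\<^sub>R b)"
      using second_difference_mvt[OF inS(1) \<open>0 < t\<close> assms(3)] unfolding F_def by blast
    obtain s' r' where sr': "0 \<le> s'" "s' \<le> t" "0 \<le> r'" "r' \<le> t"
      "f (x + t *\<^sub>R b + t *\<^sub>R a) - f (x + t *\<^sub>R b) - f (x + t *\<^sub>R a) + f x = t\<^sup>2 * F b a (x + s' *\<^sub>R b + r' *\<^sub>R a)"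
      using second_difference_mvt[OF inS(2) \<open>0 < t\<close> assms(3)] unfolding F_def by blast
    have "t\<^sup>2 * F a b (x + s *\<^sub>R a + r *\<^sub>R b) = t\<^sup>2 * F b a (x + s' *\<^sub>R b + r' *\<^sub>R a)"
      using sr(5) sr'(5) by (simp add: algebra_simps)
    then have eq: "F a b (x + s *\<^sub>R a + r *\<^sub>R b) = F b a (x + s' *\<^sub>R b + r' *\<^sub>R a)"
      using \<open>t > 0\<close> by simp
    have "\<bar>F a b (x + s *\<^sub>R a + r *\<^sub>R b) - F a b x\<bar> < e"
      using d1(2) near[OF sr(1-4)] by (simp add: d_def)
    moreover have "\<bar>F b a (x + s' *\<^sub>R b + r' *\<^sub>R a) - F b a x\<bar> < e"
      using d2(2) near[OF sr'(3,4,1,2)] by (simp add: d_def algebra_simps)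
    ultimately show False using eq unfolding e_def by (smt (verit) field_sum_of_halves)
  qed
  then show ?thesis by (simp add: F_def)
qed

subsection \<open>Charts and parametrizations\<close>

lemma chart_at:
  assumes "smooth_manifold \<A>"
  shows "chart_at \<A> p \<in> \<A>" "p \<in> cdom (chart_at \<A> p)"
proof -
  have "\<exists>c. c \<in> \<A> \<and> p \<in> cdom c" using assms unfolding smooth_manifold_def by (metis UNIV_I UN_iff)
  from someI_ex[OF this] show "chart_at \<A> p \<in> \<A>" "p \<in> cdom (chart_at \<A> p)"
    by (auto simp: chart_at_def)
qed

lemma chart_homeo:
  assumes "smooth_manifold \<A>" "c \<in> \<A>"
  shows "open (cdom c)" "open (cmap c ` cdom c)" "continuous_on (cdom c) (cmap c)"
    "continuous_on (cmap c ` cdom c) (cinv c)" "inj_on (cmap c) (cdom c)"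
    "p \<in> cdom c \<Longrightarrow> cinv c (cmap c p) = p"
    "x \<in> cmap c ` cdom c \<Longrightarrow> cmap c (cinv c x) = x"
    "x \<in> cmap c ` cdom c \<Longrightarrow> cinv c x \<in> cdom c"
proof -
  have h: "homeomorphism (cdom c) (cmap c ` cdom c) (cmap c) (cinv c)"
    and "open (cdom c)" "open (cmap c ` cdom c)"
    using assms unfolding smooth_manifold_def by auto
  then show "open (cdom c)" "open (cmap c ` cdom c)" by auto
  show "continuous_on (cdom c) (cmap c)" "continuous_on (cmap c ` cdom c) (cinv c)"
    "p \<in> cdom c \<Longrightarrow> cinv c (cmap c p) = p"
    "x \<in> cmap c ` cdom c \<Longrightarrow> cmap c (cinv c x) = x"
    "x \<in> cmap c ` cdom c \<Longrightarrow> cinv c x \<in> cdom c"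
    using h unfolding homeomorphism_def by auto
  show "inj_on (cmap c) (cdom c)"
    using h unfolding homeomorphism_def by (auto intro: inj_on_inverseI)
qed

lemma chart_image_eq_vimage:
  assumes "smooth_manifold \<A>" "c \<in> \<A>"
  shows "cmap c ` (cdom c \<inter> V) = cmap c ` cdom c \<inter> cinv c -` V"
  using chart_homeo(6-8)[OF assms] by force

text \<open>A map from an open set \<open>W\<close> of a normed space into a manifold, such as the inverse of a chart,
  a local section or a local trivialization; its derivative takes values in the preferred chart
  at the image point.\<close>

definition smooth_param ::
    "('m::{t2_space, second_countable_topology}, 'n::finite) atlas \<Rightarrow> 'e::euclidean_space set \<Rightarrow> ('e \<Rightarrow> 'm) \<Rightarrow> bool" where
  "smooth_param \<A> W \<Psi> \<longleftrightarrow> open W \<and> continuous_on W \<Psi> \<and>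
     (\<forall>c\<in>\<A>. smooth_on (W \<inter> \<Psi> -` cdom c) (cmap c \<circ> \<Psi>))"

definition param_deriv ::
    "('m, 'n::finite) atlas \<Rightarrow> ('e::real_normed_vector \<Rightarrow> 'm) \<Rightarrow> 'e \<Rightarrow> 'e \<Rightarrow> real^'n" where
  "param_deriv \<A> \<Psi> y = frechet_derivative (cmap (chart_at \<A> (\<Psi> y)) \<circ> \<Psi>) (at y)"

lemma in_chart_param: "in_chart \<A> c \<omega> x vs = \<omega> (cinv c x) (map (param_deriv \<A> (cinv c) x) vs)"
  by (simp add: in_chart_def param_deriv_def)

lemma smooth_param_open: "smooth_param \<A> W \<Psi> \<Longrightarrow> open W"
  by (simp add: smooth_param_def)

lemma smooth_param_continuous: "smooth_param \<A> W \<Psi> \<Longrightarrow> continuous_on W \<Psi>"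
  by (simp add: smooth_param_def)

lemma smooth_param_open_vimage:
  "smooth_param \<A> W \<Psi> \<Longrightarrow> open V \<Longrightarrow> open (W \<inter> \<Psi> -` V)"
  unfolding smooth_param_def by (metis continuous_open_preimage)

lemma smooth_param_smooth:
  "smooth_param \<A> W \<Psi> \<Longrightarrow> c \<in> \<A> \<Longrightarrow> smooth_on (W \<inter> \<Psi> -` cdom c) (cmap c \<circ> \<Psi>)"
  by (simp add: smooth_param_def)

lemma smooth_param_differentiable:
  "smooth_param \<A> W \<Psi> \<Longrightarrow> c \<in> \<A> \<Longrightarrow> y \<in> W \<Longrightarrow> \<Psi> y \<in> cdom c \<Longrightarrow> (cmap c \<circ> \<Psi>) differentiable (at y)"
  using smooth_on_imp_differentiable[OF smooth_param_smooth] by blast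

lemma smooth_param_has_derivative:
  assumes "smooth_manifold \<A>" "smooth_param \<A> W \<Psi>" "y \<in> W"
  shows "((cmap (chart_at \<A> (\<Psi> y)) \<circ> \<Psi>) has_derivative param_deriv \<A> \<Psi> y) (at y)"
  unfolding param_deriv_def
  by (intro has_frechet_derivative smooth_param_differentiable[OF assms(2) _ assms(3)] chart_at[OF assms(1)])

lemma linear_param_deriv:
  assumes "smooth_manifold \<A>" "smooth_param \<A> W \<Psi>" "y \<in> W"
  shows "linear (param_deriv \<A> \<Psi> y)"
  using smooth_param_has_derivative[OF assms] has_derivative_linear by blast

lemma smooth_param_cinv:
  assumes "smooth_manifold \<A>" "c \<in> \<A>"
  shows "smooth_param \<A> (cmap c ` cdom c) (cinv c)"
  unfolding smooth_param_def
proof (intro conjI ballI)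
  fix c' assume "c' \<in> \<A>"
  then have "smooth_on (cmap c ` (cdom c \<inter> cdom c')) (cmap c' \<circ> cinv c)"
    using assms unfolding smooth_manifold_def by blast
  then show "smooth_on (cmap c ` cdom c \<inter> cinv c -` cdom c') (cmap c' \<circ> cinv c)"
    by (simp add: chart_image_eq_vimage[OF assms])
qed (use chart_homeo[OF assms] in auto)

lemma smooth_param_chart_vimage_open:
  "smooth_manifold \<A> \<Longrightarrow> c \<in> \<A> \<Longrightarrow> smooth_param \<A> W \<Psi> \<Longrightarrow> open (W \<inter> \<Psi> -` cdom c)"
  by (rule smooth_param_open_vimage[OF _ chart_homeo(1)])

lemma smooth_param_compose:
  assumes M: "smooth_manifold \<A>" and "smooth_param \<A> W \<Psi>" "open W'" "smooth_on W' g" "g ` W' \<subseteq> W"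
  shows "smooth_param \<A> W' (\<Psi> \<circ> g)"
  unfolding smooth_param_def
proof (intro conjI ballI)
  have g: "continuous_on W' g" using assms(4) by (rule smooth_on_imp_continuous_on)
  then show c: "continuous_on W' (\<Psi> \<circ> g)"
    by (rule continuous_on_compose[OF _ continuous_on_subset[OF smooth_param_continuous[OF assms(2)] assms(5)]])
  fix c assume c: "c \<in> \<A>"
  have eq: "W' \<inter> (\<Psi> \<circ> g) -` cdom c = W' \<inter> g -` (W \<inter> \<Psi> -` cdom c)" using assms(5) by auto
  have op: "open (W' \<inter> (\<Psi> \<circ> g) -` cdom c)"
    unfolding eq
    by (intro continuous_open_preimage g assms smooth_param_chart_vimage_open[OF M c])
  have "smooth_on (W' \<inter> (\<Psi> \<circ> g) -` cdom c) ((cmap c \<circ> \<Psi>) \<circ> g)"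
    by (rule smooth_on_compose[OF op _ smooth_on_subset[OF assms(4)] smooth_param_smooth[OF assms(2) c]])
      (use assms(5) in auto)
  then show "smooth_on (W' \<inter> (\<Psi> \<circ> g) -` cdom c) (cmap c \<circ> (\<Psi> \<circ> g))"
    by (simp add: o_assoc)
qed fact

lemma param_deriv_cong_open:
  assumes "open S" "y \<in> S" "\<And>x. x \<in> S \<Longrightarrow> \<Psi> x = \<Psi>' x"
  shows "param_deriv \<A> \<Psi> y = param_deriv \<A> \<Psi>' y"
proof -
  have "\<Psi> y = \<Psi>' y" using assms by auto
  then show ?thesis unfolding param_deriv_def
    using frechet_derivative_cong_open[OF assms(1,2)] assms(3) by (metis comp_apply)
qed

lemma param_deriv_compose:
  assumes M: "smooth_manifold \<A>" and "smooth_param \<A> W \<Psi>" "g y \<in> W" "g differentiable (at y)"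
  shows "param_deriv \<A> (\<Psi> \<circ> g) y = param_deriv \<A> \<Psi> (g y) \<circ> frechet_derivative g (at y)"
proof -
  have "(cmap (chart_at \<A> (\<Psi> (g y))) \<circ> \<Psi>) differentiable (at (g y))"
    by (rule smooth_param_differentiable[OF assms(2) _ assms(3)]) (use chart_at[OF M] in auto)
  from frechet_derivative_eqI[OF frechet_derivative_chain[OF assms(4) this]]
  show ?thesis by (simp only: param_deriv_def o_assoc comp_apply[of \<Psi> g y])
qed

section \<open>Derivatives of maps between manifolds\<close>

text \<open>Turns maps between manifolds into parametrizations, so that derivatives and chain rules
  are handled for parametrizations only.\<close>

lemma smooth_map_on_cinv:
  assumes M: "smooth_manifold \<A>" and N: "smooth_manifold \<B>" and "smooth_map_on \<A> \<B> V f" "open V" "c \<in> \<A>"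
  shows "smooth_param \<B> (cmap c ` (cdom c \<inter> V)) (f \<circ> cinv c)"
proof -
  have op: "open (cmap c ` (cdom c \<inter> V))"
    unfolding chart_image_eq_vimage[OF M assms(5)]
    by (rule smooth_param_open_vimage[OF smooth_param_cinv[OF M assms(5)] assms(4)])
  have cont: "continuous_on (cmap c ` (cdom c \<inter> V)) (f \<circ> cinv c)"
  proof (rule continuous_on_compose)
    show "continuous_on (cmap c ` (cdom c \<inter> V)) (cinv c)"
      using chart_homeo(4)[OF M assms(5)] by (rule continuous_on_subset) auto
    show "continuous_on (cinv c ` cmap c ` (cdom c \<inter> V)) f"
      using assms(3) unfolding smooth_map_on_def
      by (elim conjE continuous_on_subset) (use chart_homeo(6)[OF M assms(5)] in auto)
  qed
  have "smooth_on (cmap c ` (cdom c \<inter> V) \<inter> (f \<circ> cinv c) -` cdom c') (cmap c' \<circ> (f \<circ> cinv c))"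
    if "c' \<in> \<B>" for c'
  proof -
    have "cmap c ` (cdom c \<inter> V) \<inter> (f \<circ> cinv c) -` cdom c' = cmap c ` (cdom c \<inter> V \<inter> f -` cdom c')"
      unfolding Int_assoc chart_image_eq_vimage[OF M assms(5)] by auto
    then show ?thesis using assms(3,5) that unfolding smooth_map_on_def by (simp add: o_assoc)
  qed
  with op cont show ?thesis by (simp add: smooth_param_def)
qed

lemma smooth_param_chart_local:
  assumes M: "smooth_manifold \<A>" and "smooth_param \<A> W \<Psi>" "y \<in> W" "c \<in> \<A>" "\<Psi> y \<in> cdom c"
  shows "open (W \<inter> \<Psi> -` cdom c)" "y \<in> W \<inter> \<Psi> -` cdom c" "W \<inter> \<Psi> -` cdom c \<subseteq> W"
    "\<Psi> ` (W \<inter> \<Psi> -` cdom c) \<subseteq> cdom c" "smooth_on (W \<inter> \<Psi> -` cdom c) (cmap c \<circ> \<Psi>)"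
    "x \<in> W \<inter> \<Psi> -` cdom c \<Longrightarrow> \<Psi> x = (cinv c \<circ> (cmap c \<circ> \<Psi>)) x"
proof -
  show "open (W \<inter> \<Psi> -` cdom c)" by (rule smooth_param_chart_vimage_open[OF M assms(4,2)])
  show "smooth_on (W \<inter> \<Psi> -` cdom c) (cmap c \<circ> \<Psi>)" by (rule smooth_param_smooth[OF assms(2,4)])
  show "\<Psi> x = (cinv c \<circ> (cmap c \<circ> \<Psi>)) x" if "x \<in> W \<inter> \<Psi> -` cdom c"
    using that chart_homeo(6)[OF M assms(4)] by simp
qed (use assms in auto)

text \<open>Near each point the composite is routed through a chart \<open>c\<close> of the source,
  so that in a target chart it becomes a composite of smooth maps between normed spaces.\<close>

lemma smooth_param_map:
  assumes M: "smooth_manifold \<A>" and N: "smooth_manifold \<B>" and f: "smooth_map_on \<A> \<B> V f" "open V"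
    and "smooth_param \<A> W \<Psi>" "\<Psi> ` W \<subseteq> V"
  shows "smooth_param \<B> W (f \<circ> \<Psi>)"
  unfolding smooth_param_def
proof (intro conjI ballI)
  show "open W" using assms(5) by (rule smooth_param_open)
  show cont: "continuous_on W (f \<circ> \<Psi>)"
    using f(1) unfolding smooth_map_on_def
    by (intro continuous_on_compose[OF smooth_param_continuous[OF assms(5)]])
      (elim conjE continuous_on_subset[OF _ assms(6)])
  fix c' assume c': "c' \<in> \<B>"
  show "smooth_on (W \<inter> (f \<circ> \<Psi>) -` cdom c') (cmap c' \<circ> (f \<circ> \<Psi>))"
  proof (rule smooth_on_local)
    fix y assume y: "y \<in> W \<inter> (f \<circ> \<Psi>) -` cdom c'"
    then have y1: "y \<in> W" by simp
    define c where "c = chart_at \<A> (\<Psi> y)"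
    have c: "c \<in> \<A>" "\<Psi> y \<in> cdom c" using chart_at[OF M] by (auto simp: c_def)
    define T where "T = W \<inter> \<Psi> -` cdom c"
  note T = smooth_param_chart_local[OF M assms(5) y1 c, folded T_def]
    define T' where "T' = T \<inter> (f \<circ> \<Psi>) -` cdom c'"
    have "T' = T \<inter> (W \<inter> (f \<circ> \<Psi>) -` cdom c')" using T(3) by (auto simp: T'_def)
    moreover have "open (W \<inter> (f \<circ> \<Psi>) -` cdom c')"
      by (rule continuous_open_preimage[OF cont smooth_param_open[OF assms(5)] chart_homeo(1)[OF N c']])
    ultimately have T': "open T'" "y \<in> T'" using T(1,2) y by (auto simp: T'_def)
    have "smooth_on T' ((cmap c' \<circ> (f \<circ> cinv c)) \<circ> (cmap c \<circ> \<Psi>))"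
    proof (rule smooth_on_compose[OF T'(1)])
      show "smooth_on (cmap c ` (cdom c \<inter> V) \<inter> (f \<circ> cinv c) -` cdom c') (cmap c' \<circ> (f \<circ> cinv c))"
        by (rule smooth_param_smooth[OF smooth_map_on_cinv[OF M N f c(1)] c'])
      show "(cmap c \<circ> \<Psi>) ` T' \<subseteq> cmap c ` (cdom c \<inter> V) \<inter> (f \<circ> cinv c) -` cdom c'"
        using T(3,4) assms(6) chart_homeo(6)[OF M c(1)] by (fastforce simp: T'_def)
      show "smooth_on T' (cmap c \<circ> \<Psi>)" using T(5) by (rule smooth_on_subset) (auto simp: T'_def)
    qed
    then have "smooth_on T' (cmap c' \<circ> (f \<circ> \<Psi>))"
      by (subst smooth_on_cong[OF T'(1), of _ "(cmap c' \<circ> (f \<circ> cinv c)) \<circ> (cmap c \<circ> \<Psi>)"])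
        (use T(6) in \<open>simp_all add: T'_def\<close>)
    with T' show "\<exists>T. open T \<and> y \<in> T \<and> smooth_on T (cmap c' \<circ> (f \<circ> \<Psi>))" by blast
  qed
qed

text \<open>The chain rule through an arbitrary chart around the point. With \<open>f\<close> the
  identity it compares a parametrization with a chart, and with \<open>c\<close> the preferred chart
  it becomes \<open>param_deriv_map\<close>.\<close>

lemma param_deriv_via_chart:
  assumes M: "smooth_manifold \<A>" and N: "smooth_manifold \<B>" and f: "smooth_map_on \<A> \<B> V f" "open V"
    and P: "smooth_param \<A> W \<Psi>" "y \<in> W" "\<Psi> y \<in> V" and c: "c \<in> \<A>" "\<Psi> y \<in> cdom c"
  shows "param_deriv \<B> (f \<circ> \<Psi>) y =
    param_deriv \<B> (f \<circ> cinv c) (cmap c (\<Psi> y)) \<circ> frechet_derivative (cmap c \<circ> \<Psi>) (at y)"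
proof -
  define T where "T = W \<inter> \<Psi> -` cdom c"
  note T = smooth_param_chart_local[OF M P(1,2) c, folded T_def]
  have "param_deriv \<B> (f \<circ> \<Psi>) y = param_deriv \<B> ((f \<circ> cinv c) \<circ> (cmap c \<circ> \<Psi>)) y"
    by (rule param_deriv_cong_open[OF T(1,2)]) (use T(6) in simp)
  also have "\<dots> = param_deriv \<B> (f \<circ> cinv c) ((cmap c \<circ> \<Psi>) y) \<circ> frechet_derivative (cmap c \<circ> \<Psi>) (at y)"
    by (rule param_deriv_compose[OF N smooth_map_on_cinv[OF M N f c(1)]])
      (use P c T(2) smooth_on_imp_differentiable[OF T(5,2)] in auto)
  finally show ?thesis by simp
qed

lemma smooth_map_on_id:
  assumes "smooth_manifold \<A>"
  shows "smooth_map_on \<A> \<A> UNIV (\<lambda>p. p)"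
  unfolding smooth_map_on_def
proof (intro conjI ballI)
  fix c c' assume "c \<in> \<A>" "c' \<in> \<A>"
  then show "smooth_on (cmap c ` (cdom c \<inter> UNIV \<inter> (\<lambda>p. p) -` cdom c')) (cmap c' \<circ> (\<lambda>p. p) \<circ> cinv c)"
    using assms unfolding smooth_manifold_def by (simp add: o_def vimage_def)
qed simp

lemma param_deriv_chart:
  assumes M: "smooth_manifold \<A>" and P: "smooth_param \<A> W \<Psi>" "y \<in> W" and c: "c \<in> \<A>" "\<Psi> y \<in> cdom c"
  shows "param_deriv \<A> \<Psi> y =
    param_deriv \<A> (cinv c) (cmap c (\<Psi> y)) \<circ> frechet_derivative (cmap c \<circ> \<Psi>) (at y)"
  using param_deriv_via_chart[OF M M smooth_map_on_id[OF M] open_UNIV P _ c] by (simp add: o_def)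

lemma mderiv_param:
  assumes M: "smooth_manifold \<A>"
  shows "mderiv \<A> \<B> f p = param_deriv \<B> (f \<circ> cinv (chart_at \<A> p)) (cmap (chart_at \<A> p) p)"
  using chart_homeo(6)[OF M chart_at[OF M]] by (simp add: mderiv_def param_deriv_def o_assoc)

lemma param_deriv_map:
  assumes M: "smooth_manifold \<A>" and N: "smooth_manifold \<B>" and f: "smooth_map_on \<A> \<B> V f" "open V"
    and P: "smooth_param \<A> W \<Psi>" "y \<in> W" "\<Psi> y \<in> V"
  shows "param_deriv \<B> (f \<circ> \<Psi>) y = mderiv \<A> \<B> f (\<Psi> y) \<circ> param_deriv \<A> \<Psi> y"
  using param_deriv_via_chart[OF M N f P chart_at[OF M]]
  by (simp add: mderiv_param[OF M] param_deriv_def[of \<A> \<Psi>])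

lemma mderiv_compose:
  assumes M: "smooth_manifold \<A>" and N: "smooth_manifold \<B>" and K: "smooth_manifold \<C>"
    and f: "smooth_map_on \<A> \<B> V f" "open V" "p \<in> V" and g: "smooth_map_on \<B> \<C> V' g" "open V'" "f p \<in> V'"
  shows "mderiv \<A> \<C> (g \<circ> f) p = mderiv \<B> \<C> g (f p) \<circ> mderiv \<A> \<B> f p"
proof -
  define c where "c = chart_at \<A> p"
  have c: "c \<in> \<A>" "p \<in> cdom c" using chart_at[OF M] by (auto simp: c_def)
  have p: "cinv c (cmap c p) = p" using chart_homeo(6)[OF M c] .
  have "param_deriv \<C> (g \<circ> (f \<circ> cinv c)) (cmap c p) =
      mderiv \<B> \<C> g ((f \<circ> cinv c) (cmap c p)) \<circ> param_deriv \<B> (f \<circ> cinv c) (cmap c p)"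
    by (rule param_deriv_map[OF N K g(1,2) smooth_map_on_cinv[OF M N f(1,2) c(1)]]) (use c f g p in auto)
  then show ?thesis using p by (simp add: mderiv_param[OF M] c_def[symmetric] o_assoc)
qed

lemma linear_mderiv:
  assumes M: "smooth_manifold \<A>" and N: "smooth_manifold \<B>" and f: "smooth_map_on \<A> \<B> V f" "open V" "p \<in> V"
  shows "linear (mderiv \<A> \<B> f p)"
  unfolding mderiv_param[OF M]
  by (rule linear_param_deriv[OF N smooth_map_on_cinv[OF M N f(1,2) chart_at(1)[OF M]]])
    (use chart_at[OF M] f(3) in auto)

lemma mderiv_id:
  assumes M: "smooth_manifold \<A>"
  shows "mderiv \<A> \<A> (\<lambda>p. p) p = (\<lambda>v. v)"
proof -
  define c where "c = chart_at \<A> p"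
  have c: "c \<in> \<A>" "p \<in> cdom c" using chart_at[OF M] by (auto simp: c_def)
  have "frechet_derivative (cmap c \<circ> cinv c) (at (cmap c p)) = frechet_derivative (\<lambda>x. x) (at (cmap c p))"
    by (rule frechet_derivative_cong_open[OF chart_homeo(2)[OF M c(1)]]) (use c chart_homeo(7)[OF M c(1)] in auto)
  also have "\<dots> = (\<lambda>v. v)" by (rule frechet_derivative_eqI) (rule has_derivative_ident)
  finally show ?thesis by (simp add: mderiv_def c_def[symmetric] o_def)
qed

text \<open>The derivative of the change of chart from the preferred chart \<open>k\<close> to
  \<open>c\<close> is a right inverse, because the inverse of \<open>k\<close> has identity
  derivative in its own coordinates.\<close>

lemma surj_param_deriv_cinv:
  assumes M: "smooth_manifold \<A>" and c: "c \<in> \<A>" "x \<in> cmap c ` cdom c"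
  shows "surj (param_deriv \<A> (cinv c) x)"
proof -
  define p where "p = cinv c x"
  have p: "p \<in> cdom c" "cmap c p = x" using chart_homeo(7,8)[OF M c] by (auto simp: p_def)
  define k where "k = chart_at \<A> p"
  have k: "k \<in> \<A>" "p \<in> cdom k" using chart_at[OF M] by (auto simp: k_def)
  have kp: "cinv k (cmap k p) = p" using chart_homeo(6)[OF M k] .
  have "param_deriv \<A> (cinv k) (cmap k p)
      = param_deriv \<A> (cinv c) (cmap c (cinv k (cmap k p))) \<circ> frechet_derivative (cmap c \<circ> cinv k) (at (cmap k p))"
    by (rule param_deriv_chart[OF M smooth_param_cinv[OF M k(1)] _ c(1)]) (use k p kp in auto)
  moreover have "param_deriv \<A> (cinv k) (cmap k p) = (\<lambda>v. v)"
    using mderiv_id[OF M, of p] by (simp add: mderiv_param[OF M] k_def[symmetric] o_def)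
  ultimately have "(\<lambda>v. v) = param_deriv \<A> (cinv c) x \<circ> frechet_derivative (cmap c \<circ> cinv k) (at (cmap k p))"
    by (simp add: kp p)
  then show ?thesis by (metis comp_apply surjI)
qed

subsection \<open>One-forms along parametrizations\<close>

lemma linear_alt_form_1: "alt_form 1 a \<Longrightarrow> linear (\<lambda>v. a [v])"
proof -
  assume a: "alt_form 1 a"
  have "linear (\<lambda>v. a ([0][0 := v]))" using a unfolding alt_form_def by (metis One_nat_def less_one length_Cons list.size(3))
  then show ?thesis by simp
qed

lemma linear_expand:
  fixes f :: "'a::euclidean_space \<Rightarrow> real"
  assumes "linear f"
  shows "f v = (\<Sum>i\<in>Basis. (v \<bullet> i) * f i)"
proof -
  have "f (\<Sum>i\<in>Basis. (v \<bullet> i) *\<^sub>R i) = (\<Sum>i\<in>Basis. (v \<bullet> i) * f i)"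
    using assms by (simp add: linear_sum linear_cmul)
  then show ?thesis by (simp add: euclidean_representation)
qed

text \<open>The right-hand side refers to a single chart \<open>c\<close>, so it can be
  differentiated in \<open>y\<close>; the left-hand side is written in preferred charts that change
  with the point.\<close>

lemma one_form_param_chart:
  assumes M: "smooth_manifold \<A>" and \<omega>: "smooth_form_on \<A> UNIV 1 \<omega>"
    and P: "smooth_param \<A> W \<Psi>" "y \<in> W" and c: "c \<in> \<A>" "\<Psi> y \<in> cdom c"
  shows "\<omega> (\<Psi> y) [param_deriv \<A> \<Psi> y b] =
    (\<Sum>i\<in>Basis. frechet_derivative (\<lambda>y. (cmap c \<circ> \<Psi>) y \<bullet> i) (at y) b * in_chart \<A> c \<omega> (cmap c (\<Psi> y)) [i])"
proof -
  define x where "x = cmap c (\<Psi> y)"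
  have x: "x \<in> cmap c ` cdom c" "cinv c x = \<Psi> y" using c chart_homeo(6)[OF M c] by (auto simp: x_def)
  define X where "X = frechet_derivative (cmap c \<circ> \<Psi>) (at y)"
  have "linear (\<lambda>v. \<omega> (\<Psi> y) [v])" using \<omega> by (intro linear_alt_form_1) (simp add: smooth_form_on_def)
  moreover have "linear (param_deriv \<A> (cinv c) x)"
    by (rule linear_param_deriv[OF M smooth_param_cinv[OF M c(1)] x(1)])
  ultimately have lin: "linear (\<lambda>v. in_chart \<A> c \<omega> x [v])"
    using linear_compose by (force simp: in_chart_param x o_def)
  have "\<omega> (\<Psi> y) [param_deriv \<A> \<Psi> y b] = in_chart \<A> c \<omega> x [X b]"
    unfolding in_chart_param x(2) by (simp add: param_deriv_chart[OF M P c] x_def X_def)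
  also have "\<dots> = (\<Sum>i\<in>Basis. (X b \<bullet> i) * in_chart \<A> c \<omega> x [i])" by (rule linear_expand[OF lin])
  finally have "\<omega> (\<Psi> y) [param_deriv \<A> \<Psi> y b] = (\<Sum>i\<in>Basis. (X b \<bullet> i) * in_chart \<A> c \<omega> x [i])" .
  moreover have "X b \<bullet> i = frechet_derivative (\<lambda>y. (cmap c \<circ> \<Psi>) y \<bullet> i) (at y) b" for i
  proof -
    have "(cmap c \<circ> \<Psi> has_derivative X) (at y)" unfolding X_def
      by (rule has_frechet_derivative[OF smooth_param_differentiable[OF P(1) c(1) P(2) c(2)]])
    then have "((\<lambda>y. (cmap c \<circ> \<Psi>) y \<bullet> i) has_derivative (\<lambda>b. X b \<bullet> i)) (at y)"
      by (rule has_derivative_inner_left)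
    then show ?thesis by (rule frechet_derivative_eqI[THEN fun_cong, symmetric])
  qed
  ultimately show ?thesis by (simp add: x_def)
qed

text \<open>Near each \<open>y\<close> the preferred chart of that one image point is frozen, and
  the expansion in this chart has smooth terms.\<close>

lemma smooth_on_one_form_param:
  assumes M: "smooth_manifold \<A>" and \<omega>: "smooth_form_on \<A> UNIV 1 \<omega>" and P: "smooth_param \<A> W \<Psi>"
  shows "smooth_on W (\<lambda>y. \<omega> (\<Psi> y) [param_deriv \<A> \<Psi> y b])"
proof (rule smooth_on_local)
  fix y assume y: "y \<in> W"
  define c where "c = chart_at \<A> (\<Psi> y)"
  have c: "c \<in> \<A>" "\<Psi> y \<in> cdom c" using chart_at[OF M] by (auto simp: c_def)
  define T where "T = W \<inter> \<Psi> -` cdom c"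
  note T = smooth_param_chart_local[OF M P y c, folded T_def]
  have "smooth_on T (\<lambda>y. \<Sum>i\<in>Basis. frechet_derivative (\<lambda>y. (cmap c \<circ> \<Psi>) y \<bullet> i) (at y) b *
      in_chart \<A> c \<omega> (cmap c (\<Psi> y)) [i])"
  proof (intro smooth_on_sum smooth_on_mult T smooth_on_frechet_derivative)
    fix i :: "real^'b"
    show "smooth_on T (\<lambda>y. (cmap c \<circ> \<Psi>) y \<bullet> i)"
      by (rule smooth_on_linear_comp[OF T(1) bounded_linear_inner_left T(5)])
    have "smooth_on (cmap c ` cdom c) (\<lambda>x. in_chart \<A> c \<omega> x [i])"
      using \<omega> c unfolding smooth_form_on_def by simp
    from smooth_on_compose[OF T(1) _ T(5) this] show "smooth_on T (\<lambda>y. in_chart \<A> c \<omega> (cmap c (\<Psi> y)) [i])"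
      using T(4) by (auto simp: o_def)
  qed
  then have "smooth_on T (\<lambda>y. \<omega> (\<Psi> y) [param_deriv \<A> \<Psi> y b])"
  proof (subst smooth_on_cong[OF T(1)])
    fix y assume "y \<in> T"
    then show "\<omega> (\<Psi> y) [param_deriv \<A> \<Psi> y b] = (\<Sum>i\<in>Basis.
        frechet_derivative (\<lambda>y. (cmap c \<circ> \<Psi>) y \<bullet> i) (at y) b * in_chart \<A> c \<omega> (cmap c (\<Psi> y)) [i])"
      by (intro one_form_param_chart[OF M \<omega> P _ c(1)]) (use T(3,4) in auto)
  qed
  then show "\<exists>T. open T \<and> y \<in> T \<and> smooth_on T (\<lambda>y. \<omega> (\<Psi> y) [param_deriv \<A> \<Psi> y b])" using T by blast
qed

text \<open>The second derivatives of the parametrization cancel because they are symmetric.\<close>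

lemma ext_d_param:
  assumes M: "smooth_manifold \<A>" and \<omega>: "smooth_form_on \<A> UNIV 1 \<omega>" and P: "smooth_param \<A> W \<Psi>" "y \<in> W"
  shows "ext_d \<A> \<omega> (\<Psi> y) [param_deriv \<A> \<Psi> y a, param_deriv \<A> \<Psi> y b] =
    frechet_derivative (\<lambda>y. \<omega> (\<Psi> y) [param_deriv \<A> \<Psi> y b]) (at y) a
    - frechet_derivative (\<lambda>y. \<omega> (\<Psi> y) [param_deriv \<A> \<Psi> y a]) (at y) b"
proof -
  define c where "c = chart_at \<A> (\<Psi> y)"
  have c: "c \<in> \<A>" "\<Psi> y \<in> cdom c" using chart_at[OF M] by (auto simp: c_def)
  define T where "T = W \<inter> \<Psi> -` cdom c"
  note T = smooth_param_chart_local[OF M P c, folded T_def]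
  define x where "x = cmap c (\<Psi> y)"
  have x: "x \<in> cmap c ` cdom c" using c by (auto simp: x_def)
  define \<theta> where "\<theta> i x = in_chart \<A> c \<omega> x [i]" for i x
  define X where "X i y = (cmap c \<circ> \<Psi>) y \<bullet> i" for i y
  define DX where "DX = param_deriv \<A> \<Psi> y"
  have sX: "smooth_on T (X i)" for i
    unfolding X_def by (rule smooth_on_linear_comp[OF T(1) bounded_linear_inner_left T(5)])
  have s\<theta>: "smooth_on (cmap c ` cdom c) (\<theta> i)" for i
    using \<omega> c unfolding smooth_form_on_def \<theta>_def by simp
  have dcX: "(cmap c \<circ> \<Psi> has_derivative DX) (at y)"
    using smooth_param_has_derivative[OF M P] by (simp add: DX_def c_def)
  have DXi: "DX b \<bullet> i = frechet_derivative (X i) (at y) b" for i b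
    using frechet_derivative_eqI[OF has_derivative_inner_left[OF dcX, of i]] by (simp add: X_def[abs_def])
  have d\<theta>: "(\<theta> i has_derivative frechet_derivative (\<theta> i) (at x)) (at x)" for i
    by (rule has_frechet_derivative[OF smooth_on_imp_differentiable[OF s\<theta> x]])
  have d\<theta>': "((\<lambda>y. \<theta> i (cmap c (\<Psi> y))) has_derivative (\<lambda>a. frechet_derivative (\<theta> i) (at x) (DX a))) (at y)" for i
    using diff_chain_at[OF dcX, of "\<theta> i"] d\<theta>[of i] by (simp add: o_def x_def)
  have ddX: "((\<lambda>y. frechet_derivative (X i) (at y) b) has_derivative
      frechet_derivative (\<lambda>y. frechet_derivative (X i) (at y) b) (at y)) (at y)" for i b
    by (rule has_frechet_derivative[OF smooth_on_imp_differentiable[OF smooth_on_frechet_derivative[OF sX] T(2)]])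
  have pull: "\<omega> (\<Psi> y) [param_deriv \<A> \<Psi> y b]
      = (\<Sum>i\<in>Basis. frechet_derivative (X i) (at y) b * \<theta> i (cmap c (\<Psi> y)))" if "y \<in> T" for y b
    unfolding X_def[abs_def] \<theta>_def
    by (rule one_form_param_chart[OF M \<omega> P(1) _ c(1)]) (use T(3,4) that in auto)
  \<comment> \<open>Product rule: each summand gives a derivative of a coefficient
    \<open>\<theta> i\<close> and a second derivative of a coordinate \<open>X i\<close>; only the
    former survive antisymmetrization in \<open>a\<close> and \<open>b\<close>.\<close>
  have D: "frechet_derivative (\<lambda>y. \<omega> (\<Psi> y) [param_deriv \<A> \<Psi> y b]) (at y) a =
      (\<Sum>i\<in>Basis. frechet_derivative (X i) (at y) b * frechet_derivative (\<theta> i) (at x) (DX a)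
        + frechet_derivative (\<lambda>y. frechet_derivative (X i) (at y) b) (at y) a * \<theta> i x)" for a b
  proof -
    have "((\<lambda>y. \<Sum>i\<in>Basis. frechet_derivative (X i) (at y) b * \<theta> i (cmap c (\<Psi> y))) has_derivative
      (\<lambda>a. \<Sum>i\<in>Basis. frechet_derivative (X i) (at y) b * frechet_derivative (\<theta> i) (at x) (DX a)
        + frechet_derivative (\<lambda>y. frechet_derivative (X i) (at y) b) (at y) a * \<theta> i (cmap c (\<Psi> y)))) (at y)"
      by (intro has_derivative_sum has_derivative_mult ddX d\<theta>')
    from frechet_derivative_eqI[OF this] show ?thesis
      by (subst frechet_derivative_cong_open[OF T(1,2) pull]) (auto simp: x_def)
  qed
  have \<theta>_lin: "in_chart \<A> c \<omega> x' [w] = (\<Sum>i\<in>Basis. (w \<bullet> i) * \<theta> i x')" if "x' \<in> cmap c ` cdom c" for x' w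
  proof -
    have "linear (\<lambda>v. \<omega> (cinv c x') [v])" using \<omega> by (intro linear_alt_form_1) (simp add: smooth_form_on_def)
    moreover have "linear (param_deriv \<A> (cinv c) x')"
      by (rule linear_param_deriv[OF M smooth_param_cinv[OF M c(1)] that])
    ultimately have lin: "linear (\<lambda>v. in_chart \<A> c \<omega> x' [v])"
      using linear_compose by (force simp: in_chart_param o_def)
    show ?thesis unfolding \<theta>_def by (rule linear_expand[OF lin])
  qed
  \<comment> \<open>\<open>ext_d\<close> keeps its arguments constant in the chart, so on this side
    only the coefficients are differentiated.\<close>
  have D\<theta>: "frechet_derivative (\<lambda>x. in_chart \<A> c \<omega> x [w]) (at x) v
      = (\<Sum>i\<in>Basis. (w \<bullet> i) * frechet_derivative (\<theta> i) (at x) v)" for w v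
  proof -
    have "((\<lambda>x. \<Sum>i\<in>Basis. (w \<bullet> i) * \<theta> i x) has_derivative
        (\<lambda>v. \<Sum>i\<in>Basis. (w \<bullet> i) * frechet_derivative (\<theta> i) (at x) v)) (at x)"
      by (intro has_derivative_sum has_derivative_mult_right d\<theta>)
    from frechet_derivative_eqI[OF this] show ?thesis
      by (subst frechet_derivative_cong_open[OF chart_homeo(2)[OF M c(1)] x \<theta>_lin]) auto
  qed
  have sym: "frechet_derivative (\<lambda>y. frechet_derivative (X i) (at y) b) (at y) a
      = frechet_derivative (\<lambda>y. frechet_derivative (X i) (at y) a) (at y) b" for i
    by (rule symmetric_second_derivative[OF T(1,2)]) (use sX in \<open>simp add: smooth_on_def\<close>)
  have "ext_d \<A> \<omega> (\<Psi> y) [DX a, DX b] =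
      frechet_derivative (\<lambda>x. in_chart \<A> c \<omega> x [DX b]) (at x) (DX a)
      - frechet_derivative (\<lambda>x. in_chart \<A> c \<omega> x [DX a]) (at x) (DX b)"
    by (simp add: ext_d_def c_def x_def numeral_2_eq_2)
  then show ?thesis
    unfolding D D\<theta> DXi DX_def[symmetric] by (simp add: sum.distrib sym)
qed

subsection \<open>Alternating forms in dimensions two and three\<close>

lemma alt_form_2D:
  assumes "alt_form 2 a"
  shows "linear (\<lambda>v. a [v, w])" "linear (\<lambda>v. a [w, v])" "a [v, v] = 0" "length vs \<noteq> 2 \<Longrightarrow> a vs = 0"
proof -
  have "linear (\<lambda>v. a ([w, w][0 := v]))" "linear (\<lambda>v. a ([w, w][1 := v]))"
    using assms unfolding alt_form_def
    by (metis One_nat_def Suc_1 length_Cons list.size(3) zero_less_numeral, metis One_nat_def Suc_1 length_Cons list.size(3) lessI)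
  then show "linear (\<lambda>v. a [v, w])" "linear (\<lambda>v. a [w, v])" by simp_all
  show "a [v, v] = 0"
    using assms unfolding alt_form_def
    by (elim conjE allE[of _ "[v, v]"] allE[of _ "0::nat"] allE[of _ "1::nat"]) simp
  show "length vs \<noteq> 2 \<Longrightarrow> a vs = 0" using assms unfolding alt_form_def by blast
qed

lemma alt_form_2I:
  assumes "\<And>w. linear (\<lambda>v. a [v, w])" "\<And>w. linear (\<lambda>v. a [w, v])" "\<And>v. a [v, v] = 0"
    "\<And>vs. length vs \<noteq> 2 \<Longrightarrow> a vs = 0"
  shows "alt_form 2 a"
  unfolding alt_form_def
proof (intro conjI allI impI; (elim conjE)?)
  fix vs :: "'a list" and i j :: nat
  { assume "length vs = 2" "i < 2"
    then obtain x y where "vs = [x, y]" "i = 0 \<or> i = 1" by (auto simp: length_Suc_conv numeral_2_eq_2 less_Suc_eq)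
    then show "linear (\<lambda>v. a (vs[i := v]))" using assms by auto }
  { assume "length vs = 2" "i < j" "j < 2" "vs ! i = vs ! j"
    then obtain x y where "vs = [x, y]" "i = 0" "j = 1" by (auto simp: length_Suc_conv numeral_2_eq_2 less_Suc_eq)
    then show "a vs = 0" using assms \<open>vs ! i = vs ! j\<close> by auto }
qed (use assms in auto)

lemma alt_form_2_swap:
  assumes "alt_form 2 a"
  shows "a [y, x] = - a [x, y]"
proof -
  have "a [x + y, x + y] = a [x, x] + a [x, y] + a [y, x] + a [y, y]"
    using linear_add[OF alt_form_2D(1)[OF assms]] linear_add[OF alt_form_2D(2)[OF assms]] by simp
  then show ?thesis using alt_form_2D(3)[OF assms] by simp
qed

lemma alt_form_2_expand:
  assumes a: "alt_form 2 a"
  shows "a [x1 *\<^sub>R u + x2 *\<^sub>R w, y1 *\<^sub>R u + y2 *\<^sub>R w] = (x1 * y2 - x2 * y1) * a [u, w]"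
  using linear_add[OF alt_form_2D(1)[OF a]] linear_add[OF alt_form_2D(2)[OF a]]
    linear_cmul[OF alt_form_2D(1)[OF a]] linear_cmul[OF alt_form_2D(2)[OF a]]
    alt_form_2D(3)[OF a] alt_form_2_swap[OF a, of w u]
  by (simp add: algebra_simps)

lemma alt_form_3D:
  assumes "alt_form 3 a"
  shows "linear (\<lambda>v. a [v, w, z])" "linear (\<lambda>v. a [w, v, z])" "linear (\<lambda>v. a [w, z, v])"
    "a [v, v, w] = 0" "a [v, w, v] = 0" "a [w, v, v] = 0" "length vs \<noteq> 3 \<Longrightarrow> a vs = 0"
proof -
  have L: "linear (\<lambda>v. a (vs[i := v]))" if "length vs = 3" "i < 3" for vs i
    using assms that unfolding alt_form_def by blast
  show "linear (\<lambda>v. a [v, w, z])" using L[of "[w, w, z]" 0] by simp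
  show "linear (\<lambda>v. a [w, v, z])" using L[of "[w, w, z]" 1] by simp
  show "linear (\<lambda>v. a [w, z, v])" using L[of "[w, z, z]" 2] by simp
  have Z: "a vs = 0" if "length vs = 3" "i < j" "j < 3" "vs ! i = vs ! j" for vs i j
    using assms that unfolding alt_form_def by blast
  show "a [v, v, w] = 0" using Z[of "[v, v, w]" 0 1] by simp
  show "a [v, w, v] = 0" using Z[of "[v, w, v]" 0 2] by simp
  show "a [w, v, v] = 0" using Z[of "[w, v, v]" 1 2] by simp
  show "length vs \<noteq> 3 \<Longrightarrow> a vs = 0" using assms unfolding alt_form_def by blast
qed

lemma alt_form_3I:
  assumes "\<And>w z. linear (\<lambda>v. a [v, w, z])" "\<And>w z. linear (\<lambda>v. a [w, v, z])" "\<And>w z. linear (\<lambda>v. a [w, z, v])"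
    "\<And>v w. a [v, v, w] = 0" "\<And>v w. a [v, w, v] = 0" "\<And>v w. a [w, v, v] = 0"
    "\<And>vs. length vs \<noteq> 3 \<Longrightarrow> a vs = 0"
  shows "alt_form 3 a"
  unfolding alt_form_def
proof (intro conjI allI impI; (elim conjE)?)
  fix vs :: "'a list" and i j :: nat
  { assume "length vs = 3" "i < 3"
    then obtain x y z where "vs = [x, y, z]" "i = 0 \<or> i = 1 \<or> i = 2"
      by (auto simp: length_Suc_conv numeral_3_eq_3 less_Suc_eq numeral_2_eq_2)
    then show "linear (\<lambda>v. a (vs[i := v]))" using assms by auto }
  { assume "length vs = 3" "i < j" "j < 3" "vs ! i = vs ! j"
    then obtain x y z where "vs = [x, y, z]" "i = 0 \<and> j = 1 \<or> i = 0 \<and> j = 2 \<or> i = 1 \<and> j = 2"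
      by (auto simp: length_Suc_conv numeral_3_eq_3 less_Suc_eq numeral_2_eq_2)
    then show "a vs = 0" using assms(4-6) \<open>vs ! i = vs ! j\<close> by auto }
qed (use assms in auto)

lemma alt_form_3_swap:
  assumes a: "alt_form 3 a"
  shows "a [y, x, z] = - a [x, y, z]" "a [x, z, y] = - a [x, y, z]"
proof -
  note add = linear_add[OF alt_form_3D(1)[OF a]] linear_add[OF alt_form_3D(2)[OF a]] linear_add[OF alt_form_3D(3)[OF a]]
  note z = alt_form_3D(4-6)[OF a]
  have "a [x + y, x + y, z] = a [x, y, z] + a [y, x, z]" by (simp add: add) (simp add: z)
  then show "a [y, x, z] = - a [x, y, z]" by (simp add: z)
  have "a [x, y + z, y + z] = a [x, y, z] + a [x, z, y]" by (simp add: add) (simp add: z)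
  then show "a [x, z, y] = - a [x, y, z]" by (simp add: z)
qed

text \<open>Repeated arguments kill all but six of the 27 terms; what remains is the determinant of
  the coefficients.\<close>

lemma alt_form_3_expand:
  assumes a: "alt_form 3 a"
  shows "a [x1 *\<^sub>R u + x2 *\<^sub>R v + x3 *\<^sub>R w, y1 *\<^sub>R u + y2 *\<^sub>R v + y3 *\<^sub>R w, z1 *\<^sub>R u + z2 *\<^sub>R v + z3 *\<^sub>R w]
    = (x1 * (y2 * z3 - y3 * z2) - x2 * (y1 * z3 - y3 * z1) + x3 * (y1 * z2 - y2 * z1)) * a [u, v, w]"
proof -
  note add = linear_add[OF alt_form_3D(1)[OF a]] linear_add[OF alt_form_3D(2)[OF a]] linear_add[OF alt_form_3D(3)[OF a]]
    linear_cmul[OF alt_form_3D(1)[OF a]] linear_cmul[OF alt_form_3D(2)[OF a]] linear_cmul[OF alt_form_3D(3)[OF a]]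
  note z = alt_form_3D(4-6)[OF a]
  have p: "a [v, u, w] = - a [u, v, w]" "a [u, w, v] = - a [u, v, w]" "a [v, w, u] = a [u, v, w]"
    "a [w, u, v] = a [u, v, w]" "a [w, v, u] = - a [u, v, w]"
    using alt_form_3_swap[OF a, of u v w] alt_form_3_swap[OF a, of v u w] alt_form_3_swap[OF a, of u w v]
      alt_form_3_swap[OF a, of w v u] by simp_all
  show ?thesis by (simp add: add z p) (simp add: algebra_simps)
qed

section \<open>Top forms as multiples of the determinant\<close>

lemma vec2_expand: "x = (x $ 1) *\<^sub>R axis 1 1 + (x $ 2) *\<^sub>R axis 2 (1::real)" for x :: "real^2"
  by (simp add: vec_eq_iff forall_2 axis_def)

lemma vec3_expand: "x = (x $ 1) *\<^sub>R axis 1 1 + (x $ 2) *\<^sub>R axis 2 1 + (x $ 3) *\<^sub>R axis 3 (1::real)" for x :: "real^3"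
  by (simp add: vec_eq_iff forall_3 axis_def)

lemma std_frame_2: "(std_frame :: (real^2) list) = [axis 1 1, axis 2 1]"
proof -
  have "[1..<Suc CARD(2)] = [1, 2]" by (simp add: upt_rec)
  then show ?thesis unfolding std_frame_def by simp
qed

lemma std_frame_3: "(std_frame :: (real^3) list) = [axis 1 1, axis 2 1, axis 3 1]"
proof -
  have "[1..<Suc CARD(3)] = [1, 2, 3]" by (simp add: upt_rec)
  then show ?thesis unfolding std_frame_def by simp
qed

lemma det_rows_2: "det (vector [x, y] :: real^2^2) = x $ 1 * y $ 2 - x $ 2 * y $ 1"
  by (simp add: det_2)

lemma det_rows_3: "det (vector [x, y, z] :: real^3^3) =
    x $ 1 * (y $ 2 * z $ 3 - y $ 3 * z $ 2) - x $ 2 * (y $ 1 * z $ 3 - y $ 3 * z $ 1)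
    + x $ 3 * (y $ 1 * z $ 2 - y $ 2 * z $ 1)"
  by (simp add: det_3 algebra_simps)

lemma alt_form_2_det:
  fixes a :: "(real^2) list \<Rightarrow> real"
  assumes "alt_form 2 a"
  shows "a [x, y] = det (vector [x, y] :: real^2^2) * a std_frame"
  using alt_form_2_expand[OF assms, of "x $ 1" "axis 1 1" "x $ 2" "axis 2 1" "y $ 1" "y $ 2"]
  by (simp add: std_frame_2 det_rows_2 vec2_expand[symmetric])

lemma alt_form_3_det:
  fixes a :: "(real^3) list \<Rightarrow> real"
  assumes "alt_form 3 a"
  shows "a [x, y, z] = det (vector [x, y, z] :: real^3^3) * a std_frame"
  using alt_form_3_expand[OF assms, of "x $ 1" "axis 1 1" "x $ 2" "axis 2 1" "x $ 3" "axis 3 1" "y $ 1" "y $ 2" "y $ 3"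
      "z $ 1" "z $ 2" "z $ 3"]
  by (simp add: std_frame_3 det_rows_3 vec3_expand[symmetric])

lemma alt_form_2_matrix:
  fixes a :: "(real^2) list \<Rightarrow> real"
  assumes "alt_form 2 a"
  shows "a (map L std_frame) = det (matrix L) * a std_frame"
  using alt_form_2_det[OF assms, of "L (axis 1 1)" "L (axis 2 1)"]
  by (simp add: std_frame_2 det_2 matrix_def algebra_simps)

lemma alt_form_3_matrix:
  fixes a :: "(real^3) list \<Rightarrow> real"
  assumes "alt_form 3 a"
  shows "a (map L std_frame) = det (matrix L) * a std_frame"
  using alt_form_3_det[OF assms, of "L (axis 1 1)" "L (axis 2 1)" "L (axis 3 1)"]
  by (simp add: std_frame_3 det_3 matrix_def algebra_simps)

lemma length_2_conv: "length vs = 2 \<longleftrightarrow> (\<exists>x y. vs = [x, y])"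
  by (auto simp: length_Suc_conv numeral_2_eq_2)

lemma length_3_conv: "length vs = 3 \<longleftrightarrow> (\<exists>x y z. vs = [x, y, z])"
  by (auto simp: length_Suc_conv numeral_3_eq_3)

text \<open>Both forms are multiples of the determinant; comparing them at one frame where
  \<open>b\<close> does not vanish eliminates it.\<close>

lemma alt_form_3_top:
  fixes a b :: "(real^3) list \<Rightarrow> real"
  assumes "alt_form 3 a" "alt_form 3 b" "b us \<noteq> 0"
  shows "a vs = (a us / b us) * b vs"
proof -
  obtain x y z where us: "us = [x, y, z]" using assms alt_form_3D(7) length_3_conv by metis
  show ?thesis
  proof (cases "length vs = 3")
    case True
    then obtain p q r where "vs = [p, q, r]" using length_3_conv by metis
    then show ?thesis
      using alt_form_3_det[OF assms(1)] alt_form_3_det[OF assms(2)] us assms(3) by (simp add: field_simps)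
  qed (use alt_form_3D(7)[OF assms(1)] alt_form_3D(7)[OF assms(2)] in simp)
qed

section \<open>Wedge products in dimension three\<close>

text \<open>The six permutations arise by peeling off 0 and then 1 by transpositions.\<close>

lemma sum_permutations_3:
  "(\<Sum>\<sigma> | \<sigma> permutes {..<3::nat}. of_int (sign \<sigma>) * f (\<sigma> 0) (\<sigma> 1) (\<sigma> 2)) =
    f 0 1 2 - f 0 2 1 - f 1 0 2 + f 1 2 0 + f 2 0 1 - (f 2 1 0 :: real)"
proof -
  have 3: "{..<3::nat} = insert 0 (insert 1 (insert 2 {}))" by auto
  have f: "finite {1, 2::nat}" "0 \<notin> {1, 2::nat}" "finite {2::nat}" "1 \<notin> {2::nat}" by auto
  show ?thesis
    unfolding 3 sum_over_permutations_insert[OF f(1,2)] sum_over_permutations_insert[OF f(3,4)] permutes_sing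
    by (simp add: sign_swap_id permutation_swap_id sign_compose sign_id swap_id_eq transpose_def)
qed

text \<open>The six terms agree in pairs after swapping the two arguments of \<open>b\<close>, which
  cancels the factor \<open>1! 2!\<close>.\<close>

lemma wedge_1_2:
  assumes "alt_form 2 b"
  shows "wedge 1 2 a b [x, y, z] = a [x] * b [y, z] - a [y] * b [x, z] + a [z] * b [x, y]"
proof -
  have m: "map (\<lambda>i. [x, y, z] ! \<sigma> i) [0..<1] = [[x, y, z] ! \<sigma> 0]"
    "map (\<lambda>i. [x, y, z] ! \<sigma> i) [1..<1 + 2] = [[x, y, z] ! \<sigma> 1, [x, y, z] ! \<sigma> 2]" for \<sigma>
    by (simp_all add: upt_rec numeral_2_eq_2)
  have "wedge 1 2 a b [x, y, z] = (\<Sum>\<sigma> | \<sigma> permutes {..<3::nat}. of_int (sign \<sigma>) *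
      (a [[x, y, z] ! \<sigma> 0] * b [[x, y, z] ! \<sigma> 1, [x, y, z] ! \<sigma> 2])) / 2"
    unfolding wedge_def m by (simp add: mult.assoc numeral_3_eq_3)
  also have "\<dots> = a [x] * b [y, z] - a [y] * b [x, z] + a [z] * b [x, y]"
    unfolding sum_permutations_3[of "\<lambda>i j k. a [[x, y, z] ! i] * b [[x, y, z] ! j, [x, y, z] ! k]"]
    using alt_form_2_swap[OF assms, of x y] alt_form_2_swap[OF assms, of x z] alt_form_2_swap[OF assms, of y z]
    by simp
  finally show ?thesis .
qed

text \<open>All six terms are equal by antisymmetry, which cancels the factor
  \<open>3!\<close>.\<close>

lemma wedge_3_0:
  assumes "alt_form 3 a"
  shows "wedge 3 0 a c vs = a vs * c []"
proof (cases "length vs = 3")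
  case True
  then obtain x y z where vs: "vs = [x, y, z]" using length_3_conv by metis
  have m: "map (\<lambda>i. [x, y, z] ! \<sigma> i) [0..<3] = [[x, y, z] ! \<sigma> 0, [x, y, z] ! \<sigma> 1, [x, y, z] ! \<sigma> 2]" for \<sigma>
    by (simp add: upt_rec numeral_2_eq_2)
  have f3: "fact 3 = (6::real)" by (simp add: fact_numeral)
  have "wedge 3 0 a c vs = (\<Sum>\<sigma> | \<sigma> permutes {..<3::nat}. of_int (sign \<sigma>) *
      (a [[x, y, z] ! \<sigma> 0, [x, y, z] ! \<sigma> 1, [x, y, z] ! \<sigma> 2] * c [])) / 6"
    unfolding wedge_def vs using f3 by (simp add: m mult.assoc)
  also have "\<dots> = a vs * c []"
    unfolding sum_permutations_3[of "\<lambda>i j k. a [[x, y, z] ! i, [x, y, z] ! j, [x, y, z] ! k] * c []"] vs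
    using alt_form_3_swap[OF assms, of x y z] alt_form_3_swap[OF assms, of y x z] alt_form_3_swap[OF assms, of x z y]
      alt_form_3_swap[OF assms, of z y x]
    by simp
  finally show ?thesis .
qed (use alt_form_3D(7)[OF assms] in \<open>simp add: wedge_def\<close>)

subsection \<open>Orthonormal frames\<close>

definition inner_form :: "(real^'n \<Rightarrow> real^'n \<Rightarrow> real) \<Rightarrow> bool" where
  "inner_form g \<longleftrightarrow> bilinear g \<and> (\<forall>v w. g v w = g w v) \<and> (\<forall>v. v \<noteq> 0 \<longrightarrow> g v v > 0)"

lemma inner_formD:
  assumes "inner_form g"
  shows "linear (\<lambda>v. g v w)" "linear (\<lambda>v. g w v)" "g v w = g w v" "v \<noteq> 0 \<Longrightarrow> g v v > 0"
  using assms by (auto simp: inner_form_def bilinear_def)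

lemma inner_form_simps:
  assumes "inner_form g"
  shows "g (x + y) z = g x z + g y z" "g z (x + y) = g z x + g z y"
    "g (x - y) z = g x z - g y z" "g z (x - y) = g z x - g z y"
    "g (c *\<^sub>R x) z = c * g x z" "g z (c *\<^sub>R x) = c * g z x"
    "g 0 z = 0" "g z 0 = 0" "g (sum f S) z = (\<Sum>i\<in>S. g (f i) z)"
  using linear_add[OF inner_formD(1)[OF assms]] linear_add[OF inner_formD(2)[OF assms]]
    linear_diff[OF inner_formD(1)[OF assms]] linear_diff[OF inner_formD(2)[OF assms]]
    linear_cmul[OF inner_formD(1)[OF assms]] linear_cmul[OF inner_formD(2)[OF assms]]
    linear_0[OF inner_formD(1)[OF assms]] linear_0[OF inner_formD(2)[OF assms]]
    linear_sum[OF inner_formD(1)[OF assms]] by simp_all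

text \<open>Lists shorter than the dimension are allowed, so that orthonormal frames can be built
  one vector at a time.\<close>

definition on_list :: "(real^'n \<Rightarrow> real^'n \<Rightarrow> real) \<Rightarrow> (real^'n) list \<Rightarrow> bool" where
  "on_list g es \<longleftrightarrow> (\<forall>i<length es. \<forall>j<length es. g (es ! i) (es ! j) = (if i = j then 1 else 0))"

lemma on_list_orthogonal_remainder:
  assumes g: "inner_form g" and es: "on_list g es" and j: "j < length es"
  shows "g (v - (\<Sum>i<length es. g v (es ! i) *\<^sub>R es ! i)) (es ! j) = 0"
proof -
  have "g (v - (\<Sum>i<length es. g v (es ! i) *\<^sub>R es ! i)) (es ! j)
      = g v (es ! j) - (\<Sum>i<length es. g v (es ! i) * g (es ! i) (es ! j))"
    by (simp add: inner_form_simps[OF g])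
  also have "(\<Sum>i<length es. g v (es ! i) * g (es ! i) (es ! j)) = (\<Sum>i<length es. if i = j then g v (es ! i) else 0)"
    using es j by (intro sum.cong) (auto simp: on_list_def)
  finally show ?thesis using j by simp
qed

lemma on_list_independent:
  assumes g: "inner_form g" and es: "on_list g es"
  shows "distinct es" "independent (set es)"
proof -
  show d: "distinct es"
    using es unfolding distinct_conv_nth on_list_def by (metis zero_neq_one)
  show "independent (set es)"
  proof (rule independent_if_scalars_zero)
    fix f x assume f: "(\<Sum>x\<in>set es. f x *\<^sub>R x) = 0" and x: "x \<in> set es"
    have on: "g y x = (if y = x then 1 else 0)" if "y \<in> set es" for y
      using es that x d unfolding on_list_def by (metis in_set_conv_nth)
    have "0 = g (\<Sum>y\<in>set es. f y *\<^sub>R y) x" using f by (simp add: inner_form_simps[OF g])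
    also have "\<dots> = (\<Sum>y\<in>set es. f y * g y x)"
      by (simp add: inner_form_simps[OF g])
    also have "\<dots> = (\<Sum>y\<in>set es. if y = x then f y else 0)" using on by (intro sum.cong) auto
    also have "\<dots> = f x" using x by simp
    finally show "f x = 0" by simp
  qed simp
qed

lemma on_list_length_le:
  fixes g :: "real^'n \<Rightarrow> real^'n \<Rightarrow> real"
  assumes "inner_form g" "on_list g es"
  shows "length es \<le> CARD('n)"
  using independent_bound[OF on_list_independent(2)[OF assms]] distinct_card[OF on_list_independent(1)[OF assms]] by simp

lemma on_list_extend:
  assumes g: "inner_form g" and es: "on_list g es" and w: "w \<noteq> 0" "\<And>j. j < length es \<Longrightarrow> g w (es ! j) = 0"
  shows "\<exists>e. on_list g (es @ [e])"
proof -
  have pos: "g w w > 0" using inner_formD(4)[OF g] w(1) .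
  define e where "e = (1 / sqrt (g w w)) *\<^sub>R w"
  have ee: "g e e = 1"
    using pos by (simp add: e_def inner_form_simps[OF g])
  have ej: "g e (es ! j) = 0" "g (es ! j) e = 0" if "j < length es" for j
    using w(2)[OF that] inner_formD(3)[OF g, of "es ! j" w] by (simp_all add: e_def inner_form_simps[OF g])
  have "on_list g (es @ [e])"
    using es ee ej unfolding on_list_def by (auto simp: nth_append less_Suc_eq)
  then show ?thesis by blast
qed

text \<open>A nonzero remainder could be normalized and appended, giving more independent vectors
  than the dimension allows.\<close>

lemma on_list_expand:
  fixes g :: "real^'n \<Rightarrow> real^'n \<Rightarrow> real"
  assumes g: "inner_form g" and es: "on_list g es" "length es = CARD('n)"
  shows "v = (\<Sum>i<CARD('n). g v (es ! i) *\<^sub>R es ! i)"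
proof (rule ccontr)
  assume "\<not> ?thesis"
  then have "v - (\<Sum>i<length es. g v (es ! i) *\<^sub>R es ! i) \<noteq> 0" using es by simp
  from on_list_extend[OF g es(1) this on_list_orthogonal_remainder[OF g es(1)]]
  obtain e where "on_list g (es @ [e])" by blast
  from on_list_length_le[OF g this] show False using es by simp
qed

text \<open>Gram-Schmidt, one vector at a time: anything outside the span leaves a nonzero
  orthogonal remainder. With \<open>k\<close> the dimension this shows that the choice in
  \<open>on_frame\<close> succeeds.\<close>

lemma on_list_exists:
  fixes g :: "real^'n \<Rightarrow> real^'n \<Rightarrow> real"
  assumes g: "inner_form g" and "k \<le> CARD('n)"
  shows "\<exists>es. on_list g es \<and> length es = k"
  using assms(2)
proof (induction k)
  case 0
  show ?case by (intro exI[of _ "[]"]) (simp add: on_list_def)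
next
  case (Suc k)
  then obtain es where es: "on_list g es" "length es = k" by auto
  have "card (set es) < DIM(real^'n)" using es card_length[of es] Suc.prems by simp
  then have "span (set es) \<noteq> UNIV"
    using dim_le_card'[of "set es"] dim_span[of "set es"] by (metis dim_UNIV List.finite_set DIM_cart DIM_real mult.right_neutral not_le)
  then obtain v where v: "v \<notin> span (set es)" by blast
  have "(\<Sum>i<length es. g v (es ! i) *\<^sub>R es ! i) \<in> span (set es)"
    by (intro span_sum span_scale span_base) simp
  then have "v - (\<Sum>i<length es. g v (es ! i) *\<^sub>R es ! i) \<noteq> 0" using v by auto
  from on_list_extend[OF g es(1) this on_list_orthogonal_remainder[OF g es(1)]]
  obtain e where "on_list g (es @ [e])" by blast
  then show ?case using es by (intro exI[of _ "es @ [e]"]) simp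
qed

lemma on_frame:
  fixes g :: "real^'n \<Rightarrow> real^'n \<Rightarrow> real"
  assumes g: "inner_form g"
  shows "on_list g (on_frame g)" "length (on_frame g) = CARD('n)"
proof -
  have "\<exists>es. length es = CARD('n) \<and> (\<forall>i<CARD('n). \<forall>j<CARD('n). g (es ! i) (es ! j) = (if i = j then 1 else 0))"
    using on_list_exists[OF g order_refl] unfolding on_list_def by metis
  from someI_ex[OF this] show "on_list g (on_frame g)" "length (on_frame g) = CARD('n)"
    unfolding on_list_def on_frame_def by auto
qed

lemma inner_form_expand:
  fixes g :: "real^'n \<Rightarrow> real^'n \<Rightarrow> real"
  assumes g: "inner_form g"
  shows "v = (\<Sum>i<CARD('n). g v (on_frame g ! i) *\<^sub>R on_frame g ! i)"
  by (rule on_list_expand[OF g on_frame[OF g]])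

lemma inner_form_parseval:
  fixes g :: "real^'n \<Rightarrow> real^'n \<Rightarrow> real"
  assumes g: "inner_form g"
  shows "g v w = (\<Sum>i<CARD('n). g v (on_frame g ! i) * g w (on_frame g ! i))"
proof -
  have "g v w = g (\<Sum>i<CARD('n). g v (on_frame g ! i) *\<^sub>R on_frame g ! i) w"
    using inner_form_expand[OF g, of v] by simp
  also have "\<dots> = (\<Sum>i<CARD('n). g v (on_frame g ! i) * g (on_frame g ! i) w)"
    by (simp add: inner_form_simps[OF g])
  finally show ?thesis using inner_formD(3)[OF g, of _ w] by simp
qed

section \<open>Inner products of forms in an orthonormal frame\<close>

lemma lists_Nil_eq: "{js. js = [] \<and> set js \<subseteq> S} = {[]}"
  by auto

text \<open>The recursion by which the sum over index lists in \<open>form_inner\<close> is unrolled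
  for small degrees.\<close>

lemma sum_lists_Suc:
  assumes "finite S"
  shows "(\<Sum>js | length js = Suc n \<and> set js \<subseteq> S. f js) =
    (\<Sum>j\<in>S. \<Sum>js | length js = n \<and> set js \<subseteq> S. f (j # js))"
proof -
  have fin: "finite {js. length js = n \<and> set js \<subseteq> S}"
    using finite_lists_length_eq[OF assms, of n] by (simp add: conj_commute)
  have eq: "{js. length js = Suc n \<and> set js \<subseteq> S} = (\<lambda>(j, js). j # js) ` (S \<times> {js. length js = n \<and> set js \<subseteq> S})"
    by (auto simp: length_Suc_conv image_iff)
  have inj: "inj_on (\<lambda>(j, js). j # js) (S \<times> {js. length js = n \<and> set js \<subseteq> S})"
    by (auto simp: inj_on_def)
  show ?thesis
    unfolding eq sum.reindex[OF inj] sum.cartesian_product by (simp add: case_prod_unfold)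
qed

lemma alt_form_scale:
  assumes "alt_form k a"
  shows "alt_form k (\<lambda>vs. c * a vs)"
proof -
  have "linear (\<lambda>v. c * f v)" if "linear f" for f :: "'a \<Rightarrow> real"
    using linear_compose_scale_right[OF that, of c] by simp
  then show ?thesis using assms unfolding alt_form_def by simp
qed

text \<open>Index lists with a repetition contribute nothing, and the two orderings of 0 and 1
  contribute equally, which cancels the \<open>2!\<close>.\<close>

lemma form_inner_2:
  assumes "alt_form 2 a" "alt_form 2 b"
  shows "form_inner (g :: real^2 \<Rightarrow> real^2 \<Rightarrow> real) 2 a b
    = a [on_frame g ! 0, on_frame g ! 1] * b [on_frame g ! 0, on_frame g ! 1]"
proof -
  have s: "{..<2::nat} = {0, 1}" by auto
  have 2: "(2::nat) = Suc (Suc 0)" by simp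
  define x y where "x = on_frame g ! 0" "y = on_frame g ! Suc 0"
  have p: "a [y, x] = - a [x, y]" "b [y, x] = - b [x, y]"
    using alt_form_2_swap assms by blast+
  have "(\<Sum>js | length js = 2 \<and> set js \<subseteq> {..<CARD(2)}. a (map (\<lambda>j. on_frame g ! j) js) * b (map (\<lambda>j. on_frame g ! j) js))
    = 2 * (a [x, y] * b [x, y])"
    unfolding 2
    by (simp add: s sum_lists_Suc lists_Nil_eq alt_form_2D(3)[OF assms(1)] x_y_def[symmetric] p)
  then show ?thesis unfolding form_inner_def by (simp add: x_y_def)
qed

lemma form_inner_3:
  assumes "alt_form 3 a" "alt_form 3 b"
  shows "form_inner (g :: real^3 \<Rightarrow> real^3 \<Rightarrow> real) 3 a b
    = a [on_frame g ! 0, on_frame g ! 1, on_frame g ! 2] * b [on_frame g ! 0, on_frame g ! 1, on_frame g ! 2]"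
proof -
  have s: "{..<3::nat} = {0, 1, 2}" by auto
  have 3: "(3::nat) = Suc (Suc (Suc 0))" by simp
  define x y z where "x = on_frame g ! 0" "y = on_frame g ! Suc 0" "z = on_frame g ! 2"
  note sw = alt_form_3_swap[OF assms(1), of x y z] alt_form_3_swap[OF assms(1), of y x z]
    alt_form_3_swap[OF assms(1), of x z y] alt_form_3_swap[OF assms(1), of z y x]
    alt_form_3_swap[OF assms(2), of x y z] alt_form_3_swap[OF assms(2), of y x z]
    alt_form_3_swap[OF assms(2), of x z y] alt_form_3_swap[OF assms(2), of z y x]
  have p: "c [y, x, z] = - c [x, y, z]" "c [x, z, y] = - c [x, y, z]" "c [y, z, x] = c [x, y, z]"
    "c [z, x, y] = c [x, y, z]" "c [z, y, x] = - c [x, y, z]" if "c = a \<or> c = b" for c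
    using that sw by auto
  have f3: "fact 3 = (6::real)" by (simp add: fact_numeral)
  have "(\<Sum>js | length js = 3 \<and> set js \<subseteq> {..<CARD(3)}. a (map (\<lambda>j. on_frame g ! j) js) * b (map (\<lambda>j. on_frame g ! j) js))
    = 6 * (a [x, y, z] * b [x, y, z])"
    unfolding 3
    by (simp add: s sum_lists_Suc lists_Nil_eq alt_form_3D(4-6)[OF assms(1)]
        x_y_z_def[symmetric] p)
  then show ?thesis unfolding form_inner_def f3 by (simp add: x_y_z_def)
qed

lemma form_inner_1:
  "form_inner (g :: real^'n \<Rightarrow> real^'n \<Rightarrow> real) 1 a b = (\<Sum>j<CARD('n). a [on_frame g ! j] * b [on_frame g ! j])"
  unfolding form_inner_def One_nat_def
  by (simp add: sum_lists_Suc lists_Nil_eq)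

subsection \<open>Area forms\<close>

lemma bilinear_2_expand:
  fixes g :: "real^2 \<Rightarrow> real^2 \<Rightarrow> real"
  assumes g: "inner_form g"
  shows "g x y = x $ 1 * y $ 1 * g (axis 1 1) (axis 1 1) + (x $ 1 * y $ 2 + x $ 2 * y $ 1) * g (axis 1 1) (axis 2 1)
    + x $ 2 * y $ 2 * g (axis 2 1) (axis 2 1)"
proof -
  have "g x y = g ((x $ 1) *\<^sub>R axis 1 1 + (x $ 2) *\<^sub>R axis 2 1) ((y $ 1) *\<^sub>R axis 1 1 + (y $ 2) *\<^sub>R axis 2 1)"
    by (simp flip: vec2_expand)
  also have "\<dots> = x $ 1 * y $ 1 * g (axis 1 1) (axis 1 1) + (x $ 1 * y $ 2 + x $ 2 * y $ 1) * g (axis 1 1) (axis 2 1)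
    + x $ 2 * y $ 2 * g (axis 2 1) (axis 2 1)"
    using inner_formD(3)[OF g, of "axis 2 1" "axis 1 1"] by (simp add: inner_form_simps[OF g] algebra_simps)
  finally show ?thesis .
qed

text \<open>Lagrange's identity relative to a metric: the Gram determinant scales with the square of
  the determinant of the vectors.\<close>

lemma gram_2:
  fixes g :: "real^2 \<Rightarrow> real^2 \<Rightarrow> real"
  assumes g: "inner_form g"
  shows "g x x * g y y - (g x y)\<^sup>2 =
    det (\<chi> i j. g (axis i 1) (axis j 1)) * (det (vector [x, y] :: real^2^2))\<^sup>2"
  unfolding bilinear_2_expand[OF g, of x] bilinear_2_expand[OF g, of y] det_rows_2
  using inner_formD(3)[OF g, of "axis 2 1" "axis 1 1"]
  by (simp add: det_2 power2_eq_square algebra_simps)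

lemma inner_form_gram_pos:
  fixes g :: "real^2 \<Rightarrow> real^2 \<Rightarrow> real"
  assumes g: "inner_form g"
  shows "det (\<chi> i j. g (axis i 1) (axis j 1)) > 0"
proof -
  define a b c where "a = g (axis 1 1) (axis 1 1)" "b = g (axis 1 1) (axis 2 1)" "c = g (axis 2 1) (axis 2 1)"
  have sym: "g (axis 2 1) (axis 1 1) = b" using inner_formD(3)[OF g] by (simp add: a_b_c_def)
  have "c > 0" unfolding a_b_c_def by (rule inner_formD(4)[OF g]) (simp add: axis_eq_0_iff)
  \<comment> \<open>This is \<open>c\<close> times the part of the first basis vector orthogonal to
    the second; its squared length is \<open>c (a c - b^2)\<close>.\<close>
  have "c *\<^sub>R axis 1 1 - b *\<^sub>R axis 2 (1::real) \<noteq> (0::real^2)"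
    using \<open>c > 0\<close> by (auto simp: vec_eq_iff forall_2 axis_def)
  from inner_formD(4)[OF g this] have "c * (a * c - b\<^sup>2) > 0"
    using sym by (simp add: inner_form_simps[OF g] a_b_c_def[symmetric] algebra_simps power2_eq_square)
  with \<open>c > 0\<close> have "a * c - b\<^sup>2 > 0" by (simp add: zero_less_mult_iff)
  then show ?thesis by (simp add: det_2 sym a_b_c_def[symmetric] power2_eq_square)
qed

lemma riem_vol_2: "riem_vol h x [v, w] = sqrt (det (\<chi> i j. h x (axis i 1) (axis j 1))) * det (vector [v, w] :: real^2^2)"
  by (simp add: riem_vol_def)

lemma alt_form_riem_vol: "alt_form 2 (riem_vol h x :: (real^2) list \<Rightarrow> real)"
proof (rule alt_form_2I)
  fix w :: "real^2"
  show "linear (\<lambda>v. riem_vol h x [v, w])" "linear (\<lambda>v. riem_vol h x [w, v])"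
    unfolding riem_vol_2 det_rows_2 by (auto intro!: linearI simp: algebra_simps)
  show "riem_vol h x [w, w] = 0" by (simp add: riem_vol_2 det_rows_2)
qed (simp add: riem_vol_def)

text \<open>The square determines the area form up to sign; the sign is supplied separately, by
  orientations.\<close>

lemma riem_vol_gram:
  fixes h :: "('m, 2) metric"
  assumes "inner_form (h x)"
  shows "(riem_vol h x [v, w])\<^sup>2 = h x v v * h x w w - (h x v w)\<^sup>2"
  unfolding gram_2[OF assms] riem_vol_2 power_mult_distrib
  using inner_form_gram_pos[OF assms] by simp

lemma riem_vol_pos_iff:
  fixes h :: "('m, 2) metric"
  assumes "inner_form (h x)"
  shows "riem_vol h x [v, w] > 0 \<longleftrightarrow> det (vector [v, w] :: real^2^2) > 0"
  unfolding riem_vol_2 using inner_form_gram_pos[OF assms] by (simp add: zero_less_mult_iff)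

lemma riem_vol_on_frame:
  fixes h :: "('m, 2) metric"
  assumes "inner_form (h x)"
  shows "(riem_vol h x [on_frame (h x) ! 0, on_frame (h x) ! 1])\<^sup>2 = 1"
proof -
  have "h x (on_frame (h x) ! i) (on_frame (h x) ! j) = (if i = j then 1 else 0)" if "i < 2" "j < 2" for i j
    using on_frame[OF assms] that unfolding on_list_def by simp
  then show ?thesis unfolding riem_vol_gram[of h x, OF assms] by simp
qed

lemma form_inner_riem_vol:
  fixes h :: "('m, 2) metric"
  assumes "inner_form (h x)"
  shows "form_inner (h x) 2 (\<lambda>vs. k * riem_vol h x vs) (\<lambda>vs. l * riem_vol h x vs) = k * l"
proof -
  have alt: "alt_form 2 (\<lambda>vs. k * riem_vol h x vs)" for k
    by (rule alt_form_scale[OF alt_form_riem_vol])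
  show ?thesis unfolding form_inner_2[OF alt alt]
    using riem_vol_on_frame[of h x, OF assms] by (simp add: power2_eq_square algebra_simps)
qed

subsection \<open>The Kaluza--Klein metric on a tangent space\<close>

text \<open>The situation on one tangent space of the bundle: \<open>p\<close> is the differential
  of the projection, \<open>a\<close> the connection and \<open>v\<close> the generator of the
  action. The area form \<nu> is fixed only up to sign, which suffices because the results below
  depend on its square or hold for either sign.\<close>

locale vertical_splitting =
  fixes p :: "real^3 \<Rightarrow> real^2" and a :: "(real^3) list \<Rightarrow> real" and v :: "real^3"
    and h :: "real^2 \<Rightarrow> real^2 \<Rightarrow> real" and \<nu> :: "(real^2) list \<Rightarrow> real"
  assumes p: "linear p" "surj p" "p v = 0" and a: "alt_form 1 a" "a [v] = 1"
    and h: "inner_form h" and \<nu>: "alt_form 2 \<nu>" "\<And>x y. (\<nu> [x, y])\<^sup>2 = h x x * h y y - (h x y)\<^sup>2"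
begin

definition g :: "real^3 \<Rightarrow> real^3 \<Rightarrow> real" where "g x y = h (p x) (p y) + a [x] * a [y]"

definition vol :: "(real^3) list \<Rightarrow> real" where "vol = wedge 1 2 a (\<lambda>vs. \<nu> (map p vs))"

lemmas la = linear_alt_form_1[OF a(1)]

lemma alt_pull: "alt_form 2 (\<lambda>vs. \<nu> (map p vs))"
  using linear_compose[OF p(1) alt_form_2D(1)[OF \<nu>(1)]] linear_compose[OF p(1) alt_form_2D(2)[OF \<nu>(1)]]
    alt_form_2D(3,4)[OF \<nu>(1)]
  by (intro alt_form_2I) (auto simp: o_def)

lemma vol_eq: "vol [x, y, z] = a [x] * \<nu> [p y, p z] - a [y] * \<nu> [p x, p z] + a [z] * \<nu> [p x, p y]"
  unfolding vol_def wedge_1_2[OF alt_pull] by simp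

lemma alt_vol: "alt_form 3 vol"
proof (rule alt_form_3I)
  note l = linear_add[OF la] linear_cmul[OF la] linear_add[OF p(1)] linear_cmul[OF p(1)]
    linear_add[OF alt_form_2D(1)[OF \<nu>(1)]] linear_cmul[OF alt_form_2D(1)[OF \<nu>(1)]]
    linear_add[OF alt_form_2D(2)[OF \<nu>(1)]] linear_cmul[OF alt_form_2D(2)[OF \<nu>(1)]]
  fix w z :: "real^3"
  show "linear (\<lambda>v. vol [v, w, z])" "linear (\<lambda>v. vol [w, v, z])" "linear (\<lambda>v. vol [w, z, v])"
    unfolding vol_eq by (rule linearI; simp add: l algebra_simps)+
  show "vol [w, w, z] = 0" "vol [w, z, w] = 0" "vol [z, w, w] = 0"
    unfolding vol_eq using alt_form_2_swap[OF \<nu>(1), of "p z" "p w"] alt_form_2D(3)[OF \<nu>(1)] by simp_all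
qed (simp add: vol_def wedge_def)

lemma vol_v: "vol [v, x, y] = \<nu> [p x, p y]"
  unfolding vol_eq using p(3) a(2) linear_0[OF alt_form_2D(1)[OF \<nu>(1)]] by simp

text \<open>Any preimage under \<open>p\<close> can be corrected along \<open>v\<close>, which
  \<open>p\<close> kills and on which \<open>a\<close> is 1.\<close>

lemma lift: obtains u where "p u = e" "a [u] = t"
proof -
  obtain w where w: "p w = e" using p(2) by (metis surjD)
  have "p (w + (t - a [w]) *\<^sub>R v) = e" "a [w + (t - a [w]) *\<^sub>R v] = t"
    using w p(3) a(2) by (simp_all add: linear_add[OF p(1)] linear_cmul[OF p(1)] linear_add[OF la] linear_cmul[OF la])
  then show thesis by (rule that)
qed

text \<open>The map \<open>(a, p)\<close> into \<open>real^3\<close> is onto by \<open>lift\<close>,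
  hence one-to-one by equality of dimensions.\<close>

lemma kernel:
  assumes "p x = 0" "a [x] = 0"
  shows "x = 0"
proof -
  define T :: "real^3 \<Rightarrow> real^3" where "T x = vector [a [x], p x $ 1, p x $ 2]" for x
  have lT: "linear T"
    by (rule linearI) (simp_all add: T_def vec_eq_iff forall_3 linear_add[OF p(1)] linear_cmul[OF p(1)]
        linear_add[OF la] linear_cmul[OF la])
  have "surj T"
    unfolding surj_def
  proof
    fix y :: "real^3"
    obtain u where "p u = vector [y $ 2, y $ 3]" "a [u] = y $ 1" by (rule lift)
    then have "y = T u" by (simp add: T_def vec_eq_iff forall_3)
    then show "\<exists>x. y = T x" by blast
  qed
  then have "inj T" using linear_surj_imp_inj[OF lT] by blast
  moreover have "T x = T 0"
    using assms by (simp add: T_def linear_0[OF p(1)] linear_0[OF la])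
  ultimately show ?thesis by (simp add: inj_def)
qed

lemma inner_g: "inner_form g"
  unfolding inner_form_def bilinear_def
proof (intro conjI allI impI)
  note l = linear_add[OF la] linear_cmul[OF la] linear_add[OF p(1)] linear_cmul[OF p(1)] inner_form_simps[OF h]
  fix x y :: "real^3"
  show "linear (\<lambda>y. g x y)" "linear (\<lambda>x. g x y)"
    unfolding g_def by (rule linearI; simp add: l algebra_simps)+
  show "g x y = g y x" unfolding g_def using inner_formD(3)[OF h, of "p x"] by simp
  assume "x \<noteq> 0"
  show "g x x > 0"
  proof (cases "p x = 0")
    case True
    then have "a [x] \<noteq> 0" using kernel \<open>x \<noteq> 0\<close> by blast
    then show ?thesis using True by (simp add: g_def inner_form_simps[OF h] power2_eq_square[symmetric])
  next
    case False
    from inner_formD(4)[OF h this] show ?thesis unfolding g_def by (simp add: add_pos_nonneg)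
  qed
qed

lemma g_v: "g v x = a [x]"
  using p(3) a(2) by (simp add: g_def inner_form_simps[OF h])

definition frame :: "(real^3) list" where
  "frame = [on_frame g ! 0, on_frame g ! 1, on_frame g ! 2]"

text \<open>The frame picked by \<open>on_frame\<close> is an unspecified choice, so it is compared
  with an adapted one: \<open>v\<close> and horizontal lifts of an orthonormal frame of
  \<open>h\<close>. The matrix between them is orthogonal, so its determinant is 1 or -1.\<close>

lemma vol_frame: "(vol frame)\<^sup>2 = 1"
proof -
  define e where "e i = on_frame g ! i" for i
  obtain u where u: "p u = on_frame h ! 0" "a [u] = 0" by (rule lift)
  obtain w where w: "p w = on_frame h ! 1" "a [w] = 0" by (rule lift)
  have oh: "h (on_frame h ! i) (on_frame h ! j) = (if i = j then 1 else 0)" if "i < 2" "j < 2" for i j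
    using on_frame[OF h] that unfolding on_list_def by simp
  have on: "g v v = 1" "g v u = 0" "g v w = 0" "g u u = 1" "g u w = 0" "g w w = 1"
    using oh u w p(3) a(2) by (simp_all add: g_def inner_form_simps[OF h])
  have s: "{..<CARD(3)} = {0, 1, 2}" by auto
  have ex: "x = g x (e 0) *\<^sub>R e 0 + g x (e 1) *\<^sub>R e 1 + g x (e 2) *\<^sub>R e 2" for x
    using inner_form_expand[OF inner_g, of x] unfolding s by (simp add: e_def add.assoc)
  have pa: "g x (e 0) * g y (e 0) + g x (e 1) * g y (e 1) + g x (e 2) * g y (e 2) = g x y" for x y
    using inner_form_parseval[OF inner_g, of x y] unfolding s by (simp add: e_def add.assoc)
  define C :: "real^3^3" where "C = vector [vector [g v (e 0), g v (e 1), g v (e 2)],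
    vector [g u (e 0), g u (e 1), g u (e 2)], vector [g w (e 0), g w (e 1), g w (e 2)]]"
  \<comment> \<open>By Parseval the products of rows of \<open>C\<close> are the inner products of
    the adapted frame.\<close>
  have "C ** transpose C = mat 1"
    using pa[of v v] pa[of v u] pa[of v w] pa[of u u] pa[of u w] pa[of w w] on
    by (simp add: C_def matrix_matrix_mult_def transpose_def mat_def vec_eq_iff forall_3 sum_3 mult.commute)
  then have "det C * det C = 1" by (metis det_I det_mul det_transpose)
  moreover have "vol [v, u, w] = det C * vol [e 0, e 1, e 2]"
    using alt_form_3_expand[OF alt_vol, of "g v (e 0)" "e 0" "g v (e 1)" "e 1" "g v (e 2)" "e 2"
        "g u (e 0)" "g u (e 1)" "g u (e 2)" "g w (e 0)" "g w (e 1)" "g w (e 2)"]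
    unfolding ex[symmetric] C_def det_rows_3 by simp
  moreover have "(vol [v, u, w])\<^sup>2 = 1"
    unfolding vol_v u w \<nu>(2) using oh by simp
  ultimately have "(det C * vol [e 0, e 1, e 2])\<^sup>2 = 1" "(det C)\<^sup>2 = 1"
    by (simp_all only: power2_eq_square[of "det C"])
  then have "(vol [e 0, e 1, e 2])\<^sup>2 = 1" by (simp only: power_mult_distrib mult_1)
  then show ?thesis by (simp add: frame_def e_def)
qed

lemma frame_nonzero: "vol frame \<noteq> 0"
  using vol_frame by auto

lemma alt_scale_vol: "alt_form 3 (\<lambda>vs. k * vol vs)"
  by (rule alt_form_scale[OF alt_vol])

text \<open>The candidate is the 0-form with value \<open>k\<close>: on the chosen frame
  \<open>vol\<close> is 1 or -1, so dividing and multiplying by it agree. Testing against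
  \<open>vol\<close> itself at that frame gives uniqueness.\<close>

lemma hodge_vol: "hodge g vol 3 (\<lambda>vs. k * vol vs) [] = k"
proof -
  define c0 :: "(real^3) list \<Rightarrow> real" where "c0 vs = (if vs = [] then k else 0)" for vs
  have c0: "alt_form 0 c0" by (auto simp: alt_form_def c0_def)
  have fi: "form_inner g 3 b (\<lambda>vs. k * vol vs) = b frame * (k * vol frame)" if "alt_form 3 b" for b
    using form_inner_3[OF that alt_scale_vol[of k]] by (simp add: frame_def)
  have "hodge g vol 3 (\<lambda>vs. k * vol vs) = c0"
    unfolding hodge_def
  proof (rule the_equality)
    have "wedge 3 0 b c0 = (\<lambda>vs. form_inner g 3 b (\<lambda>vs. k * vol vs) * vol vs)" if b: "alt_form 3 b" for b
    proof
      fix vs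
      have "b vs = b frame / vol frame * vol vs" by (rule alt_form_3_top[OF b alt_vol frame_nonzero])
      also have "b frame / vol frame = b frame * vol frame"
        using vol_frame frame_nonzero by (simp add: divide_eq_eq power2_eq_square mult.assoc)
      finally show "wedge 3 0 b c0 vs = form_inner g 3 b (\<lambda>vs. k * vol vs) * vol vs"
        by (simp add: wedge_3_0[OF b] fi[OF b] c0_def)
    qed
    then show "alt_form (CARD(3) - 3) c0 \<and> (\<forall>b. alt_form 3 b \<longrightarrow>
        wedge 3 (CARD(3) - 3) b c0 = (\<lambda>vs. form_inner g 3 b (\<lambda>vs. k * vol vs) * vol vs))"
      using c0 by simp
    fix c
    assume "alt_form (CARD(3) - 3) c \<and> (\<forall>b. alt_form 3 b \<longrightarrow>
        wedge 3 (CARD(3) - 3) b c = (\<lambda>vs. form_inner g 3 b (\<lambda>vs. k * vol vs) * vol vs))"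
    then have c: "alt_form 0 c" "wedge 3 0 vol c frame = form_inner g 3 vol (\<lambda>vs. k * vol vs) * vol frame"
      using alt_vol by simp_all
    have "vol frame * c [] = vol frame * (k * vol frame) * vol frame"
      using c(2) unfolding wedge_3_0[OF alt_vol] fi[OF alt_vol] .
    then have "c [] = k" using vol_frame frame_nonzero by (simp add: power2_eq_square)
    then show "c = c0" using c(1) by (auto simp: alt_form_def c0_def)
  qed
  then show ?thesis by (simp add: c0_def)
qed

lemma wedge_hodge_vol: "wedge 3 0 (\<lambda>vs. k * vol vs) (hodge g vol 3 (\<lambda>vs. k * vol vs)) vs = k * k * vol vs"
  unfolding wedge_3_0[OF alt_scale_vol] hodge_vol by simp

text \<open>The values of \<open>a\<close> on the frame are the coordinates of \<open>v\<close>, so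
  the sum defining the inner product evaluates \<open>b\<close> on the expansion of
  \<open>v\<close>.\<close>

lemma form_inner_connection:
  assumes "alt_form 1 b"
  shows "form_inner g 1 (\<lambda>vs. k * a vs) b = k * b [v]"
proof -
  have lb: "linear (\<lambda>w. b [w])" by (rule linear_alt_form_1[OF assms])
  have "b [v] = b [\<Sum>i<CARD(3). g v (on_frame g ! i) *\<^sub>R on_frame g ! i]"
    using inner_form_expand[OF inner_g, of v] by simp
  also have "\<dots> = (\<Sum>i<CARD(3). a [on_frame g ! i] * b [on_frame g ! i])"
    by (simp add: linear_sum[OF lb] linear_cmul[OF lb] g_v)
  finally show ?thesis unfolding form_inner_1 by (simp add: sum_distrib_left mult.assoc)
qed

lemma top_form_eq:
  assumes "alt_form 3 b" "vol us \<noteq> 0"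
  shows "b vs = (b us / vol us) * vol vs"
  by (rule alt_form_3_top[OF assms(1) alt_vol assms(2)])

text \<open>Every 3-form is a multiple of \<open>vol\<close>, and contracting \<open>vol\<close>
  with \<open>v\<close> leaves the pulled back area form.\<close>

lemma two_form_eq:
  assumes "alt_form 3 b" "vol us \<noteq> 0"
  shows "b (v # vs) = (b us / vol us) * \<nu> (map p vs)"
proof (cases "length vs = 2")
  case True
  then obtain x y where "vs = [x, y]" using length_2_conv by metis
  then show ?thesis using top_form_eq[OF assms, of "[v, x, y]"] vol_v by simp
next
  case False
  then show ?thesis using alt_form_3D(7)[OF assms(1)] alt_form_2D(4)[OF \<nu>(1)] by simp
qed

end

subsection \<open>Integration on oriented manifolds\<close>

text \<open>The transformation law of a top form, with \<open>a\<close> its value on the standard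
  frame. Stated through linear maps, it serves dimensions two and three alike.\<close>

definition density_form ::
    "('m, 'n::{finite, comm_ring_1}) form \<Rightarrow> ('m \<Rightarrow> real) \<Rightarrow> bool" where
  "density_form \<eta> a \<longleftrightarrow> (\<forall>p L. linear L \<longrightarrow> \<eta> p (map L std_frame) = det (matrix L) * a p)"

section \<open>Change of variables and uniqueness of integrals\<close>

text \<open>A real function is treated as one with values in \<open>real^1\<close>. Quantifying over
  the value \<open>b\<close> in the auxiliary equivalence separates integrability from the value of
  the integral.\<close>

lemma absolute_integral_change_of_variables_real:
  fixes f :: "real^'m::{finite,wellorder} \<Rightarrow> real" and g :: "real^'m::_ \<Rightarrow> real^'m::_"
  assumes S: "S \<in> sets lebesgue"
    and der_g: "\<And>x. x \<in> S \<Longrightarrow> (g has_derivative g' x) (at x within S)"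
    and inj: "inj_on g S"
  shows "(\<lambda>x. \<bar>det (matrix (g' x))\<bar> * f (g x)) absolutely_integrable_on S \<longleftrightarrow> f absolutely_integrable_on (g ` S)"
    and "f absolutely_integrable_on (g ` S) \<Longrightarrow>
      integral (g ` S) f = integral S (\<lambda>x. \<bar>det (matrix (g' x))\<bar> * f (g x))"
proof -
  have *: "(\<lambda>x. \<bar>det (matrix (g' x))\<bar> * f (g x)) absolutely_integrable_on S \<and>
           integral S (\<lambda>x. \<bar>det (matrix (g' x))\<bar> * f (g x)) = b
     \<longleftrightarrow> f absolutely_integrable_on (g ` S) \<and> integral (g ` S) f = b" for b
    using has_absolute_integral_change_of_variables[OF assms, of "\<lambda>x. vec (f x) :: real^1" "vec b"]
    unfolding absolutely_integrable_on_1_iff integral_on_1_eq integrable_on_1_iff absolutely_integrable_on_def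
    by (auto simp: has_integral_iff o_def)
  then show "(\<lambda>x. \<bar>det (matrix (g' x))\<bar> * f (g x)) absolutely_integrable_on S \<longleftrightarrow> f absolutely_integrable_on (g ` S)"
    and "f absolutely_integrable_on (g ` S) \<Longrightarrow>
      integral (g ` S) f = integral S (\<lambda>x. \<bar>det (matrix (g' x))\<bar> * f (g x))"
    by blast+
qed

lemma borel_vimage_continuous:
  fixes f :: "'a::topological_space \<Rightarrow> 'b::topological_space"
  assumes "open V" "continuous_on V f" "E \<in> sets borel"
  shows "V \<inter> f -` E \<in> sets borel"
proof -
  have "f \<in> borel_measurable (restrict_space borel V)"
    using assms(2) by (rule borel_measurable_continuous_on_restrict)
  from measurable_sets[OF this assms(3)]
  have "f -` E \<inter> V \<in> sets (restrict_space borel V)" by (simp add: space_restrict_space)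
  then show ?thesis using assms(1) by (simp add: sets_restrict_space_iff Int_commute)
qed

lemma chart_image_borel:
  assumes M: "smooth_manifold \<A>" and "c \<in> \<A>" "D \<in> sets borel" "D \<subseteq> cdom c"
  shows "cmap c ` D \<in> sets borel"
  unfolding chart_image_eq_vimage[OF M assms(2), of D, unfolded Int_absorb1[OF assms(4)]]
  by (rule borel_vimage_continuous[OF chart_homeo(2,4)[OF M assms(2)] assms(3)])

text \<open>Both sides of the change of variables are written with the form itself, so that the same lemma
  compares two charts and computes integrals in a local trivialization.\<close>

lemma integral_param:
  fixes \<A> :: "('m::{t2_space, second_countable_topology}, 'n::{finite, comm_ring_1, wellorder}) atlas"
  assumes M: "smooth_manifold \<A>" and c: "c \<in> \<A>" and P: "smooth_param \<A> W \<Psi>"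
    and S: "S \<in> sets borel" "S \<subseteq> W" "\<Psi> ` S \<subseteq> cdom c" "inj_on \<Psi> S"
    and pos: "\<And>y. y \<in> S \<Longrightarrow> det (matrix (frechet_derivative (cmap c \<circ> \<Psi>) (at y))) > 0"
    and \<eta>: "density_form \<eta> a"
  shows "(\<lambda>x. in_chart \<A> c \<eta> x std_frame) absolutely_integrable_on (cmap c ` \<Psi> ` S) \<longleftrightarrow>
      (\<lambda>y. \<eta> (\<Psi> y) (map (param_deriv \<A> \<Psi> y) std_frame)) absolutely_integrable_on S"
    and "(\<lambda>x. in_chart \<A> c \<eta> x std_frame) absolutely_integrable_on (cmap c ` \<Psi> ` S) \<Longrightarrow>
      integral (cmap c ` \<Psi> ` S) (\<lambda>x. in_chart \<A> c \<eta> x std_frame) =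
      integral S (\<lambda>y. \<eta> (\<Psi> y) (map (param_deriv \<A> \<Psi> y) std_frame))"
proof -
  define X where "X = cmap c \<circ> \<Psi>"
  define f where "f = (\<lambda>x. in_chart \<A> c \<eta> x std_frame)"
  define G where "G = (\<lambda>y. \<eta> (\<Psi> y) (map (param_deriv \<A> \<Psi> y) std_frame))"
  have dX: "(X has_derivative frechet_derivative X (at y)) (at y)" if "y \<in> S" for y
    unfolding X_def by (intro has_frechet_derivative smooth_param_differentiable[OF P c]) (use that S in auto)
  have inj: "inj_on X S"
    unfolding X_def by (rule comp_inj_on[OF S(4) inj_on_subset[OF chart_homeo(5)[OF M c] S(3)]])
  \<comment> \<open>The chain rule splits the derivative of \<Psi> into that of the inverse chart
    and the Jacobian of \<open>X\<close>; the density law turns this into a product of determinants,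
    and positivity removes the absolute value.\<close>
  have eq: "\<bar>det (matrix (frechet_derivative X (at y)))\<bar> * f (X y) = G y" if y: "y \<in> S" for y
  proof -
    have \<Psi>y: "\<Psi> y \<in> cdom c" "y \<in> W" using S y by auto
    have cy: "cinv c (X y) = \<Psi> y" using chart_homeo(6)[OF M c \<Psi>y(1)] by (simp add: X_def)
    define N where "N = param_deriv \<A> (cinv c) (cmap c (\<Psi> y))"
    have lN: "linear N" unfolding N_def
      by (rule linear_param_deriv[OF M smooth_param_cinv[OF M c]]) (use \<Psi>y in auto)
    have lX: "linear (frechet_derivative X (at y))" using dX[OF y] has_derivative_linear by blast
    have "param_deriv \<A> \<Psi> y = N \<circ> frechet_derivative X (at y)"
      unfolding N_def X_def by (rule param_deriv_chart[OF M P \<Psi>y(2) c \<Psi>y(1)])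
    then have "G y = det (matrix (N \<circ> frechet_derivative X (at y))) * a (\<Psi> y)"
      using \<eta> linear_compose[OF lX lN] unfolding density_form_def G_def by simp
    moreover have "f (X y) = det (matrix N) * a (\<Psi> y)"
      using \<eta> lN cy unfolding density_form_def f_def in_chart_param by (simp add: N_def X_def)
    ultimately show ?thesis
      using pos[OF y] by (simp add: matrix_compose[OF lX lN] det_mul X_def[symmetric])
  qed
  have Sl: "S \<in> sets lebesgue" using S(1) by simp
  note cov = absolute_integral_change_of_variables_real[OF Sl has_derivative_at_withinI[OF dX] inj, where f = f]
  have im: "cmap c ` \<Psi> ` S = X ` S" by (simp add: X_def image_comp)
  have "(\<lambda>y. \<bar>det (matrix (frechet_derivative X (at y)))\<bar> * f (X y)) absolutely_integrable_on S
      \<longleftrightarrow> G absolutely_integrable_on S"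
    by (rule set_integrable_cong) (use eq in auto)
  then have i: "f absolutely_integrable_on (X ` S) \<longleftrightarrow> G absolutely_integrable_on S"
    using cov(1) by simp
  have "integral S (\<lambda>y. \<bar>det (matrix (frechet_derivative X (at y)))\<bar> * f (X y)) = integral S G"
    by (rule integral_cong) (use eq in auto)
  then have j: "f absolutely_integrable_on (X ` S) \<Longrightarrow> integral (X ` S) f = integral S G"
    using cov(2) by simp
  show "(\<lambda>x. in_chart \<A> c \<eta> x std_frame) absolutely_integrable_on (cmap c ` \<Psi> ` S) \<longleftrightarrow>
      (\<lambda>y. \<eta> (\<Psi> y) (map (param_deriv \<A> \<Psi> y) std_frame)) absolutely_integrable_on S"
    using i by (simp add: im f_def G_def)
  show "(\<lambda>x. in_chart \<A> c \<eta> x std_frame) absolutely_integrable_on (cmap c ` \<Psi> ` S) \<Longrightarrow>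
      integral (cmap c ` \<Psi> ` S) (\<lambda>x. in_chart \<A> c \<eta> x std_frame) =
      integral S (\<lambda>y. \<eta> (\<Psi> y) (map (param_deriv \<A> \<Psi> y) std_frame))"
    using j by (simp add: im f_def G_def)
qed

text \<open>The instance of \<open>integral_param\<close> whose parametrization is the inverse of
  the second chart; orientation makes the Jacobian positive, so no sign appears.\<close>

lemma integral_chart_independent:
  fixes \<A> :: "('m::{t2_space, second_countable_topology}, 'n::{finite, comm_ring_1, wellorder}) atlas"
  assumes M: "smooth_manifold \<A>" and o: "oriented_atlas \<A>" and c: "c \<in> \<A>" "c' \<in> \<A>"
    and D: "D \<in> sets borel" "D \<subseteq> cdom c" "D \<subseteq> cdom c'" and \<eta>: "density_form \<eta> a"
    and int: "(\<lambda>x. in_chart \<A> c \<eta> x std_frame) absolutely_integrable_on (cmap c ` D)"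
  shows "integral (cmap c ` D) (\<lambda>x. in_chart \<A> c \<eta> x std_frame)
       = integral (cmap c' ` D) (\<lambda>x. in_chart \<A> c' \<eta> x std_frame)"
proof -
  have D': "cinv c' ` cmap c' ` D = D" using chart_homeo(6)[OF M c(2)] D(3) by force
  have "integral (cmap c ` cinv c' ` (cmap c' ` D)) (\<lambda>x. in_chart \<A> c \<eta> x std_frame) =
      integral (cmap c' ` D) (\<lambda>y. \<eta> (cinv c' y) (map (param_deriv \<A> (cinv c') y) std_frame))"
  proof (rule integral_param(2)[OF M c(1) smooth_param_cinv[OF M c(2)] chart_image_borel[OF M c(2) D(1,3)] _ _ _ _ \<eta>])
    show "cmap c' ` D \<subseteq> cmap c' ` cdom c'" using D by auto
    show "cinv c' ` cmap c' ` D \<subseteq> cdom c" unfolding D' by (rule D)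
    show "inj_on (cinv c') (cmap c' ` D)"
      by (rule inj_on_inverseI[of _ "cmap c'"]) (use D chart_homeo(6)[OF M c(2)] in auto)
    show "0 < det (matrix (frechet_derivative (cmap c \<circ> cinv c') (at y)))" if y: "y \<in> cmap c' ` D" for y
    proof -
      obtain q where "y = cmap c' q" "q \<in> cdom c' \<inter> cdom c" using y D by auto
      then show ?thesis using o c unfolding oriented_atlas_def by blast
    qed
    show "(\<lambda>x. in_chart \<A> c \<eta> x std_frame) absolutely_integrable_on (cmap c ` cinv c' ` cmap c' ` D)"
      unfolding D' by (rule int)
  qed
  then show ?thesis by (simp add: D' in_chart_param)
qed

text \<open>Injectivity of the chart keeps the images of disjoint parts disjoint, so the integral is
  additive under refinement.\<close>

lemma integral_chart_split:
  fixes f :: "real^'n \<Rightarrow> real" and \<A> :: "('m::{t2_space, second_countable_topology}, 'n::finite) atlas"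
  assumes M: "smooth_manifold \<A>" and c: "c \<in> \<A>" and E: "E \<in> sets borel" "E \<subseteq> cdom c"
    and J: "finite J" "\<And>j. j \<in> J \<Longrightarrow> F j \<in> sets borel" "disjoint_family_on F J" "E \<subseteq> (\<Union>j\<in>J. F j)"
    and f: "f absolutely_integrable_on (cmap c ` E)"
  shows "j \<in> J \<Longrightarrow> f absolutely_integrable_on (cmap c ` (E \<inter> F j))"
    and "integral (cmap c ` E) f = (\<Sum>j\<in>J. integral (cmap c ` (E \<inter> F j)) f)"
proof -
  show sub: "f absolutely_integrable_on (cmap c ` (E \<inter> F j))" if "j \<in> J" for j
  proof (rule set_integrable_subset[OF f])
    have "cmap c ` (E \<inter> F j) \<in> sets borel"
      by (rule chart_image_borel[OF M c]) (use E J(2)[OF that] in auto)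
    then show "cmap c ` (E \<inter> F j) \<in> sets lebesgue" by simp
  qed auto
  have "(f has_integral (\<Sum>j\<in>J. integral (cmap c ` (E \<inter> F j)) f)) (\<Union>j\<in>J. cmap c ` (E \<inter> F j))"
  proof (rule has_integral_UN[OF J(1)])
    show "(f has_integral integral (cmap c ` (E \<inter> F j)) f) (cmap c ` (E \<inter> F j))" if "j \<in> J" for j
      using sub[OF that] set_lebesgue_integral_eq_integral(1) integrable_integral by blast
    have "cmap c ` (E \<inter> F i) \<inter> cmap c ` (E \<inter> F j) = {}" if "i \<in> J" "j \<in> J" "i \<noteq> j" for i j
    proof -
      have "F i \<inter> F j = {}" using J(3) that by (auto simp: disjoint_family_on_def)
      then show ?thesis
        using inj_on_image_Int[OF chart_homeo(5)[OF M c], of "E \<inter> F i" "E \<inter> F j"] E(2) by auto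
    qed
    then show "pairwise (\<lambda>i j. negligible (cmap c ` (E \<inter> F i) \<inter> cmap c ` (E \<inter> F j))) J"
      by (auto simp: pairwise_def)
  qed
  moreover have "(\<Union>j\<in>J. cmap c ` (E \<inter> F j)) = cmap c ` E"
  proof -
    have "(\<Union>j\<in>J. E \<inter> F j) = E" using J(4) by blast
    then show ?thesis by (metis image_UN)
  qed
  ultimately show "integral (cmap c ` E) f = (\<Sum>j\<in>J. integral (cmap c ` (E \<inter> F j)) f)"
    by (simp add: integral_unique)
qed

text \<open>Two decompositions are compared on their common refinement, where each piece lies in two
  charts.\<close>

lemma has_form_integral_unique:
  fixes \<A> :: "('m::{t2_space, second_countable_topology}, 'n::{finite, comm_ring_1, wellorder}) atlas"
  assumes M: "smooth_manifold \<A>" and o: "oriented_atlas \<A>" and \<eta>: "density_form \<eta> a"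
    and "has_form_integral \<A> \<eta> I" "has_form_integral \<A> \<eta> I'"
  shows "I = I'"
proof -
  let ?f = "\<lambda>c x. in_chart \<A> c \<eta> x std_frame"
  obtain cs E where E: "finite cs" "cs \<subseteq> \<A>" "\<forall>c\<in>cs. E c \<in> sets borel \<and> E c \<subseteq> cdom c"
    "disjoint_family_on E cs" "(\<Union>c\<in>cs. E c) = UNIV"
    "\<forall>c\<in>cs. ?f c absolutely_integrable_on (cmap c ` E c)"
    "I = (\<Sum>c\<in>cs. integral (cmap c ` E c) (?f c))"
    using assms(4) unfolding has_form_integral_def by (elim exE conjE) (rule that)
  obtain cs' E' where E': "finite cs'" "cs' \<subseteq> \<A>" "\<forall>c\<in>cs'. E' c \<in> sets borel \<and> E' c \<subseteq> cdom c"
    "disjoint_family_on E' cs'" "(\<Union>c\<in>cs'. E' c) = UNIV"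
    "\<forall>c\<in>cs'. ?f c absolutely_integrable_on (cmap c ` E' c)"
    "I' = (\<Sum>c\<in>cs'. integral (cmap c ` E' c) (?f c))"
    using assms(5) unfolding has_form_integral_def by (elim exE conjE) (rule that)
  have A: "c \<in> \<A>" "E c \<in> sets borel" "E c \<subseteq> cdom c" "?f c absolutely_integrable_on (cmap c ` E c)"
    if "c \<in> cs" for c using E(2,3,6) that by auto
  have A': "c \<in> \<A>" "E' c \<in> sets borel" "E' c \<subseteq> cdom c" "?f c absolutely_integrable_on (cmap c ` E' c)"
    if "c \<in> cs'" for c using E'(2,3,6) that by auto
  have sub: "X \<subseteq> (\<Union>c\<in>cs. E c)" "X \<subseteq> (\<Union>c\<in>cs'. E' c)" for X using E(5) E'(5) by auto
  have s: "integral (cmap c ` E c) (?f c) = (\<Sum>c'\<in>cs'. integral (cmap c ` (E c \<inter> E' c')) (?f c))"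
    "\<And>c'. c' \<in> cs' \<Longrightarrow> ?f c absolutely_integrable_on (cmap c ` (E c \<inter> E' c'))" if "c \<in> cs" for c
    using integral_chart_split[OF M A(1-3)[OF that] E'(1) A'(2) E'(4) sub(2) A(4)[OF that]] by blast+
  have s': "integral (cmap c' ` E' c') (?f c') = (\<Sum>c\<in>cs. integral (cmap c' ` (E' c' \<inter> E c)) (?f c'))" if "c' \<in> cs'" for c'
    by (rule integral_chart_split(2)[OF M A'(1-3)[OF that] E(1) A(2) E(4) sub(1) A'(4)[OF that]])
  have "I = (\<Sum>c\<in>cs. \<Sum>c'\<in>cs'. integral (cmap c ` (E c \<inter> E' c')) (?f c))" unfolding E(7) using s(1) by simp
  also have "\<dots> = (\<Sum>c\<in>cs. \<Sum>c'\<in>cs'. integral (cmap c' ` (E' c' \<inter> E c)) (?f c'))"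
  proof (intro sum.cong refl)
    fix c c' assume c: "c \<in> cs" "c' \<in> cs'"
    have "E c \<inter> E' c' \<in> sets borel" "E c \<inter> E' c' \<subseteq> cdom c" "E c \<inter> E' c' \<subseteq> cdom c'"
      using A[OF c(1)] A'[OF c(2)] by auto
    then show "integral (cmap c ` (E c \<inter> E' c')) (?f c) = integral (cmap c' ` (E' c' \<inter> E c)) (?f c')"
      unfolding Int_commute[of "E' c'"]
      by (rule integral_chart_independent[OF M o A(1)[OF c(1)] A'(1)[OF c(2)] _ _ _ \<eta> s(2)[OF c]])
  qed
  also have "\<dots> = I'" unfolding E'(7) using s' by (subst sum.swap) simp
  finally show ?thesis .
qed

lemma form_integral_eq:
  fixes \<A> :: "('m::{t2_space, second_countable_topology}, 'n::{finite, comm_ring_1, wellorder}) atlas"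
  assumes "smooth_manifold \<A>" "oriented_atlas \<A>" "density_form \<eta> a" "has_form_integral \<A> \<eta> I"
  shows "form_integral \<A> \<eta> = I"
  unfolding form_integral_def using assms has_form_integral_unique by blast

section \<open>Existence of integrals on a compact manifold\<close>

lemma disjointify_borel:
  assumes "finite I" "\<And>i. i \<in> I \<Longrightarrow> V i \<in> sets borel"
  shows "\<exists>E. (\<forall>i\<in>I. E i \<in> sets borel \<and> E i \<subseteq> V i) \<and> disjoint_family_on E I \<and> (\<Union>i\<in>I. E i) = (\<Union>i\<in>I. V i)"
  using assms
proof (induction I)
  case empty
  then show ?case by (auto simp: disjoint_family_on_def)
next
  case (insert j I)
  then obtain E where E: "\<forall>i\<in>I. E i \<in> sets borel \<and> E i \<subseteq> V i" "disjoint_family_on E I"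
    "(\<Union>i\<in>I. E i) = (\<Union>i\<in>I. V i)" by auto
  define E' where "E' = E(j := V j - (\<Union>i\<in>I. E i))"
  have E'I: "E' i = E i" if "i \<in> I" for i using that insert.hyps by (auto simp: E'_def)
  have "E' j \<in> sets borel" "E' j \<subseteq> V j"
    using E(1) insert.hyps insert.prems by (auto simp: E'_def intro!: sets.Diff sets.finite_UN)
  moreover have "disjoint_family_on E' (insert j I)"
    using E(2) E'I insert.hyps unfolding disjoint_family_on_def by (auto simp: E'_def)
  moreover have "(\<Union>i\<in>insert j I. E' i) = (\<Union>i\<in>insert j I. V i)"
  proof -
    have "(\<Union>i\<in>I. E' i) = (\<Union>i\<in>I. V i)" using E(3) E'I by simp
    then show ?thesis using E(3) by (auto simp: E'_def)
  qed
  ultimately show ?case using E(1) E'I by (intro exI[of _ E']) auto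
qed

text \<open>A form will only be known to be continuous on the open image of a chart; the compact set
  \<open>K\<close> makes it integrable on every Borel piece inside.\<close>

lemma chart_compact_neighbourhood:
  assumes M: "smooth_manifold \<A>" and c: "c \<in> \<A>" "p \<in> cdom c" and U: "open U" "p \<in> U"
  shows "\<exists>V K. open V \<and> compact K \<and> p \<in> V \<and> V \<subseteq> K \<and> K \<subseteq> cdom c \<inter> U"
proof -
  have "open (cmap c ` (cdom c \<inter> U))"
    unfolding chart_image_eq_vimage[OF M c(1)]
    by (rule continuous_open_preimage[OF chart_homeo(4,2)[OF M c(1)] U(1)])
  then obtain r where r: "r > 0" "cball (cmap c p) r \<subseteq> cmap c ` (cdom c \<inter> U)"
    using c U open_contains_cball by (metis IntI imageI)
  define K where "K = cinv c ` cball (cmap c p) r"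
  define V where "V = cdom c \<inter> cmap c -` ball (cmap c p) r"
  have "compact K" unfolding K_def
    by (rule compact_continuous_image[OF continuous_on_subset[OF chart_homeo(4)[OF M c(1)]]]) (use r in auto)
  moreover have "open V" unfolding V_def
    by (rule continuous_open_preimage[OF chart_homeo(3,1)[OF M c(1)]]) simp
  moreover have "p \<in> V" using c r by (simp add: V_def)
  moreover have "V \<subseteq> K"
  proof
    fix q assume "q \<in> V"
    then have "q = cinv c (cmap c q)" "cmap c q \<in> cball (cmap c p) r"
      using chart_homeo(6)[OF M c(1)] by (auto simp: V_def)
    then show "q \<in> K" unfolding K_def by blast
  qed
  moreover have "K \<subseteq> cdom c \<inter> U" unfolding K_def using r(2) chart_homeo(6)[OF M c(1)] by force
  ultimately show ?thesis by blast
qed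

lemma has_form_integral_exists:
  fixes \<A> :: "('m::{t2_space, second_countable_topology}, 'n::{finite, comm_ring_1, wellorder}) atlas"
  assumes M: "smooth_manifold \<A>" and "compact (UNIV :: 'm set)"
    and cont: "\<And>c. c \<in> \<A> \<Longrightarrow> continuous_on (cmap c ` cdom c) (\<lambda>x. in_chart \<A> c \<eta> x std_frame)"
  shows "\<exists>I. has_form_integral \<A> \<eta> I"
proof -
  define k where "k = (\<lambda>p. chart_at \<A> p)"
  have k: "k p \<in> \<A>" "p \<in> cdom (k p)" for p using chart_at[OF M] by (auto simp: k_def)
  have "\<forall>p. \<exists>V K. open V \<and> compact K \<and> p \<in> V \<and> V \<subseteq> K \<and> K \<subseteq> cdom (k p)"
    using chart_compact_neighbourhood[OF M k open_UNIV UNIV_I] by simp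
  then obtain V K where VK: "\<And>p. open (V p)" "\<And>p. compact (K p)" "\<And>p. p \<in> V p" "\<And>p. V p \<subseteq> K p"
    "\<And>p. K p \<subseteq> cdom (k p)" by metis
  obtain D where D: "finite D" "UNIV = (\<Union>p\<in>D. V p)"
  proof -
    have "UNIV \<subseteq> (\<Union>p\<in>UNIV. V p)" using VK(3) by blast
    then obtain D where "finite D" "UNIV \<subseteq> (\<Union>p\<in>D. V p)"
      using VK(1) compactE_image[OF assms(2), of UNIV V] by metis
    then show thesis using that[of D] by blast
  qed
  define cs where "cs = k ` D"
  \<comment> \<open>Pieces are indexed by charts, and several points of \<open>D\<close> may share a
    chart, so their neighbourhoods are merged.\<close>
  define V' where "V' c = (\<Union>p\<in>{p \<in> D. k p = c}. V p)" for c
  define K' where "K' c = (\<Union>p\<in>{p \<in> D. k p = c}. K p)" for c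
  have cs: "finite cs" "cs \<subseteq> \<A>" using D k by (auto simp: cs_def)
  have V': "open (V' c)" "V' c \<subseteq> K' c" "compact (K' c)" "K' c \<subseteq> cdom c" for c
  proof -
    have fin: "finite {p \<in> D. k p = c}" using D(1) by simp
    show "open (V' c)" unfolding V'_def using VK(1) by blast
    show "V' c \<subseteq> K' c" unfolding V'_def K'_def by (rule UN_mono) (use VK(4) in auto)
    show "compact (K' c)" unfolding K'_def using fin VK(2) by (rule compact_UN)
    show "K' c \<subseteq> cdom c" unfolding K'_def using VK(5) by blast
  qed
  have cover: "(\<Union>c\<in>cs. V' c) = UNIV"
  proof -
    have "x \<in> (\<Union>c\<in>cs. V' c)" for x
    proof -
      obtain p where "p \<in> D" "x \<in> V p" using D(2) by blast
      then show ?thesis unfolding cs_def V'_def by blast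
    qed
    then show ?thesis by blast
  qed
  have "\<exists>E. (\<forall>c\<in>cs. E c \<in> sets borel \<and> E c \<subseteq> V' c) \<and> disjoint_family_on E cs \<and> (\<Union>c\<in>cs. E c) = UNIV"
    using disjointify_borel[OF cs(1), of V'] V'(1) cover by simp
  then obtain E where E': "\<forall>c\<in>cs. E c \<in> sets borel \<and> E c \<subseteq> V' c" "disjoint_family_on E cs"
    "(\<Union>c\<in>cs. E c) = UNIV" by blast
  note E = bspec[OF E'(1)] E'(2,3)
  have int: "(\<lambda>x. in_chart \<A> c \<eta> x std_frame) absolutely_integrable_on (cmap c ` E c)" if c: "c \<in> cs" for c
  proof (rule set_integrable_subset)
    have cA: "c \<in> \<A>" using c cs by auto
    have "compact (cmap c ` K' c)"
      by (rule compact_continuous_image[OF continuous_on_subset[OF chart_homeo(3)[OF M cA] V'(4)] V'(3)])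
    moreover have "continuous_on (cmap c ` K' c) (\<lambda>x. in_chart \<A> c \<eta> x std_frame)"
      using cont[OF cA] by (rule continuous_on_subset) (use V'(4)[of c] in auto)
    ultimately have i: "integrable lborel (\<lambda>x. indicat_real (cmap c ` K' c) x *\<^sub>R in_chart \<A> c \<eta> x std_frame)"
      by (rule borel_integrable_compact)
    then show "(\<lambda>x. in_chart \<A> c \<eta> x std_frame) absolutely_integrable_on (cmap c ` K' c)"
      unfolding set_integrable_def using integrable_completion[OF borel_measurable_integrable[OF i]] by blast
    have "cmap c ` E c \<in> sets borel"
      by (rule chart_image_borel[OF M cA]) (use E(1)[OF c] V'(2,4)[of c] in auto)
    then show "cmap c ` E c \<in> sets lebesgue" by simp
    show "cmap c ` E c \<subseteq> cmap c ` K' c" using E(1)[OF c] V'(2)[of c] by auto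
  qed
  have "E c \<subseteq> cdom c" if "c \<in> cs" for c using E(1)[OF that] V'(2,4)[of c] by blast
  then have "has_form_integral \<A> \<eta> (\<Sum>c\<in>cs. integral (cmap c ` E c) (\<lambda>x. in_chart \<A> c \<eta> x std_frame))"
    unfolding has_form_integral_def using cs E int by (intro exI[of _ cs] exI[of _ E]) simp
  then show ?thesis ..
qed

subsection \<open>Integration over a cylinder\<close>

lemma vector_2_eq: "(vector [a, b] :: real^2) = a *\<^sub>R axis 1 1 + b *\<^sub>R axis 2 1"
  by (subst vec2_expand) simp

lemma vector_3_eq: "(vector [a, b, c] :: real^3) = a *\<^sub>R axis 1 1 + b *\<^sub>R axis 2 1 + c *\<^sub>R axis 3 1"
  by (subst vec3_expand) simp

lemma prod_Basis_vec: "(\<Prod>b\<in>Basis. x \<bullet> b) = (\<Prod>i\<in>UNIV. x $ i)" for x :: "real^'n"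
proof -
  have "(Basis :: (real^'n) set) = (\<lambda>i. axis i 1) ` UNIV" by (auto simp: Basis_vec_def)
  moreover have "inj (\<lambda>i. axis i (1::real) :: real^'n)" by (auto simp: inj_def axis_eq_axis)
  ultimately have "(\<Prod>b\<in>Basis. x \<bullet> b) = (\<Prod>i\<in>UNIV. x \<bullet> axis i 1)"
    using prod.reindex[of "\<lambda>i. axis i 1" UNIV "\<lambda>b. x \<bullet> b"] by simp
  then show ?thesis by (simp add: inner_axis)
qed

text \<open>Lebesgue measure is determined by its values on boxes, and the preimage of a box is the
  product of an interval and a box.\<close>

lemma lborel_vec3:
  "lborel = distr (lborel \<Otimes>\<^sub>M lborel) borel (\<lambda>(t, x::real^2). vector [t, x $ 1, x $ 2] :: real^3)"
proof (rule lborel_eqI)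
  let ?\<phi> = "\<lambda>(t, x::real^2). vector [t, x $ 1, x $ 2] :: real^3"
  have "continuous_on UNIV ?\<phi>"
    unfolding case_prod_unfold vector_3_eq by (intro continuous_intros)
  then have meas: "?\<phi> \<in> measurable (lborel \<Otimes>\<^sub>M lborel) borel"
    unfolding lborel_prod by (simp add: borel_measurable_continuous_onI)
  fix l u :: "real^3" assume lu: "\<And>b. b \<in> Basis \<Longrightarrow> l \<bullet> b \<le> u \<bullet> b"
  have le: "l $ i \<le> u $ i" for i using lu[of "axis i 1"] by (simp add: inner_axis)
  have vim: "?\<phi> -` box l u = box (l $ 1) (u $ 1) \<times> box (vector [l $ 2, l $ 3]) (vector [u $ 2, u $ 3])"
    by (auto simp: mem_box_cart forall_2 forall_3)
  have "emeasure (distr (lborel \<Otimes>\<^sub>M lborel) borel ?\<phi>) (box l u)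
      = emeasure (lborel \<Otimes>\<^sub>M lborel) (box (l $ 1) (u $ 1) \<times> box (vector [l $ 2, l $ 3] :: real^2) (vector [u $ 2, u $ 3]))"
    by (subst emeasure_distr[OF meas]) (simp_all add: vim space_pair_measure)
  also have "\<dots> = emeasure lborel (box (l $ 1) (u $ 1)) * emeasure lborel (box (vector [l $ 2, l $ 3] :: real^2) (vector [u $ 2, u $ 3]))"
    by (rule lborel.emeasure_pair_measure_Times) simp_all
  also have "emeasure lborel (box (vector [l $ 2, l $ 3] :: real^2) (vector [u $ 2, u $ 3]))
      = ennreal ((u $ 2 - l $ 2) * (u $ 3 - l $ 3))"
  proof (subst emeasure_lborel_box)
    show "(vector [l $ 2, l $ 3] :: real^2) \<bullet> b \<le> vector [u $ 2, u $ 3] \<bullet> b" if b: "b \<in> Basis" for b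
    proof -
      obtain i where "b = axis i 1" using b by (auto simp: Basis_vec_def)
      then show ?thesis using exhaust_2[of i] le by (auto simp: inner_axis)
    qed
  qed (simp add: prod_Basis_vec UNIV_2)
  also have "emeasure lborel (box (l $ 1) (u $ 1)) * ennreal ((u $ 2 - l $ 2) * (u $ 3 - l $ 3))
      = ennreal (\<Prod>b\<in>Basis. (u - l) \<bullet> b)"
  proof -
    have "emeasure lborel (box (l $ 1) (u $ 1)) = ennreal (u $ 1 - l $ 1)"
      using le[of 1] by (simp add: box_real)
    then show ?thesis
      unfolding prod_Basis_vec UNIV_3 using le by (simp add: ennreal_mult[symmetric])
  qed
  finally show "emeasure (distr (lborel \<Otimes>\<^sub>M lborel) borel ?\<phi>) (box l u) = ennreal (\<Prod>b\<in>Basis. (u - l) \<bullet> b)" .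
qed simp

text \<open>Fubini over \<open>[0,1) \<times> T\<close>: the function is constant along the first
  coordinate, whose interval has length one.\<close>

lemma cylinder_integral:
  fixes G :: "real^2 \<Rightarrow> real"
  assumes T: "T \<in> sets borel" "continuous_on T G" "G absolutely_integrable_on T"
  defines "S \<equiv> {w :: real^3. 0 \<le> w $ 1 \<and> w $ 1 < 1 \<and> vector [w $ 2, w $ 3] \<in> T}"
  shows "(\<lambda>w. G (vector [w $ 2, w $ 3])) absolutely_integrable_on S"
    and "integral S (\<lambda>w. G (vector [w $ 2, w $ 3])) = integral T G"
    and "S \<in> sets borel"
proof -
  let ?\<phi> = "\<lambda>(t, x::real^2). vector [t, x $ 1, x $ 2] :: real^3"
  \<comment> \<open>Continuity on \<open>T\<close> makes the extension by zero Borel measurable, so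
    that integrals for \<open>lborel\<close> and for its completion agree.\<close>
  define f where "f x = indicator T x *\<^sub>R G x" for x
  have fm: "f \<in> borel_measurable borel"
    unfolding f_def using T(1,2) by (rule borel_measurable_continuous_on_indicator)
  have fi: "integrable lborel f"
    using T(3) fm unfolding set_integrable_def f_def by (subst (asm) integrable_completion) auto
  have If: "integral\<^sup>L lborel f = integral T G"
    using set_borel_integral_eq_integral(2)[of T G] fi unfolding set_integrable_def set_lebesgue_integral_def f_def by simp
  define \<rho> where "\<rho> w = (vector [w $ 2, w $ 3] :: real^2)" for w :: "real^3"
  have "continuous_on UNIV \<rho>"
    unfolding \<rho>_def vector_2_eq by (intro continuous_intros)
  then have \<rho>m: "\<rho> \<in> borel_measurable borel" by (rule borel_measurable_continuous_onI)
  have nth: "(\<lambda>w::real^3. w $ 1) \<in> borel_measurable borel"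
    by (intro borel_measurable_continuous_onI continuous_intros)
  define F where "F w = (indicator {0..<1} (w $ 1) * f (\<rho> w) :: real)" for w :: "real^3"
  have Fm: "F \<in> borel_measurable borel"
    unfolding F_def
    by (intro borel_measurable_times measurable_compose[OF \<rho>m fm]
        measurable_compose[OF nth borel_measurable_indicator]) simp
  have FS: "F w = indicator S w *\<^sub>R G (\<rho> w)" for w
    by (auto simp: F_def f_def S_def \<rho>_def indicator_def)
  show S: "S \<in> sets borel"
  proof -
    have "S = (\<lambda>w::real^3. w $ 1) -` {0..<1} \<inter> \<rho> -` T" by (auto simp: S_def \<rho>_def)
    moreover have "(\<lambda>w::real^3. w $ 1) -` {0..<1} \<in> sets borel" "\<rho> -` T \<in> sets borel"
      using measurable_sets[OF nth, of "{0..<1}"] measurable_sets[OF \<rho>m T(1)] by auto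
    ultimately show ?thesis by simp
  qed
  have "continuous_on UNIV ?\<phi>"
    unfolding case_prod_unfold vector_3_eq by (intro continuous_intros)
  then have meas: "?\<phi> \<in> measurable (lborel \<Otimes>\<^sub>M lborel) borel"
    unfolding lborel_prod by (simp add: borel_measurable_continuous_onI)
  have F\<phi>: "F (?\<phi> (t, x)) = indicator {0..<1} t * f x" for t x
  proof -
    have "(vector [x $ 1, x $ 2] :: real^2) = x" by (simp add: vec_eq_iff forall_2)
    then show ?thesis by (simp add: F_def \<rho>_def)
  qed
  have int: "integrable (lborel \<Otimes>\<^sub>M lborel) (\<lambda>z. F (?\<phi> z))"
  proof (rule lborel_pair.Fubini_integrable)
    show "(\<lambda>z. F (?\<phi> z)) \<in> borel_measurable (lborel \<Otimes>\<^sub>M lborel)"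
      using measurable_compose[OF meas Fm] .
    have "(\<lambda>t. \<integral>x. norm (F (?\<phi> (t, x))) \<partial>lborel) = (\<lambda>t::real. indicator {0..<1} t * (\<integral>x. \<bar>f x\<bar> \<partial>lborel))"
      unfolding F\<phi> by (simp add: abs_mult)
    moreover have "integrable lborel (\<lambda>t::real. indicator {0..<1} t * (\<integral>x. \<bar>f x\<bar> \<partial>lborel) :: real)"
      by (intro integrable_mult_left integrable_real_indicator) simp_all
    ultimately show "integrable lborel (\<lambda>t. \<integral>x. norm (F (?\<phi> (t, x))) \<partial>lborel)" by simp
    show "AE t in lborel. integrable lborel (\<lambda>x. F (?\<phi> (t, x)))"
      unfolding F\<phi> using fi by simp
  qed
  have iF: "integrable lborel F"
    unfolding lborel_vec3 using int by (subst integrable_distr_eq[OF meas Fm])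
  have "integral\<^sup>L lborel F = (\<integral>z. F (?\<phi> z) \<partial>(lborel \<Otimes>\<^sub>M lborel))"
    unfolding lborel_vec3 by (rule integral_distr[OF meas Fm])
  also have "\<dots> = (\<integral>t. \<integral>x. F (?\<phi> (t, x)) \<partial>lborel \<partial>lborel)"
    using lborel_pair.integral_fst'[OF int] by simp
  also have "\<dots> = (\<integral>t. indicator {0..<1::real} t * integral\<^sup>L lborel f \<partial>lborel)"
    unfolding F\<phi> by simp
  also have "\<dots> = integral\<^sup>L lborel f" by simp
  finally have IF: "integral\<^sup>L lborel F = integral T G" unfolding If .
  have sF: "set_integrable lborel S (\<lambda>w. G (\<rho> w))"
    using iF unfolding set_integrable_def FS .
  then show "(\<lambda>w. G (vector [w $ 2, w $ 3])) absolutely_integrable_on S"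
    unfolding set_integrable_def \<rho>_def[symmetric]
    by (subst integrable_completion) (use Fm in \<open>auto simp: FS[abs_def]\<close>)
  show "integral S (\<lambda>w. G (vector [w $ 2, w $ 3])) = integral T G"
    using set_borel_integral_eq_integral(2)[OF sF] IF
    unfolding set_lebesgue_integral_def FS[abs_def] \<rho>_def by simp
qed

subsection \<open>Circle bundles over surfaces\<close>

locale surface_bundle =
  fixes P :: "('s::{t2_space, second_countable_topology}, 'z::{t2_space, second_countable_topology}) circle_bundle"
    and h :: "('s, 2) metric" and A :: "('z, 3) form"
  assumes surface: "closed_oriented_surface_bundle P"
    and metric: "riemannian_metric (base P) h"
    and conn: "connection_form P A"
begin

abbreviation "dproj \<equiv> mderiv (total P) (base P) (proj P)"
abbreviation "dact t \<equiv> mderiv (total P) (total P) (act P t)"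

lemma principal: "principal_circle_bundle P"
  using surface by (simp add: closed_oriented_surface_bundle_def)

lemma base_manifold: "smooth_manifold (base P)" and total_manifold: "smooth_manifold (total P)"
  and proj_smooth: "smooth_map_on (total P) (base P) UNIV (proj P)"
  and act_0: "act P 0 z = z" and act_1: "act P 1 z = z"
  and act_add: "act P (t + r) z = act P t (act P r z)"
  and proj_act: "proj P (act P t z) = proj P z"
  and act_continuous: "continuous_on UNIV (\<lambda>(t, z). act P t z)"
  and act_smooth: "c \<in> total P \<Longrightarrow> c' \<in> total P \<Longrightarrow>
        smooth_on {(t, x). x \<in> cmap c ` cdom c \<and> act P t (cinv c x) \<in> cdom c'}
          (\<lambda>(t, x). cmap c' (act P t (cinv c x)))"
  and ex_trivialization: "\<exists>U s \<tau>. x \<in> U \<and> local_trivialization P U s \<tau>"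
  using principal unfolding principal_circle_bundle_def by blast+

lemma base_oriented: "oriented_atlas (base P)" and total_oriented: "oriented_atlas (total P)"
  and fibre_first: "det (vector [dproj z w\<^sub>1, dproj z w\<^sub>2] :: real^2^2) > 0 \<Longrightarrow>
        det (vector [generator P z, w\<^sub>1, w\<^sub>2] :: real^3^3) > 0"
  and base_compact: "compact (UNIV :: 's set)"
  using surface unfolding closed_oriented_surface_bundle_def fibre_first_oriented_def by blast+

lemma inner_h: "inner_form (h x)"
  using metric unfolding riemannian_metric_def inner_form_def by blast

lemma connection: "smooth_form_on (total P) UNIV 1 A" "invariant_on P UNIV A" "A z [generator P z] = 1"
  using conn unfolding connection_form_def by blast+

lemma alt_A: "alt_form 1 (A z)"
  using connection(1) unfolding smooth_form_on_def by blast

lemma trivializationD: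
  assumes "local_trivialization P U s \<tau>"
  shows "open U" "smooth_map_on (base P) (total P) U s" "x \<in> U \<Longrightarrow> proj P (s x) = x"
    "x \<in> U \<Longrightarrow> \<tau> (act P t (s x)) = cis (2 * pi * t)"
    "proj P z \<in> U \<Longrightarrow> \<exists>t. z = act P t (s (proj P z))"
  using assms unfolding local_trivialization_def by blast+

section \<open>The circle action and its derivatives\<close>

text \<open>Expressing \<sigma> in a chart near each point reduces the claim to smoothness of the
  action in charts. The lemma yields orbits, local product coordinates and flowed-out
  charts.\<close>

lemma smooth_param_act:
  fixes \<sigma> :: "'e::euclidean_space \<Rightarrow> 'z"
  assumes \<sigma>: "smooth_param (total P) W \<sigma>"
  shows "smooth_param (total P) (UNIV \<times> W) (\<lambda>(t, y). act P t (\<sigma> y))"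
  unfolding smooth_param_def
proof (intro conjI ballI)
  show "open (UNIV \<times> W :: (real \<times> 'e) set)" by (intro open_Times smooth_param_open[OF \<sigma>] open_UNIV)
  have "continuous_on (UNIV \<times> W) (\<lambda>p :: real \<times> 'e. (fst p, \<sigma> (snd p)))"
    by (intro continuous_intros continuous_on_compose2[OF smooth_param_continuous[OF \<sigma>]]) auto
  from continuous_on_compose2[OF act_continuous this]
  show cont: "continuous_on (UNIV \<times> W) (\<lambda>(t, y). act P t (\<sigma> y))" by (simp add: case_prod_unfold)
  fix c' assume c': "c' \<in> total P"
  let ?V = "UNIV \<times> W \<inter> (\<lambda>(t, y). act P t (\<sigma> y)) -` cdom c'"
  have opV: "open ?V"
    by (rule continuous_open_preimage[OF cont _ chart_homeo(1)[OF total_manifold c']]) fact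
  show "smooth_on ?V (cmap c' \<circ> (\<lambda>(t, y). act P t (\<sigma> y)))"
  proof (rule smooth_on_local)
    fix p :: "real \<times> 'e" assume p: "p \<in> ?V"
    define c where "c = chart_at (total P) (\<sigma> (snd p))"
    have c: "c \<in> total P" "\<sigma> (snd p) \<in> cdom c" using chart_at[OF total_manifold] by (auto simp: c_def)
    define W' where "W' = W \<inter> \<sigma> -` cdom c"
    have W': "open W'" "W' \<subseteq> W" "smooth_on W' (cmap c \<circ> \<sigma>)"
      unfolding W'_def using smooth_param_chart_vimage_open[OF total_manifold c(1) \<sigma>] smooth_param_smooth[OF \<sigma> c(1)] by auto
    define V where "V = ?V \<inter> UNIV \<times> W'"
    have V: "open V" "p \<in> V" using opV W' p c by (auto simp: V_def W'_def intro!: open_Int open_Times)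
    have 1: "smooth_on V (\<lambda>p. (fst p, (cmap c \<circ> \<sigma>) (snd p)))"
    proof (rule smooth_on_Pair[OF V(1)])
      show "smooth_on V fst" by (rule smooth_on_bounded_linear) (rule bounded_linear_fst)
      have "smooth_on V ((cmap c \<circ> \<sigma>) \<circ> snd)"
        by (rule smooth_on_compose[OF V(1) _ smooth_on_bounded_linear[OF bounded_linear_snd] W'(3)]) (auto simp: V_def)
      then show "smooth_on V (\<lambda>p. (cmap c \<circ> \<sigma>) (snd p))" by (simp add: o_def)
    qed
    have cc: "cinv c (cmap c (\<sigma> y)) = \<sigma> y" if "y \<in> W'" for y
      using that chart_homeo(6)[OF total_manifold c(1)] by (auto simp: W'_def)
    have "smooth_on V ((\<lambda>(t, x). cmap c' (act P t (cinv c x))) \<circ> (\<lambda>p. (fst p, (cmap c \<circ> \<sigma>) (snd p))))"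
      by (rule smooth_on_compose[OF V(1) _ 1 act_smooth[OF c(1) c']]) (auto simp: V_def cc W'_def)
    then have "smooth_on V (cmap c' \<circ> (\<lambda>(t, y). act P t (\<sigma> y)))"
      by (rule smooth_on_cong[OF V(1), THEN iffD1, rotated]) (auto simp: V_def cc)
    then show "\<exists>T. open T \<and> p \<in> T \<and> smooth_on T (cmap c' \<circ> (\<lambda>(t, y). act P t (\<sigma> y)))" using V by blast
  qed
qed

lemma act_smooth_map: "smooth_map_on (total P) (total P) UNIV (act P t)"
  unfolding smooth_map_on_def
proof (intro conjI ballI)
  have "continuous_on UNIV (\<lambda>z::'z. (t, z))" by (intro continuous_intros)
  from continuous_on_compose2[OF act_continuous this]
  show "continuous_on UNIV (act P t)" by (simp add: eta_contract_eq)
  fix c c' assume c: "c \<in> total P" "c' \<in> total P"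
  have op: "open (cmap c ` (cdom c \<inter> UNIV \<inter> act P t -` cdom c'))"
  proof -
    have "open (act P t -` cdom c')"
      using continuous_open_preimage[OF \<open>continuous_on UNIV (act P t)\<close> open_UNIV chart_homeo(1)[OF total_manifold c(2)]] by simp
    then show ?thesis
      unfolding Int_UNIV_right chart_image_eq_vimage[OF total_manifold c(1)]
      by (rule continuous_open_preimage[OF chart_homeo(4,2)[OF total_manifold c(1)]])
  qed
  have "smooth_on (cmap c ` (cdom c \<inter> UNIV \<inter> act P t -` cdom c'))
      ((\<lambda>(t, x). cmap c' (act P t (cinv c x))) \<circ> (\<lambda>x. (t, x)))"
  proof (rule smooth_on_compose[OF op _ _ act_smooth[OF c]])
    show "smooth_on (cmap c ` (cdom c \<inter> UNIV \<inter> act P t -` cdom c')) (\<lambda>x. (t, x))"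
      by (intro smooth_on_Pair[OF op] smooth_on_const smooth_on_bounded_linear bounded_linear_ident)
  qed (use chart_homeo(6)[OF total_manifold c(1)] in auto)
  then show "smooth_on (cmap c ` (cdom c \<inter> UNIV \<inter> act P t -` cdom c')) (cmap c' \<circ> act P t \<circ> cinv c)"
    by (simp add: o_def)
qed

lemma smooth_param_const: "smooth_param (total P) UNIV (\<lambda>_ :: 'e::euclidean_space. z)"
  unfolding smooth_param_def by (auto simp: o_def intro: smooth_on_const)

lemma smooth_param_orbit: "smooth_param (total P) UNIV (\<lambda>t. act P t z)"
proof -
  \<comment> \<open>The constant map is given a dummy real variable, so that the orbit becomes a
    line inside a flowed-out parametrization.\<close>
  have "smooth_param (total P) UNIV ((\<lambda>(t, y::real). act P t z) \<circ> (\<lambda>t. (t, 0)))"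
  proof (rule smooth_param_compose[OF total_manifold smooth_param_act[OF smooth_param_const] open_UNIV])
    show "smooth_on UNIV (\<lambda>t. (t, 0))"
      by (intro smooth_on_Pair smooth_on_const smooth_on_bounded_linear bounded_linear_ident open_UNIV)
  qed simp
  then show ?thesis by (simp add: o_def)
qed

text \<open>Rewrites the velocity of the orbit as the derivative of a parametrization, so that the
  chain rules for \<open>param_deriv\<close> apply to the generator.\<close>

lemma generator_param: "generator P z = param_deriv (total P) (\<lambda>t. act P t z) 0 1"
proof -
  have "((\<lambda>t. cmap (chart_at (total P) z) (act P t z)) has_derivative param_deriv (total P) (\<lambda>t. act P t z) 0) (at 0)"
    using smooth_param_has_derivative[OF total_manifold smooth_param_orbit UNIV_I, of 0 z] by (simp add: o_def act_0)
  moreover from has_derivative_linear[OF this]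
  have "param_deriv (total P) (\<lambda>t. act P t z) 0 = (\<lambda>r. r *\<^sub>R param_deriv (total P) (\<lambda>t. act P t z) 0 1)"
    by (metis linear_cmul mult.right_neutral real_scaleR_def)
  ultimately have "((\<lambda>t. cmap (chart_at (total P) z) (act P t z)) has_vector_derivative
      param_deriv (total P) (\<lambda>t. act P t z) 0 1) (at 0)"
    by (simp add: has_vector_derivative_def)
  then show ?thesis unfolding generator_def by (rule vector_derivative_at)
qed

lemma has_derivative_fst_line: "((\<lambda>t::real. (t + t0, y)) has_derivative (\<lambda>r. (r, 0))) (at x)"
  by (auto intro!: derivative_eq_intros)

text \<open>By the group law, advancing \<open>t\<close> amounts to acting for a short time on the
  point already reached.\<close>

lemma param_deriv_act_vertical:
  assumes \<sigma>: "smooth_param (total P) W \<sigma>" and y: "y \<in> W"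
  shows "param_deriv (total P) (\<lambda>(t, y). act P t (\<sigma> y)) (t, y) (1, 0) = generator P (act P t (\<sigma> y))"
proof -
  have "(\<lambda>r. act P r (act P t (\<sigma> y))) = (\<lambda>(t, y). act P t (\<sigma> y)) \<circ> (\<lambda>r. (r + t, y))"
    by (simp add: fun_eq_iff act_add)
  moreover have "param_deriv (total P) ((\<lambda>(t, y). act P t (\<sigma> y)) \<circ> (\<lambda>r. (r + t, y))) 0 =
      param_deriv (total P) (\<lambda>(t, y). act P t (\<sigma> y)) (0 + t, y) \<circ> frechet_derivative (\<lambda>r. (r + t, y)) (at 0)"
    by (rule param_deriv_compose[OF total_manifold smooth_param_act[OF \<sigma>]])
      (use y has_derivative_fst_line in \<open>auto simp: differentiable_def\<close>)
  moreover have "frechet_derivative (\<lambda>r. (r + t, y)) (at 0) = (\<lambda>r. (r, 0))"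
    by (rule frechet_derivative_eqI) (rule has_derivative_fst_line)
  ultimately show ?thesis by (simp add: generator_param)
qed

lemma param_deriv_act_horizontal:
  assumes \<sigma>: "smooth_param (total P) W \<sigma>" and y: "y \<in> W"
  shows "param_deriv (total P) (\<lambda>(t, y). act P t (\<sigma> y)) (t, y) (0, b) = dact t (\<sigma> y) (param_deriv (total P) \<sigma> y b)"
proof -
  have "act P t \<circ> \<sigma> = (\<lambda>(t, y). act P t (\<sigma> y)) \<circ> (\<lambda>y. (t, y))" by (simp add: fun_eq_iff)
  moreover have d: "((\<lambda>y. (t, y)) has_derivative (\<lambda>b. (0, b))) (at y)" by (auto intro!: derivative_eq_intros)
  have "param_deriv (total P) ((\<lambda>(t, y). act P t (\<sigma> y)) \<circ> (\<lambda>y. (t, y))) y =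
      param_deriv (total P) (\<lambda>(t, y). act P t (\<sigma> y)) (t, y) \<circ> frechet_derivative (\<lambda>y. (t, y)) (at y)"
    by (rule param_deriv_compose[OF total_manifold smooth_param_act[OF \<sigma>]])
      (use y d in \<open>auto simp: differentiable_def\<close>)
  moreover have "param_deriv (total P) (act P t \<circ> \<sigma>) y = dact t (\<sigma> y) \<circ> param_deriv (total P) \<sigma> y"
    by (rule param_deriv_map[OF total_manifold total_manifold act_smooth_map open_UNIV \<sigma> y UNIV_I])
  ultimately show ?thesis using frechet_derivative_eqI[OF d] by (metis comp_apply)
qed

lemma dproj_generator: "dproj z (generator P z) = 0"
proof -
  have "param_deriv (base P) (proj P \<circ> (\<lambda>t. act P t z)) 0 = dproj (act P 0 z) \<circ> param_deriv (total P) (\<lambda>t. act P t z) 0"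
    by (rule param_deriv_map[OF total_manifold base_manifold proj_smooth open_UNIV smooth_param_orbit UNIV_I UNIV_I])
  moreover have "param_deriv (base P) (proj P \<circ> (\<lambda>t. act P t z)) (0::real) = (\<lambda>_. 0)"
    unfolding param_deriv_def o_def proj_act by (simp add: frechet_derivative_const)
  ultimately show ?thesis by (simp add: generator_param act_0 fun_eq_iff)
qed

lemma dact_generator: "dact t z (generator P z) = generator P (act P t z)"
proof -
  have "param_deriv (total P) (act P t \<circ> (\<lambda>r. act P r z)) 0 = dact t (act P 0 z) \<circ> param_deriv (total P) (\<lambda>r. act P r z) 0"
    by (rule param_deriv_map[OF total_manifold total_manifold act_smooth_map open_UNIV smooth_param_orbit UNIV_I UNIV_I])
  moreover have "act P t \<circ> (\<lambda>r. act P r z) = (\<lambda>r. act P r (act P t z))"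
    by (simp add: fun_eq_iff flip: act_add add: add.commute)
  ultimately show ?thesis by (simp add: generator_param act_0)
qed

lemma dproj_dact: "dproj (act P t z) (dact t z w) = dproj z w"
proof -
  have "mderiv (total P) (base P) (proj P \<circ> act P t) z = dproj (act P t z) \<circ> dact t z"
    by (rule mderiv_compose[OF total_manifold total_manifold base_manifold act_smooth_map open_UNIV UNIV_I
          proj_smooth open_UNIV UNIV_I])
  moreover have "proj P \<circ> act P t = proj P" by (simp add: fun_eq_iff proj_act)
  ultimately show ?thesis by (metis comp_apply)
qed

lemma A_dact: "A (act P t z) [dact t z w] = A z [w]"
proof -
  have "pullback (total P) (total P) (act P t) A z [w] = A z [w]"
    using connection(2) by (simp add: invariant_on_def)
  then show ?thesis by (simp add: pullback_def)
qed

section \<open>The splitting and the volume form on the tangent spaces of the bundle\<close>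

lemma linear_dproj: "linear (dproj z)"
  by (rule linear_mderiv[OF total_manifold base_manifold proj_smooth open_UNIV UNIV_I])

text \<open>A local section gives a right inverse of the differential on its image; the action
  transports it along the fibre.\<close>

lemma surj_dproj: "surj (dproj z)"
proof -
  obtain U s \<tau> where U: "proj P z \<in> U" "local_trivialization P U s \<tau>" using ex_trivialization by blast
  note triv = trivializationD[OF U(2)]
  define x where "x = proj P z"
  obtain t where t: "z = act P t (s x)" using triv(5)[OF U(1)] by (auto simp: x_def)
  define c where "c = chart_at (base P) x"
  have c: "c \<in> base P" "x \<in> cdom c" using chart_at[OF base_manifold] by (auto simp: c_def)
  have "mderiv (base P) (base P) (proj P \<circ> s) x = dproj (s x) \<circ> mderiv (base P) (total P) s x"
    by (rule mderiv_compose[OF base_manifold total_manifold base_manifold triv(2,1) _ proj_smooth open_UNIV UNIV_I])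
      (use U x_def in simp)
  moreover have "mderiv (base P) (base P) (proj P \<circ> s) x = mderiv (base P) (base P) (\<lambda>p. p) x"
    unfolding mderiv_param[OF base_manifold] c_def[symmetric]
  proof (rule param_deriv_cong_open)
    show "open (cmap c ` (cdom c \<inter> U))"
      unfolding chart_image_eq_vimage[OF base_manifold c(1)]
      by (rule continuous_open_preimage[OF chart_homeo(4,2)[OF base_manifold c(1)] triv(1)])
    show "cmap c x \<in> cmap c ` (cdom c \<inter> U)" using c U by (auto simp: x_def)
    show "(proj P \<circ> s \<circ> cinv c) y = ((\<lambda>p. p) \<circ> cinv c) y" if "y \<in> cmap c ` (cdom c \<inter> U)" for y
      using that triv(3) chart_homeo(6)[OF base_manifold c(1)] by auto
  qed
  ultimately have "dproj (s x) (mderiv (base P) (total P) s x e) = e" for e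
    by (metis mderiv_id[OF base_manifold] comp_apply)
  then have "dproj z (dact t (s x) (mderiv (base P) (total P) s x e)) = e" for e
    unfolding t dproj_dact .
  then show ?thesis unfolding surj_def by metis
qed

text \<open>Makes the linear algebra of one tangent space available at every point
  \<open>z\<close>.\<close>

sublocale split: vertical_splitting "dproj z" "A z" "generator P z" "h (proj P z)" "riem_vol h (proj P z)" for z
  by (rule vertical_splitting.intro)
    (rule linear_dproj surj_dproj dproj_generator alt_A connection(3) inner_h alt_form_riem_vol
      riem_vol_gram[where h = h, OF inner_h])+

lemma total_metric_split: "total_metric P h A z = split.g z"
  unfolding split.g_def total_metric_def by (simp add: fun_eq_iff)

lemma total_vol_split: "total_vol P h A z = split.vol z"
  unfolding split.vol_def total_vol_def pullback_def[abs_def] ..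

lemma alt_total_vol: "alt_form 3 (total_vol P h A z)"
  unfolding total_vol_split by (rule split.alt_vol)

lemma total_vol_generator: "total_vol P h A z [generator P z, x, y] = riem_vol h (proj P z) [dproj z x, dproj z y]"
  unfolding total_vol_split by (rule split.vol_v)

lemma total_vol_eq:
  "total_vol P h A z [x, y, w] = A z [x] * riem_vol h (proj P z) [dproj z y, dproj z w]
    - A z [y] * riem_vol h (proj P z) [dproj z x, dproj z w] + A z [w] * riem_vol h (proj P z) [dproj z x, dproj z y]"
  unfolding total_vol_split by (rule split.vol_eq)

lemma riem_vol_std_pos: "riem_vol h x std_frame > 0"
  unfolding std_frame_2 riem_vol_pos_iff[of h x, OF inner_h] by (simp add: det_rows_2 axis_def)

text \<open>Fixes the sign left open by the pointwise algebra: two vectors over the standard frame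
  of the base, preceded by the generator, form a positive frame by the fibre-first orientation, and
  on it the volume form equals the positive base area.\<close>

lemma total_vol_std_pos: "total_vol P h A z std_frame > 0"
proof -
  obtain u where u: "dproj z u = axis 1 1" by (metis surj_dproj surjD)
  obtain w where w: "dproj z w = axis 2 1" by (metis surj_dproj surjD)
  have "det (vector [generator P z, u, w] :: real^3^3) > 0"
    by (rule fibre_first) (simp add: u w det_rows_2 axis_def)
  moreover have "det (vector [generator P z, u, w] :: real^3^3) * total_vol P h A z std_frame > 0"
    using riem_vol_std_pos[of "proj P z"]
    unfolding alt_form_3_det[OF alt_total_vol, symmetric] total_vol_generator u w std_frame_2 .
  ultimately show ?thesis by (simp add: zero_less_mult_iff)
qed

lemma density_base: "density_form (\<lambda>x vs. k x * riem_vol h x vs) (\<lambda>x. k x * riem_vol h x std_frame)"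
  unfolding density_form_def by (simp add: alt_form_2_matrix[OF alt_form_riem_vol])

lemma density_total: "density_form (\<lambda>z vs. k z * total_vol P h A z vs) (\<lambda>z. k z * total_vol P h A z std_frame)"
  unfolding density_form_def by (simp add: alt_form_3_matrix[OF alt_total_vol])

text \<open>The volume form is built from \<open>A\<close> and the differential of the projection,
  both unchanged by the action.\<close>

lemma total_vol_dact:
  "total_vol P h A (act P t z) (map (dact t z) vs) = total_vol P h A z vs"
proof (cases "length vs = 3")
  case True
  then obtain x y w where "vs = [x, y, w]" using length_3_conv by metis
  then show ?thesis
    by (simp only: total_vol_eq list.map A_dact dproj_dact proj_act)
next
  case False
  then show ?thesis using alt_form_3D(7)[OF alt_total_vol] by simp
qed

end

text \<open>The derivative of an inverse chart is written in the preferred chart, which belongs to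
  the atlas, so it is that of a change of charts.\<close>

lemma oriented_det_pos:
  assumes M: "smooth_manifold \<A>" and o: "oriented_atlas \<A>" and c: "c \<in> \<A>" "x \<in> cmap c ` cdom c"
  shows "det (matrix (param_deriv \<A> (cinv c) x)) > 0"
proof -
  define p where "p = cinv c x"
  have p: "p \<in> cdom c" "cmap c p = x" using chart_homeo(7,8)[OF M c] by (auto simp: p_def)
  have "chart_at \<A> p \<in> \<A>" "p \<in> cdom (chart_at \<A> p)" using chart_at[OF M] .
  then have "det (matrix (frechet_derivative (cmap (chart_at \<A> p) \<circ> cinv c) (at (cmap c p)))) > 0"
    using o c(1) p(1) unfolding oriented_atlas_def by blast
  then show ?thesis by (simp add: param_deriv_def p(2) p_def[symmetric])
qed

subsection \<open>Curvature of a connection\<close>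

text \<open>Forms are functions on lists of all lengths, so an equality of forms must also be
  checked on lists of the wrong length.\<close>

lemma ext_d_length:
  assumes "\<And>p. alt_form k (\<omega> p)" "length vs \<noteq> Suc k"
  shows "ext_d \<A> \<omega> p vs = 0"
proof -
  have "in_chart \<A> c \<omega> x (take i vs @ drop (Suc i) vs) = 0" if "i < length vs" for c x i
  proof -
    have "length (take i vs @ drop (Suc i) vs) \<noteq> k" using that assms(2) by auto
    then show ?thesis using assms(1) unfolding in_chart_def alt_form_def by simp
  qed
  then show ?thesis unfolding ext_d_def by (intro sum.neutral) (simp add: frechet_derivative_const)
qed

section \<open>Area and volume densities in charts\<close>

context surface_bundle
begin

text \<open>On the image of a chart of the base this is the classical factor
  \<open>sqrt (det h)\<close> in the coordinates of \<open>c\<close>.\<close>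

definition area_density :: "('s, 2) chart \<Rightarrow> real^2 \<Rightarrow> real" where
  "area_density c y = in_chart (base P) c (riem_vol h) y std_frame"

lemma riem_vol_chart:
  assumes "c \<in> base P" "y \<in> cmap c ` cdom c"
  shows "riem_vol h (cinv c y) [param_deriv (base P) (cinv c) y a, param_deriv (base P) (cinv c) y b]
    = det (vector [a, b] :: real^2^2) * area_density c y"
proof -
  define M where "M = param_deriv (base P) (cinv c) y"
  have M: "linear M" unfolding M_def by (rule linear_param_deriv[OF base_manifold smooth_param_cinv[OF base_manifold assms(1)] assms(2)])
  have "alt_form 2 (\<lambda>vs. riem_vol h (cinv c y) (map M vs))"
    using linear_compose[OF M alt_form_2D(1)[OF alt_form_riem_vol]] linear_compose[OF M alt_form_2D(2)[OF alt_form_riem_vol]]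
      alt_form_2D(3)[OF alt_form_riem_vol] alt_form_2D(4)[OF alt_form_riem_vol[of h "cinv c y"]]
    by (intro alt_form_2I) (auto simp: o_def)
  from alt_form_2_det[OF this] show ?thesis
    by (simp add: area_density_def in_chart_param M_def)
qed

lemma area_density_pos:
  assumes "c \<in> base P" "y \<in> cmap c ` cdom c"
  shows "area_density c y > 0"
  using oriented_det_pos[OF base_manifold base_oriented assms] riem_vol_std_pos
  by (simp add: area_density_def in_chart_param alt_form_2_matrix[OF alt_form_riem_vol])

text \<open>\<open>riem_vol\<close> uses metric coefficients in preferred charts, so its smoothness
  is not visible. The Gram identity and the orientation express the density as the square root of a
  positive polynomial in the smooth metric coefficients of the chart \<open>c\<close>.\<close>

lemma smooth_on_area_density:
  assumes c: "c \<in> base P"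
  shows "smooth_on (cmap c ` cdom c) (area_density c)"
proof -
  define H where "H v w y = h (cinv c y) (param_deriv (base P) (cinv c) y v) (param_deriv (base P) (cinv c) y w)" for v w y
  have H: "smooth_on (cmap c ` cdom c) (H v w)" for v w
    using metric c unfolding riemannian_metric_def H_def by (simp add: in_chart_param)
  have op: "open (cmap c ` cdom c)" by (rule chart_homeo(2)[OF base_manifold c])
  have sq: "(area_density c y)\<^sup>2 = H (axis 1 1) (axis 1 1) y * H (axis 2 1) (axis 2 1) y
      - H (axis 1 1) (axis 2 1) y * H (axis 1 1) (axis 2 1) y" for y
    unfolding area_density_def in_chart_param std_frame_2 H_def
    using riem_vol_gram[where h = h, OF inner_h] by (simp add: power2_eq_square)
  have eq: "area_density c y = sqrt (H (axis 1 1) (axis 1 1) y * H (axis 2 1) (axis 2 1) y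
      - H (axis 1 1) (axis 2 1) y * H (axis 1 1) (axis 2 1) y)" if "y \<in> cmap c ` cdom c" for y
    using area_density_pos[OF c that] unfolding sq[symmetric] by simp
  show ?thesis
  proof (subst smooth_on_cong[OF op eq], assumption)
    show "smooth_on (cmap c ` cdom c) (\<lambda>y. sqrt (H (axis 1 1) (axis 1 1) y * H (axis 2 1) (axis 2 1) y
      - H (axis 1 1) (axis 2 1) y * H (axis 1 1) (axis 2 1) y))"
    proof (intro smooth_on_sqrt smooth_on_diff smooth_on_mult op H)
      fix y assume "y \<in> cmap c ` cdom c"
      from area_density_pos[OF c this] show "0 < H (axis 1 1) (axis 1 1) y * H (axis 2 1) (axis 2 1) y
          - H (axis 1 1) (axis 2 1) y * H (axis 1 1) (axis 2 1) y"
        unfolding sq[symmetric] by simp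
    qed
  qed
qed

lemma smooth_on_riem_vol_param:
  fixes \<Phi> :: "'e::euclidean_space \<Rightarrow> 's"
  assumes \<Phi>: "smooth_param (base P) W \<Phi>"
  shows "smooth_on W (\<lambda>y. riem_vol h (\<Phi> y) [param_deriv (base P) \<Phi> y a, param_deriv (base P) \<Phi> y b])"
proof (rule smooth_on_local)
  fix y assume y: "y \<in> W"
  define c where "c = chart_at (base P) (\<Phi> y)"
  have c: "c \<in> base P" "\<Phi> y \<in> cdom c" using chart_at[OF base_manifold] by (auto simp: c_def)
  define T where "T = W \<inter> \<Phi> -` cdom c"
  note T = smooth_param_chart_local[OF base_manifold \<Phi> y c, folded T_def]
  define X where "X = cmap c \<circ> \<Phi>"
  have sX: "smooth_on T X" using T(5) by (simp add: X_def)
  have eq: "riem_vol h (\<Phi> y) [param_deriv (base P) \<Phi> y a, param_deriv (base P) \<Phi> y b] =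
     (frechet_derivative X (at y) a $ 1 * frechet_derivative X (at y) b $ 2
      - frechet_derivative X (at y) a $ 2 * frechet_derivative X (at y) b $ 1) * (area_density c \<circ> X) y" if "y \<in> T" for y
  proof -
    have yW: "y \<in> W" "\<Phi> y \<in> cdom c" using that by (auto simp: T_def)
    have cx: "cinv c (X y) = \<Phi> y" using chart_homeo(6)[OF base_manifold c(1) yW(2)] by (simp add: X_def)
    have Xin: "X y \<in> cmap c ` cdom c" using yW by (simp add: X_def)
    have "param_deriv (base P) \<Phi> y = param_deriv (base P) (cinv c) (X y) \<circ> frechet_derivative X (at y)"
      using param_deriv_chart[OF base_manifold \<Phi> yW(1) c(1) yW(2)] by (simp add: X_def)
    then show ?thesis
      using riem_vol_chart[OF c(1) Xin] by (simp add: cx det_rows_2)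
  qed
  have "smooth_on T (\<lambda>y. (frechet_derivative X (at y) a $ 1 * frechet_derivative X (at y) b $ 2
      - frechet_derivative X (at y) a $ 2 * frechet_derivative X (at y) b $ 1) * (area_density c \<circ> X) y)"
  proof (intro smooth_on_mult smooth_on_diff smooth_on_component smooth_on_frechet_derivative T(1) sX)
    show "smooth_on T (area_density c \<circ> X)"
      by (rule smooth_on_compose[OF T(1) _ sX smooth_on_area_density[OF c(1)]]) (use T(4) in \<open>auto simp: X_def\<close>)
  qed
  then have "smooth_on T (\<lambda>y. riem_vol h (\<Phi> y) [param_deriv (base P) \<Phi> y a, param_deriv (base P) \<Phi> y b])"
    by (subst smooth_on_cong[OF T(1) eq])
  then show "\<exists>T. open T \<and> y \<in> T \<and> smooth_on T (\<lambda>y. riem_vol h (\<Phi> y) [param_deriv (base P) \<Phi> y a, param_deriv (base P) \<Phi> y b])"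
    using T(1,2) by blast
qed

definition volume_density :: "('z, 3) chart \<Rightarrow> real^3 \<Rightarrow> real" where
  "volume_density c y = in_chart (total P) c (total_vol P h A) y std_frame"

lemma volume_density_pos:
  assumes "c \<in> total P" "y \<in> cmap c ` cdom c"
  shows "volume_density c y > 0"
  using oriented_det_pos[OF total_manifold total_oriented assms] total_vol_std_pos
  by (simp add: volume_density_def in_chart_param alt_form_3_matrix[OF alt_total_vol])

text \<open>The wedge product expands into values of \<open>A\<close> and of the pulled back area
  form, each smooth along the inverse chart.\<close>

lemma smooth_on_volume_density:
  assumes c: "c \<in> total P"
  shows "smooth_on (cmap c ` cdom c) (volume_density c)"
proof -
  define W where "W = cmap c ` cdom c"
  have op: "open W" unfolding W_def by (rule chart_homeo(2)[OF total_manifold c])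
  have ci: "smooth_param (total P) W (cinv c)" unfolding W_def by (rule smooth_param_cinv[OF total_manifold c])
  have pr: "smooth_param (base P) W (proj P \<circ> cinv c)"
    by (rule smooth_param_map[OF total_manifold base_manifold proj_smooth open_UNIV ci]) simp
  define a where "a b y = A (cinv c y) [param_deriv (total P) (cinv c) y b]" for b y
  define n where "n b b' y = riem_vol h ((proj P \<circ> cinv c) y)
    [param_deriv (base P) (proj P \<circ> cinv c) y b, param_deriv (base P) (proj P \<circ> cinv c) y b']" for b b' y
  have eq: "volume_density c y = a (axis 1 1) y * n (axis 2 1) (axis 3 1) y - a (axis 2 1) y * n (axis 1 1) (axis 3 1) y
     + a (axis 3 1) y * n (axis 1 1) (axis 2 1) y" if "y \<in> W" for y
    using param_deriv_map[OF total_manifold base_manifold proj_smooth open_UNIV ci that UNIV_I]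
    by (simp add: volume_density_def in_chart_param std_frame_3 total_vol_eq a_def n_def)
  have "smooth_on W (\<lambda>y. a (axis 1 1) y * n (axis 2 1) (axis 3 1) y - a (axis 2 1) y * n (axis 1 1) (axis 3 1) y
     + a (axis 3 1) y * n (axis 1 1) (axis 2 1) y)"
    unfolding a_def n_def
    by (intro smooth_on_add smooth_on_diff smooth_on_mult op smooth_on_riem_vol_param pr
        smooth_on_one_form_param[OF total_manifold connection(1) ci])
  then have "smooth_on W (volume_density c)"
    by (subst smooth_on_cong[OF op eq])
  then show ?thesis by (simp add: W_def)
qed

section \<open>Fibres and descending forms\<close>

lemma fibre_transitive:
  assumes "proj P z = proj P z'"
  shows "\<exists>t. z' = act P t z"
proof -
  obtain U s \<tau> where U: "proj P z \<in> U" "local_trivialization P U s \<tau>" using ex_trivialization by blast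
  obtain t where t: "z = act P t (s (proj P z))" using trivializationD(5)[OF U(2,1)] by blast
  obtain r where r: "z' = act P r (s (proj P z'))" using trivializationD(5)[OF U(2), of z'] U(1) assms by auto
  have "act P (r - t) z = act P (r - t) (act P t (s (proj P z)))" using t by simp
  also have "\<dots> = z'" using r assms by (simp flip: act_add)
  finally show ?thesis by metis
qed

lemma surj_proj: "\<exists>z. proj P z = x"
  using ex_trivialization[of x] trivializationD(3) by metis

text \<open>The projection and its differential are both onto, so a pullback determines the form on
  the base.\<close>

lemma descend_pullback:
  assumes \<beta>: "\<And>x. alt_form 2 (\<beta> x)"
  shows "descend P 2 (pullback (total P) (base P) (proj P) \<beta>) = \<beta>"
  unfolding descend_def
proof (rule the_equality)
  show "(\<forall>x. alt_form 2 (\<beta> x)) \<and> pullback (total P) (base P) (proj P) \<beta> = pullback (total P) (base P) (proj P) \<beta>"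
    using \<beta> by blast
  fix \<beta>' assume \<beta>': "(\<forall>x. alt_form 2 (\<beta>' x)) \<and>
    pullback (total P) (base P) (proj P) \<beta>' = pullback (total P) (base P) (proj P) \<beta>"
  show "\<beta>' = \<beta>"
  proof (intro ext)
    fix x and vs :: "(real^2) list"
    obtain z where z: "proj P z = x" using surj_proj by blast
    have "\<exists>ws. vs = map (dproj z) ws"
      unfolding ex_map_conv using surj_dproj[of z] unfolding surj_def by blast
    then obtain ws where ws: "vs = map (dproj z) ws" by blast
    have "pullback (total P) (base P) (proj P) \<beta>' z ws = pullback (total P) (base P) (proj P) \<beta> z ws"
      using \<beta>' by simp
    then show "\<beta>' x vs = \<beta> x vs" by (simp add: pullback_def ws z)
  qed
qed

lemma generator_coefficient:
  assumes "dproj z w = 0"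
  shows "w = A z [w] *\<^sub>R generator P z"
proof -
  have "w - A z [w] *\<^sub>R generator P z = 0"
  proof (rule split.kernel)
    show "dproj z (w - A z [w] *\<^sub>R generator P z) = 0"
      using assms by (simp add: linear_diff[OF linear_dproj] linear_cmul[OF linear_dproj] dproj_generator)
    show "A z [w - A z [w] *\<^sub>R generator P z] = 0"
      using linear_diff[OF split.la, of z w] linear_cmul[OF split.la, of z "A z [w]" "generator P z"] connection(3)[of z] by simp
  qed
  then show ?thesis by simp
qed

end

section \<open>Local product coordinates and the exterior derivative of the connection\<close>

text \<open>The chart and the trivializing set are unrelated, so all computations take place over
  the coordinate image \<open>W\<close> of their intersection.\<close>

locale trivialized_bundle = surface_bundle +
  fixes c :: "('a, 2) chart" and U s \<tau>
  assumes c: "c \<in> base P" and triv: "local_trivialization P U s \<tau>"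
begin

definition W :: "(real^2) set" where "W = cmap c ` (cdom c \<inter> U)"

definition \<sigma> :: "real^2 \<Rightarrow> 'b" where "\<sigma> = s \<circ> cinv c"

text \<open>The time \<open>t\<close> runs over the whole line, so that the domain is open in a
  normed space; \<Phi> winds around each fibre once per unit of time.\<close>

definition \<Phi> :: "real \<times> (real^2) \<Rightarrow> 'b" where "\<Phi> = (\<lambda>(t, y). act P t (\<sigma> y))"

lemma \<sigma>_param: "smooth_param (total P) W \<sigma>"
  unfolding W_def \<sigma>_def
  by (rule smooth_map_on_cinv[OF base_manifold total_manifold trivializationD(2,1)[OF triv] c])

lemma open_W: "open W"
  using \<sigma>_param by (rule smooth_param_open)

lemma W_subset: "W \<subseteq> cmap c ` cdom c"
  by (auto simp: W_def)

lemma W_in_U: "y \<in> W \<Longrightarrow> cinv c y \<in> U"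
  using chart_homeo(6)[OF base_manifold c] by (auto simp: W_def)

lemma proj_\<sigma>: "y \<in> W \<Longrightarrow> proj P (\<sigma> y) = cinv c y"
  using trivializationD(3)[OF triv] W_in_U by (simp add: \<sigma>_def)

lemma proj_\<Phi>: "y \<in> W \<Longrightarrow> proj P (\<Phi> (t, y)) = cinv c y"
  using proj_\<sigma> by (simp add: \<Phi>_def proj_act)

lemma \<Phi>_param: "smooth_param (total P) (UNIV \<times> W) \<Phi>"
  unfolding \<Phi>_def by (rule smooth_param_act[OF \<sigma>_param])

lemma \<Phi>_onto:
  assumes "y \<in> W" "proj P z = cinv c y"
  obtains t where "z = \<Phi> (t, y)"
proof -
  obtain t where "z = act P t (s (proj P z))"
    using trivializationD(5)[OF triv, of z] assms W_in_U by auto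
  then show thesis using assms by (intro that[of t]) (simp add: \<Phi>_def \<sigma>_def)
qed

lemma dproj_d\<Phi>:
  assumes y: "y \<in> W"
  shows "dproj (\<Phi> (t, y)) (param_deriv (total P) \<Phi> (t, y) (r, b)) = param_deriv (base P) (cinv c) y b"
proof -
  have ty: "(t, y) \<in> UNIV \<times> W" using y by simp
  have "param_deriv (base P) (proj P \<circ> \<Phi>) (t, y) = dproj (\<Phi> (t, y)) \<circ> param_deriv (total P) \<Phi> (t, y)"
    by (rule param_deriv_map[OF total_manifold base_manifold proj_smooth open_UNIV \<Phi>_param ty UNIV_I])
  moreover have "param_deriv (base P) (proj P \<circ> \<Phi>) (t, y) = param_deriv (base P) (cinv c \<circ> snd) (t, y)"
    by (rule param_deriv_cong_open[OF smooth_param_open[OF \<Phi>_param] ty]) (auto simp: proj_\<Phi>)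
  moreover have d: "(snd has_derivative snd) (at (t, y))"
    by (rule bounded_linear_imp_has_derivative) (rule bounded_linear_snd)
  have "param_deriv (base P) (cinv c \<circ> snd) (t, y) = param_deriv (base P) (cinv c) (snd (t, y)) \<circ> frechet_derivative snd (at (t, y))"
    by (rule param_deriv_compose[OF base_manifold smooth_param_cinv[OF base_manifold c]])
      (use d y W_subset in \<open>auto simp: differentiable_def\<close>)
  ultimately show ?thesis using frechet_derivative_eqI[OF d] by (metis comp_apply snd_conv)
qed

lemma d\<Phi>_eq:
  assumes y: "y \<in> W"
  shows "param_deriv (total P) \<Phi> (t, y) (r, b) =
    r *\<^sub>R generator P (\<Phi> (t, y)) + dact t (\<sigma> y) (param_deriv (total P) \<sigma> y b)"
proof -
  have l: "linear (param_deriv (total P) \<Phi> (t, y))"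
    by (rule linear_param_deriv[OF total_manifold \<Phi>_param]) (use y in simp)
  have "param_deriv (total P) \<Phi> (t, y) (r *\<^sub>R (1, 0) + (0, b)) =
      r *\<^sub>R param_deriv (total P) \<Phi> (t, y) (1, 0) + param_deriv (total P) \<Phi> (t, y) (0, b)"
    by (simp only: linear_add[OF l] linear_cmul[OF l])
  then show ?thesis
    using param_deriv_act_vertical[OF \<sigma>_param y, of t] param_deriv_act_horizontal[OF \<sigma>_param y, of t b]
    by (simp add: \<Phi>_def)
qed

text \<open>The local gauge potential: the pullback of the connection by the section
  \<sigma>.\<close>

definition \<alpha> :: "real^2 \<Rightarrow> real^2 \<Rightarrow> real" where
  "\<alpha> b y = A (\<sigma> y) [param_deriv (total P) \<sigma> y b]"

text \<open>Invariance removes the motion by \<open>t\<close> and \<open>A\<close> is 1 on the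
  generator, so the connection pulls back to \<open>dt + \<alpha>\<close>.\<close>

lemma A_d\<Phi>:
  assumes y: "y \<in> W"
  shows "A (\<Phi> (t, y)) [param_deriv (total P) \<Phi> (t, y) (r, b)] = r + \<alpha> b y"
proof -
  have "A (\<Phi> (t, y)) [dact t (\<sigma> y) w] = A (\<sigma> y) [w]" for w
    using A_dact by (simp add: \<Phi>_def)
  then show ?thesis
    by (simp add: d\<Phi>_eq[OF y] linear_add[OF split.la] linear_cmul[OF split.la] connection(3) \<alpha>_def)
qed

text \<open>The base part of \<open>w\<close> is matched first; what remains is vertical, hence a
  multiple of the generator, which is the \<open>t\<close>-direction of \<Phi>.\<close>

lemma d\<Phi>_onto:
  assumes y: "y \<in> W"
  obtains r b where "w = param_deriv (total P) \<Phi> (t, y) (r, b)"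
proof -
  obtain b where b: "dproj (\<Phi> (t, y)) w = param_deriv (base P) (cinv c) y b"
    using surj_param_deriv_cinv[OF base_manifold c, of y] y W_subset by (metis subsetD surjD)
  let ?w = "w - param_deriv (total P) \<Phi> (t, y) (0, b)"
  have "dproj (\<Phi> (t, y)) ?w = 0"
    using dproj_d\<Phi>[OF y, of t 0 b] b by (simp add: linear_diff[OF linear_dproj])
  from generator_coefficient[OF this]
  have "w = A (\<Phi> (t, y)) [?w] *\<^sub>R generator P (\<Phi> (t, y)) + param_deriv (total P) \<Phi> (t, y) (0, b)"
    by (simp add: algebra_simps)
  also have "\<dots> = param_deriv (total P) \<Phi> (t, y) (A (\<Phi> (t, y)) [?w], b)"
    using d\<Phi>_eq[OF y, of t 0 b] d\<Phi>_eq[OF y, of t "A (\<Phi> (t, y)) [?w]" b] by simp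
  finally show thesis by (rule that)
qed

lemma smooth_\<alpha>: "smooth_on W (\<alpha> b)"
  unfolding \<alpha>_def[abs_def] by (rule smooth_on_one_form_param[OF total_manifold connection(1) \<sigma>_param])

text \<open>The curl of the gauge potential: the coefficient of \<open>d\<alpha>\<close> in the
  coordinates of the plane.\<close>

definition K :: "real^2 \<Rightarrow> real" where
  "K y = frechet_derivative (\<alpha> (axis 2 1)) (at y) (axis 1 1) - frechet_derivative (\<alpha> (axis 1 1)) (at y) (axis 2 1)"

lemma smooth_K: "smooth_on W K"
  unfolding K_def[abs_def] by (intro smooth_on_diff smooth_on_frechet_derivative smooth_\<alpha> open_W)

text \<open>Linearity in both slots reduces everything to four partial derivatives; antisymmetrizing
  in \<open>a\<close> and \<open>b\<close> will leave only \<open>K\<close>.\<close>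

lemma frechet_\<alpha>:
  assumes y: "y \<in> W"
  shows "frechet_derivative (\<alpha> b) (at y) a =
    b $ 1 * (a $ 1 * frechet_derivative (\<alpha> (axis 1 1)) (at y) (axis 1 1) + a $ 2 * frechet_derivative (\<alpha> (axis 1 1)) (at y) (axis 2 1))
    + b $ 2 * (a $ 1 * frechet_derivative (\<alpha> (axis 2 1)) (at y) (axis 1 1) + a $ 2 * frechet_derivative (\<alpha> (axis 2 1)) (at y) (axis 2 1))"
proof -
  have d: "(\<alpha> b has_derivative frechet_derivative (\<alpha> b) (at y)) (at y)" for b
    by (rule has_frechet_derivative[OF smooth_on_imp_differentiable[OF smooth_\<alpha> y]])
  have \<alpha>_lin: "\<alpha> b y = b $ 1 * \<alpha> (axis 1 1) y + b $ 2 * \<alpha> (axis 2 1) y" if "y \<in> W" for y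
  proof -
    have "linear (param_deriv (total P) \<sigma> y)" by (rule linear_param_deriv[OF total_manifold \<sigma>_param that])
    from linear_compose[OF this split.la[of "\<sigma> y"]] have l: "linear (\<lambda>b. \<alpha> b y)" by (simp add: \<alpha>_def o_def)
    have "\<alpha> b y = \<alpha> ((b $ 1) *\<^sub>R axis 1 1 + (b $ 2) *\<^sub>R axis 2 1) y" by (simp flip: vec2_expand)
    then show ?thesis by (simp add: linear_add[OF l] linear_cmul[OF l])
  qed
  have "((\<lambda>y. b $ 1 * \<alpha> (axis 1 1) y + b $ 2 * \<alpha> (axis 2 1) y) has_derivative
      (\<lambda>a. b $ 1 * frechet_derivative (\<alpha> (axis 1 1)) (at y) a + b $ 2 * frechet_derivative (\<alpha> (axis 2 1)) (at y) a)) (at y)"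
    by (intro has_derivative_add has_derivative_mult_right d)
  note eq = frechet_derivative_eqI[OF this]
  have "frechet_derivative (\<alpha> b) (at y) =
      frechet_derivative (\<lambda>y. b $ 1 * \<alpha> (axis 1 1) y + b $ 2 * \<alpha> (axis 2 1) y) (at y)"
    by (rule frechet_derivative_cong_open[OF open_W y]) (rule \<alpha>_lin)
  then have "frechet_derivative (\<alpha> b) (at y) a =
      b $ 1 * frechet_derivative (\<alpha> (axis 1 1)) (at y) a + b $ 2 * frechet_derivative (\<alpha> (axis 2 1)) (at y) a"
    unfolding eq by simp
  moreover have "frechet_derivative (\<alpha> e) (at y) a =
      a $ 1 * frechet_derivative (\<alpha> e) (at y) (axis 1 1) + a $ 2 * frechet_derivative (\<alpha> e) (at y) (axis 2 1)" for e
  proof -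
    have l: "linear (frechet_derivative (\<alpha> e) (at y))" using d has_derivative_linear by blast
    have "frechet_derivative (\<alpha> e) (at y) a = frechet_derivative (\<alpha> e) (at y) ((a $ 1) *\<^sub>R axis 1 1 + (a $ 2) *\<^sub>R axis 2 1)"
      by (simp flip: vec2_expand)
    then show ?thesis by (simp add: linear_add[OF l] linear_cmul[OF l])
  qed
  ultimately show ?thesis by metis
qed

text \<open>In product coordinates the derivative of \<open>dt + \<alpha>\<close> is
  \<open>d\<alpha>\<close>, without \<open>dt\<close> part and independent of \<open>t\<close>, so
  it comes from the base; dividing by the area density expresses it through the area form.\<close>

lemma ext_d_connection:
  assumes y: "y \<in> W" and z: "proj P z = cinv c y"
  shows "ext_d (total P) A z vs = (K y / area_density c y) * riem_vol h (cinv c y) (map (dproj z) vs)"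
proof (cases "length vs = 2")
  case False
  then show ?thesis
    using ext_d_length[of 1 A vs "total P" z] alt_A alt_form_2D(4)[OF alt_form_riem_vol[of h "cinv c y"], of "map (dproj z) vs"] by simp
next
  case True
  obtain t where t: "z = \<Phi> (t, y)" by (rule \<Phi>_onto[OF y z])
  obtain w w' where vs: "vs = [w, w']" using True length_2_conv by metis
  obtain r a where w: "w = param_deriv (total P) \<Phi> (t, y) (r, a)" by (rule d\<Phi>_onto[OF y])
  obtain r' b where w': "w' = param_deriv (total P) \<Phi> (t, y) (r', b)" by (rule d\<Phi>_onto[OF y])
  have ty: "(t, y) \<in> UNIV \<times> W" using y by simp
  \<comment> \<open>For a fixed direction \<open>(r, b)\<close> the pulled back connection is
    \<open>r + \<alpha> b\<close>, so the time component of the second direction drops out.\<close>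
  have D: "frechet_derivative (\<lambda>p. A (\<Phi> p) [param_deriv (total P) \<Phi> p (r, b)]) (at (t, y)) (r', a)
      = frechet_derivative (\<alpha> b) (at y) a" for r r' a b
  proof -
    have "(\<alpha> b has_derivative frechet_derivative (\<alpha> b) (at y)) (at (snd (t, y)))"
      using has_frechet_derivative[OF smooth_on_imp_differentiable[OF smooth_\<alpha> y]] by simp
    from has_derivative_compose[OF bounded_linear_imp_has_derivative[OF bounded_linear_snd] this]
    have "((\<lambda>p. r + \<alpha> b (snd p)) has_derivative (\<lambda>p. 0 + frechet_derivative (\<alpha> b) (at y) (snd p))) (at (t, y))"
      by (intro has_derivative_add has_derivative_const)
    then have "frechet_derivative (\<lambda>p. r + \<alpha> b (snd p)) (at (t, y)) (r', a) = frechet_derivative (\<alpha> b) (at y) a"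
      by (simp add: frechet_derivative_eqI)
    then show ?thesis
      by (subst frechet_derivative_cong_open[OF smooth_param_open[OF \<Phi>_param] ty, where g = "\<lambda>p. r + \<alpha> b (snd p)"])
        (auto simp: A_d\<Phi>)
  qed
  have "ext_d (total P) A z vs = frechet_derivative (\<alpha> b) (at y) a - frechet_derivative (\<alpha> a) (at y) b"
    unfolding t vs w w' ext_d_param[OF total_manifold connection(1) \<Phi>_param ty] D ..
  also have "\<dots> = det (vector [a, b] :: real^2^2) * K y"
    unfolding frechet_\<alpha>[OF y, of b a] frechet_\<alpha>[OF y, of a b] by (simp add: det_rows_2 K_def algebra_simps)
  also have "\<dots> = (K y / area_density c y) * (det (vector [a, b] :: real^2^2) * area_density c y)"
    using area_density_pos[OF c, of y] y W_subset by auto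
  also have "det (vector [a, b] :: real^2^2) * area_density c y = riem_vol h (cinv c y) (map (dproj z) vs)"
    using riem_vol_chart[OF c, of y a b] y W_subset
    by (auto simp: vs w w' t dproj_d\<Phi>[OF y])
  finally show ?thesis .
qed

end

section \<open>The curvature as a multiple of the area form\<close>

context surface_bundle
begin

text \<open>The defining property mentions neither a chart nor a section. Since at most one
  \<open>k\<close> can satisfy it, the formulas from different local trivializations agree on
  overlaps.\<close>

definition curvature_coeff :: "'s \<Rightarrow> real" where
  "curvature_coeff x = (SOME k. \<forall>z vs. proj P z = x \<longrightarrow>
     ext_d (total P) A z vs = k * riem_vol h x (map (dproj z) vs))"

lemma curvature_coeff_unique:
  assumes "\<And>z vs. proj P z = x \<Longrightarrow> ext_d (total P) A z vs = k * riem_vol h x (map (dproj z) vs)"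
  shows "curvature_coeff x = k"
  unfolding curvature_coeff_def
proof (rule some_equality)
  fix k' assume k': "\<forall>z vs. proj P z = x \<longrightarrow> ext_d (total P) A z vs = k' * riem_vol h x (map (dproj z) vs)"
  obtain z where z: "proj P z = x" using surj_proj by blast
  obtain u where u: "dproj z u = axis 1 1" by (metis surj_dproj surjD)
  obtain w where w: "dproj z w = axis 2 1" by (metis surj_dproj surjD)
  have "k' * riem_vol h x (map (dproj z) [u, w]) = k * riem_vol h x (map (dproj z) [u, w])"
    using assms[OF z] k' z by metis
  then show "k' = k" using riem_vol_std_pos[of x] by (simp add: u w std_frame_2)
qed (use assms in blast)

lemma curvature_coeff_chart:
  assumes "trivialized_bundle P h A c U s \<tau>" "y \<in> cmap c ` (cdom c \<inter> U)"
  shows "curvature_coeff (cinv c y) = trivialized_bundle.K P A c s y / area_density c y"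
proof -
  interpret trivialized_bundle P h A c U s \<tau> by fact
  show ?thesis
    by (rule curvature_coeff_unique[OF ext_d_connection]) (use assms(2) in \<open>auto simp: W_def\<close>)
qed

lemma ext_d_eq:
  "ext_d (total P) A = pullback (total P) (base P) (proj P) (\<lambda>x vs. curvature_coeff x * riem_vol h x vs)"
proof (intro ext)
  fix z vs
  obtain U s \<tau> where U: "proj P z \<in> U" "local_trivialization P U s \<tau>" using ex_trivialization by blast
  define c where "c = chart_at (base P) (proj P z)"
  have cz: "c \<in> base P" "proj P z \<in> cdom c" using chart_at[OF base_manifold] by (auto simp: c_def)
  interpret trivialized_bundle P h A c U s \<tau> by unfold_locales (use cz U in auto)
  define y where "y = cmap c (proj P z)"
  have y: "y \<in> W" "cinv c y = proj P z"
    using cz U chart_homeo(6)[OF base_manifold cz] by (auto simp: y_def W_def)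
  have "curvature_coeff (cinv c y) = K y / area_density c y"
    by (rule curvature_coeff_chart[OF trivialized_bundle_axioms]) (use y in \<open>simp add: W_def\<close>)
  then show "ext_d (total P) A z vs = pullback (total P) (base P) (proj P) (\<lambda>x vs. curvature_coeff x * riem_vol h x vs) z vs"
    using ext_d_connection[OF y(1) y(2)[symmetric], of vs] by (simp add: pullback_def y(2))
qed

lemma curvature_eq: "curvature P A = (\<lambda>x vs. curvature_coeff x * riem_vol h x vs)"
  unfolding curvature_def ext_d_eq by (rule descend_pullback) (rule alt_form_scale[OF alt_form_riem_vol])

text \<open>Near each point a trivialization is used, in which the coefficient is the quotient of
  \<open>K\<close> by the positive area density.\<close>

lemma smooth_curvature_coeff: "smooth_fun_on (base P) UNIV curvature_coeff"
  unfolding smooth_fun_on_def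
proof
  fix c assume c: "c \<in> base P"
  show "smooth_on (cmap c ` (cdom c \<inter> UNIV)) (curvature_coeff \<circ> cinv c)"
  proof (rule smooth_on_local)
    fix y assume y: "y \<in> cmap c ` (cdom c \<inter> UNIV)"
    obtain U s \<tau> where U: "cinv c y \<in> U" "local_trivialization P U s \<tau>" using ex_trivialization by blast
    interpret trivialized_bundle P h A c U s \<tau> by unfold_locales (use c U in auto)
    have yW: "y \<in> W"
      unfolding W_def chart_image_eq_vimage[OF base_manifold c] using y U by simp
    have pos: "area_density c y > 0" if "y \<in> W" for y
      using area_density_pos[OF c] that W_subset by blast
    have "smooth_on W (\<lambda>y. K y / area_density c y)"
      by (rule smooth_on_divide[OF open_W smooth_K smooth_on_subset[OF smooth_on_area_density[OF c] W_subset] pos])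
    moreover have "(curvature_coeff \<circ> cinv c) y = K y / area_density c y" if "y \<in> W" for y
      using curvature_coeff_chart[OF trivialized_bundle_axioms, of y] that by (simp add: W_def)
    ultimately have "smooth_on W (curvature_coeff \<circ> cinv c)"
      by (subst smooth_on_cong[OF open_W])
    then show "\<exists>T. open T \<and> y \<in> T \<and> smooth_on T (curvature_coeff \<circ> cinv c)" using open_W yW by blast
  qed
qed

end

subsection \<open>Integration along the fibres\<close>

lemma cis_2pi_inj:
  assumes "cis (2 * pi * t) = cis (2 * pi * t')" "0 \<le> t" "t < 1" "0 \<le> t'" "t' < 1"
  shows "t = t'"
proof -
  have "cis (2 * pi * (t - t')) = 1"
    using assms(1) by (simp add: right_diff_distrib flip: cis_divide)
  then have "cos (2 * pi * (t - t')) = 1" by (metis cis.sel(1) one_complex.sel(1))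
  then obtain n :: int where "2 * pi * (t - t') = real_of_int n * 2 * pi" using cos_one_2pi_int by blast
  then have n: "t - t' = n" by simp
  then have "\<bar>real_of_int n\<bar> < 1" using assms by linarith
  then have "n = 0" by linarith
  then show ?thesis using n by simp
qed

section \<open>Compactness of the total space\<close>

context surface_bundle
begin

lemma act_int: "act P (of_int n) z = z"
proof -
  have nat: "act P (real k) z = z" for k z
    by (induction k) (simp_all add: act_0 act_1 act_add)
  show ?thesis
  proof (cases "n \<ge> 0")
    case True
    then show ?thesis using nat[of "nat n" z] by simp
  next
    case False
    have "act P (of_int n) z = act P (of_int n) (act P (real (nat (- n))) z)" by (simp only: nat)
    also have "\<dots> = act P 0 z" using False by (simp flip: act_add)
    finally show ?thesis by (simp add: act_0)
  qed
qed

lemma act_frac: "act P (frac t) z = act P t z"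
proof -
  have "act P t z = act P (frac t) (act P (of_int \<lfloor>t\<rfloor>) z)" by (simp add: frac_def flip: act_add)
  then show ?thesis by (simp add: act_int)
qed

text \<open>After reducing time modulo 1, a small preimage lies in the image of the compact set
  \<open>{0..1} \<times> K\<close> under the action, and finitely many such images cover. This gives
  the existence of integrals over the total space.\<close>

lemma total_compact: "compact (UNIV :: 'z set)"
proof -
  have "\<exists>V L. open V \<and> x \<in> V \<and> compact L \<and> proj P -` V \<subseteq> L" for x
  proof -
    obtain U s \<tau> where U: "x \<in> U" "local_trivialization P U s \<tau>" using ex_trivialization by blast
    note triv = trivializationD[OF U(2)]
    obtain V K where V: "open V" "compact K" "x \<in> V" "V \<subseteq> K" "K \<subseteq> cdom (chart_at (base P) x) \<inter> U"
      using chart_compact_neighbourhood[OF base_manifold chart_at[OF base_manifold] triv(1) U(1)] by blast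
    have s: "continuous_on U s" using triv(2) by (simp add: smooth_map_on_def)
    have "continuous_on ({0..1} \<times> K) (\<lambda>p :: real \<times> 's. (fst p, s (snd p)))"
      by (intro continuous_intros continuous_on_compose2[OF s]) (use V in auto)
    from continuous_on_compose2[OF act_continuous this]
    have "continuous_on ({0..1} \<times> K) (\<lambda>p. act P (fst p) (s (snd p)))" by simp
    then have "compact ((\<lambda>p. act P (fst p) (s (snd p))) ` ({0..1} \<times> K))"
      by (rule compact_continuous_image) (intro compact_Times V compact_Icc)
    moreover have "proj P -` V \<subseteq> (\<lambda>p. act P (fst p) (s (snd p))) ` ({0..1} \<times> K)"
    proof
      fix z assume z: "z \<in> proj P -` V"
      then have "proj P z \<in> U" using V by auto
      then obtain t where t: "z = act P t (s (proj P z))" using triv(5) by blast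
      have "frac t \<in> {0..1}" using frac_ge_0[of t] frac_lt_1[of t] by simp
      moreover have "z = act P (frac t) (s (proj P z))" using t by (simp add: act_frac)
      ultimately show "z \<in> (\<lambda>p. act P (fst p) (s (snd p))) ` ({0..1} \<times> K)"
        using z V(4) by (intro image_eqI[of _ _ "(frac t, proj P z)"]) auto
    qed
    ultimately show ?thesis using V by blast
  qed
  then obtain V L where VL: "\<And>x. open (V x)" "\<And>x. x \<in> V x" "\<And>x. compact (L x)" "\<And>x. proj P -` V x \<subseteq> L x"
    by metis
  have "UNIV \<subseteq> (\<Union>x\<in>UNIV. V x)" using VL(2) by blast
  then obtain N where N: "finite N" "UNIV \<subseteq> (\<Union>x\<in>N. V x)"
    using VL(1) compactE_image[OF base_compact, of UNIV V] by metis
  have "z \<in> (\<Union>x\<in>N. L x)" for z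
  proof -
    obtain x where "x \<in> N" "proj P z \<in> V x" using N(2) by blast
    then show ?thesis using VL(4)[of x] by blast
  qed
  then have "UNIV = (\<Union>x\<in>N. L x)" by blast
  then show ?thesis using compact_UN[of N L] N(1) VL(3) by simp
qed

end

section \<open>Fibre integration over one trivializing set\<close>

text \<open>Integrals are taken over \<open>real^3\<close>, whereas \<Phi> lives on
  \<open>real \<times> real^2\<close>; the fibre coordinate comes first, as in the
  orientation.\<close>

definition cylinder_coords :: "real^3 \<Rightarrow> real \<times> (real^2)" where
  "cylinder_coords w = (w $ 1, vector [w $ 2, w $ 3])"

lemma bounded_linear_cylinder_coords: "bounded_linear cylinder_coords"
proof -
  have "linear cylinder_coords"
    by (rule linearI) (simp_all add: cylinder_coords_def vec_eq_iff forall_2)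
  then show ?thesis by (simp add: linear_conv_bounded_linear)
qed

context trivialized_bundle
begin

definition \<Psi> :: "real^3 \<Rightarrow> 'b" where "\<Psi> = \<Phi> \<circ> cylinder_coords"

definition V :: "(real^3) set" where "V = cylinder_coords -` (UNIV \<times> W)"

lemma \<Psi>_param: "smooth_param (total P) V \<Psi>"
  unfolding \<Psi>_def
proof (rule smooth_param_compose[OF total_manifold \<Phi>_param])
  show "open V" unfolding V_def
    by (rule open_vimage[OF smooth_param_open[OF \<Phi>_param] linear_continuous_on[OF bounded_linear_cylinder_coords]])
  show "smooth_on V cylinder_coords" by (rule smooth_on_bounded_linear[OF bounded_linear_cylinder_coords])
qed (auto simp: V_def)

text \<open>The first frame vector goes to the generator and the other two project to the frame of
  the chart, so the volume factor is the base area density, constant in time.\<close>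

lemma total_vol_d\<Psi>:
  assumes w: "w \<in> V"
  shows "total_vol P h A (\<Psi> w) (map (param_deriv (total P) \<Psi> w) std_frame) = area_density c (vector [w $ 2, w $ 3])"
proof -
  define y where "y = (vector [w $ 2, w $ 3] :: real^2)"
  have y: "y \<in> W" "cylinder_coords w = (w $ 1, y)" "\<Psi> w = \<Phi> (w $ 1, y)"
    using w by (auto simp: V_def cylinder_coords_def y_def \<Psi>_def)
  have d: "(cylinder_coords has_derivative cylinder_coords) (at w)"
    by (rule bounded_linear_imp_has_derivative[OF bounded_linear_cylinder_coords])
  have "param_deriv (total P) \<Psi> w = param_deriv (total P) \<Phi> (cylinder_coords w) \<circ> frechet_derivative cylinder_coords (at w)"
    unfolding \<Psi>_def
    by (rule param_deriv_compose[OF total_manifold \<Phi>_param])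
      (use y d in \<open>auto simp: differentiable_def\<close>)
  then have D: "param_deriv (total P) \<Psi> w e = param_deriv (total P) \<Phi> (w $ 1, y) (cylinder_coords e)" for e
    by (simp add: frechet_derivative_eqI[OF d] y(2))
  have e: "cylinder_coords (axis 1 1) = (1, 0)" "cylinder_coords (axis 2 1) = (0, axis 1 1)"
    "cylinder_coords (axis 3 1) = (0, axis 2 1)"
    by (simp_all add: cylinder_coords_def vec_eq_iff forall_2 axis_def)
  have v: "param_deriv (total P) \<Phi> (w $ 1, y) (1, 0) = generator P (\<Phi> (w $ 1, y))"
    using param_deriv_act_vertical[OF \<sigma>_param y(1)] by (simp add: \<Phi>_def)
  show ?thesis
    unfolding y_def[symmetric] std_frame_3 list.map D e v y(3) total_vol_generator dproj_d\<Phi>[OF y(1)] proj_\<Phi>[OF y(1)]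
    by (simp add: area_density_def in_chart_param std_frame_2)
qed

text \<open>The projection recovers the base coordinates, and \<tau> recovers the time modulo 1,
  hence the time itself on the half-open unit interval.\<close>

lemma inj_on_\<Psi>: "inj_on \<Psi> (V \<inter> {w. 0 \<le> w $ 1 \<and> w $ 1 < 1})"
proof (rule inj_onI)
  fix w w' assume w: "w \<in> V \<inter> {w. 0 \<le> w $ 1 \<and> w $ 1 < 1}" and w': "w' \<in> V \<inter> {w. 0 \<le> w $ 1 \<and> w $ 1 < 1}"
    and eq: "\<Psi> w = \<Psi> w'"
  define y y' where "y = (vector [w $ 2, w $ 3] :: real^2)" "y' = (vector [w' $ 2, w' $ 3] :: real^2)"
  have y: "y \<in> W" "\<Psi> w = \<Phi> (w $ 1, y)" and y': "y' \<in> W" "\<Psi> w' = \<Phi> (w' $ 1, y')"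
    using w w' by (auto simp: V_def cylinder_coords_def y_y'_def \<Psi>_def)
  have "cinv c y = cinv c y'" using eq proj_\<Phi>[OF y(1)] proj_\<Phi>[OF y'(1)] y(2) y'(2) by metis
  moreover have "cmap c (cinv c y) = y" "cmap c (cinv c y') = y'"
    using chart_homeo(7)[OF base_manifold c] y(1) y'(1) W_subset by blast+
  ultimately have yy: "y = y'" by metis
  have \<tau>: "\<tau> (\<Phi> (t, y)) = cis (2 * pi * t)" for t
    using trivializationD(4)[OF triv W_in_U[OF y(1)]] by (simp add: \<Phi>_def \<sigma>_def)
  have "w $ 1 = w' $ 1"
  proof (rule cis_2pi_inj)
    show "cis (2 * pi * w $ 1) = cis (2 * pi * w' $ 1)"
      using eq \<tau>[of "w $ 1"] \<tau>[of "w' $ 1"] y(2) y'(2) yy by simp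
  qed (use w w' in auto)
  moreover have "w $ 2 = w' $ 2" "w $ 3 = w' $ 3"
    using yy by (simp_all add: y_y'_def vec_eq_iff forall_2)
  ultimately show "w = w'" by (simp add: vec_eq_iff forall_3)
qed

text \<open>The base integral over \<open>D\<close> is spread over a cylinder with fibre of length
  one. \<Psi> maps the cylinder bijectively onto the preimage of \<open>D\<close>, and the given
  chart pieces cut it into parts to which the change of variables applies.\<close>

lemma fibre_integral_piece:
  assumes g: "continuous_on UNIV g" and D: "D \<in> sets borel" "D \<subseteq> cdom c \<inter> U"
    and int: "(\<lambda>x. in_chart (base P) c (\<lambda>x vs. g x * riem_vol h x vs) x std_frame) absolutely_integrable_on (cmap c ` D)"
    and J: "finite J" "J \<subseteq> total P" "\<And>k. k \<in> J \<Longrightarrow> E k \<in> sets borel" "\<And>k. k \<in> J \<Longrightarrow> E k \<subseteq> cdom k"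
      "disjoint_family_on E J" "(\<Union>k\<in>J. E k) = UNIV"
  shows "integral (cmap c ` D) (\<lambda>x. in_chart (base P) c (\<lambda>x vs. g x * riem_vol h x vs) x std_frame) =
    (\<Sum>k\<in>J. integral (cmap k ` (E k \<inter> proj P -` D))
      (\<lambda>x. in_chart (total P) k (\<lambda>z vs. g (proj P z) * total_vol P h A z vs) x std_frame))"
proof -
  define \<eta> where "\<eta> = (\<lambda>z vs. g (proj P z) * total_vol P h A z vs)"
  define f where "f = (\<lambda>x. in_chart (base P) c (\<lambda>x vs. g x * riem_vol h x vs) x std_frame)"
  define T where "T = cmap c ` D"
  define S where "S = {w :: real^3. 0 \<le> w $ 1 \<and> w $ 1 < 1 \<and> vector [w $ 2, w $ 3] \<in> T}"
  \<comment> \<open>The form on the total space in the coordinates of \<Psi>; on the cylinder it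
    equals the base integrand.\<close>
  define G where "G = (\<lambda>w. \<eta> (\<Psi> w) (map (param_deriv (total P) \<Psi> w) std_frame))"
  have f: "f y = g (cinv c y) * area_density c y" for y
    by (simp add: f_def area_density_def in_chart_param)
  have TW: "T \<subseteq> W" using D(2) by (auto simp: T_def W_def)
  have Tb: "T \<in> sets borel" unfolding T_def by (rule chart_image_borel[OF base_manifold c D(1)]) (use D in auto)
  have Tc: "continuous_on T f"
    unfolding f
  proof (intro continuous_on_mult)
    have "continuous_on (cmap c ` cdom c) (\<lambda>y. g (cinv c y))"
      by (rule continuous_on_compose2[OF g chart_homeo(4)[OF base_manifold c]]) simp
    then show "continuous_on T (\<lambda>y. g (cinv c y))"
      by (rule continuous_on_subset) (use TW W_subset in blast)
    show "continuous_on T (area_density c)"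
      using smooth_on_imp_continuous_on[OF smooth_on_area_density[OF c]]
      by (rule continuous_on_subset) (use TW W_subset in blast)
  qed
  note cyl = cylinder_integral[OF Tb Tc int[folded f_def T_def], folded S_def]
  have SV: "S \<subseteq> V" using TW by (auto simp: S_def V_def cylinder_coords_def)
  have proj_\<Psi>: "proj P (\<Psi> w) = cinv c (vector [w $ 2, w $ 3])" if "w \<in> V" for w
    using that proj_\<Phi> by (auto simp: V_def \<Psi>_def cylinder_coords_def)
  have GS: "G w = f (vector [w $ 2, w $ 3])" if "w \<in> S" for w
    using that SV total_vol_d\<Psi> proj_\<Psi> by (auto simp: G_def \<eta>_def f)
  have intG: "G absolutely_integrable_on S"
    using cyl(1) by (rule set_integrable_cong[THEN iffD1, rotated 3]) (auto simp: GS)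
  have "integral S G = integral S (\<lambda>w. f (vector [w $ 2, w $ 3]))"
    by (rule integral_cong) (rule GS)
  then have IG: "integral S G = integral T f" using cyl(2) by simp
  define S' where "S' k = S \<inter> \<Psi> -` E k" for k
  have S'b: "S' k \<in> sets borel" if k: "k \<in> J" for k
  proof -
    have "V \<inter> \<Psi> -` E k \<in> sets borel"
      by (rule borel_vimage_continuous[OF smooth_param_open[OF \<Psi>_param] smooth_param_continuous[OF \<Psi>_param] J(3)[OF k]])
    moreover have "S' k = S \<inter> (V \<inter> \<Psi> -` E k)" using SV by (auto simp: S'_def)
    ultimately show ?thesis using cyl(3) by simp
  qed
  have intG': "G absolutely_integrable_on (S' k)" if k: "k \<in> J" for k
    by (rule set_integrable_subset[OF intG]) (use S'b[OF k] in \<open>auto simp: S'_def\<close>)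
  have im: "\<Psi> ` S' k = E k \<inter> proj P -` D" for k
  proof
    show "\<Psi> ` S' k \<subseteq> E k \<inter> proj P -` D"
    proof (rule image_subsetI)
      fix w assume w: "w \<in> S' k"
      then have wS: "w \<in> S" "\<Psi> w \<in> E k" by (simp_all add: S'_def)
      have "vector [w $ 2, w $ 3] \<in> T" using wS(1) by (simp add: S_def)
      then obtain x where x: "x \<in> D" "vector [w $ 2, w $ 3] = cmap c x" unfolding T_def by blast
      have "proj P (\<Psi> w) = cinv c (cmap c x)" using proj_\<Psi> SV wS(1) x(2) by auto
      also have "\<dots> = x" by (rule chart_homeo(6)[OF base_manifold c]) (use x D in auto)
      finally show "\<Psi> w \<in> E k \<inter> proj P -` D" using x(1) wS(2) by simp
    qed
    show "E k \<inter> proj P -` D \<subseteq> \<Psi> ` S' k"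
    proof
      fix z assume z: "z \<in> E k \<inter> proj P -` D"
      define y where "y = cmap c (proj P z)"
      have zD: "proj P z \<in> D" "proj P z \<in> cdom c" "proj P z \<in> U" using z D(2) by auto
      have y: "y \<in> T" "y \<in> W" "cinv c y = proj P z"
        using zD chart_homeo(6)[OF base_manifold c zD(2)] by (simp_all add: y_def T_def W_def)
      obtain t where t: "z = \<Phi> (t, y)" by (rule \<Phi>_onto[OF y(2) y(3)[symmetric]])
      \<comment> \<open>Replacing the time by its fractional part leaves the point unchanged and
        lands in the cylinder.\<close>
      define w where "w = (vector [frac t, y $ 1, y $ 2] :: real^3)"
      have wy: "(vector [w $ 2, w $ 3] :: real^2) = y" by (simp add: w_def vec_eq_iff forall_2)
      have "\<Psi> w = z"
        by (simp add: \<Psi>_def cylinder_coords_def wy t) (simp add: \<Phi>_def w_def act_frac)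
      moreover have "w \<in> S" using y(1) wy frac_ge_0[of t] frac_lt_1[of t] by (simp add: S_def w_def)
      ultimately show "z \<in> \<Psi> ` S' k" using z by (auto simp: S'_def)
    qed
  qed
  have piece: "integral (S' k) G = integral (cmap k ` (E k \<inter> proj P -` D)) (\<lambda>x. in_chart (total P) k \<eta> x std_frame)"
    if k: "k \<in> J" for k
  proof -
    have kt: "k \<in> total P" using k J(2) by blast
    have sub: "S' k \<subseteq> V" "\<Psi> ` S' k \<subseteq> cdom k" using SV J(4)[OF k] by (auto simp: S'_def)
    have inj: "inj_on \<Psi> (S' k)"
      by (rule inj_on_subset[OF inj_on_\<Psi>]) (use SV in \<open>auto simp: S'_def S_def\<close>)
    \<comment> \<open>The volume form has positive coefficients both along \<Psi> and in the chart
      \<open>k\<close>, so the Jacobian between them is positive.\<close>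
    have pos: "det (matrix (frechet_derivative (cmap k \<circ> \<Psi>) (at w))) > 0" if w: "w \<in> S' k" for w
    proof -
      have wV: "w \<in> V" "\<Psi> w \<in> cdom k" using w sub by auto
      define N where "N = param_deriv (total P) (cinv k) (cmap k (\<Psi> w))"
      define X where "X = frechet_derivative (cmap k \<circ> \<Psi>) (at w)"
      have k\<Psi>: "cmap k (\<Psi> w) \<in> cmap k ` cdom k" using wV by simp
      have lN: "linear N" unfolding N_def by (rule linear_param_deriv[OF total_manifold smooth_param_cinv[OF total_manifold kt] k\<Psi>])
      have lX: "linear X" unfolding X_def
        using has_derivative_linear[OF has_frechet_derivative[OF smooth_param_differentiable[OF \<Psi>_param kt wV]]] .
      have "param_deriv (total P) \<Psi> w = N \<circ> X"
        unfolding N_def X_def by (rule param_deriv_chart[OF total_manifold \<Psi>_param wV(1) kt wV(2)])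
      then have "det (matrix N) * det (matrix X) * total_vol P h A (\<Psi> w) std_frame = area_density c (vector [w $ 2, w $ 3])"
        using total_vol_d\<Psi>[OF wV(1)] alt_form_3_matrix[OF alt_total_vol, of "\<Psi> w" "N \<circ> X"]
        by (simp add: matrix_compose[OF lX lN] det_mul)
      moreover have "area_density c (vector [w $ 2, w $ 3]) > 0"
        by (rule area_density_pos[OF c]) (use wV(1) W_subset in \<open>auto simp: V_def cylinder_coords_def\<close>)
      moreover have "det (matrix N) > 0"
        unfolding N_def by (rule oriented_det_pos[OF total_manifold total_oriented kt k\<Psi>])
      ultimately show ?thesis
        using total_vol_std_pos[of "\<Psi> w"] by (simp add: X_def zero_less_mult_iff) (smt (verit) mult_pos_pos mult_nonneg_nonpos zero_less_mult_iff)
    qed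
    have \<eta>: "density_form \<eta> (\<lambda>z. g (proj P z) * total_vol P h A z std_frame)"
      unfolding \<eta>_def by (rule density_total)
    note param = integral_param[OF total_manifold kt \<Psi>_param S'b[OF k] sub inj pos \<eta>, folded G_def, unfolded im]
    show ?thesis using param intG'[OF k] by simp
  qed
  have "(G has_integral (\<Sum>k\<in>J. integral (S' k) G)) (\<Union>k\<in>J. S' k)"
  proof (rule has_integral_UN[OF J(1)])
    show "(G has_integral integral (S' k) G) (S' k)" if "k \<in> J" for k
      using intG'[OF that] set_lebesgue_integral_eq_integral(1) integrable_integral by blast
    show "pairwise (\<lambda>i j. negligible (S' i \<inter> S' j)) J"
    proof (rule pairwiseI)
      fix i j assume "i \<in> J" "j \<in> J" "i \<noteq> j"
      then have "E i \<inter> E j = {}" using J(5) by (auto simp: disjoint_family_on_def)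
      then have "S' i \<inter> S' j = {}" by (auto simp: S'_def)
      then show "negligible (S' i \<inter> S' j)" by simp
    qed
  qed
  moreover have "(\<Union>k\<in>J. S' k) = S"
  proof -
    have "(\<Union>k\<in>J. S' k) = S \<inter> \<Psi> -` (\<Union>k\<in>J. E k)" by (auto simp: S'_def)
    then show ?thesis unfolding J(6) by simp
  qed
  ultimately have "integral S G = (\<Sum>k\<in>J. integral (S' k) G)" by (simp add: integral_unique)
  also have "\<dots> = (\<Sum>k\<in>J. integral (cmap k ` (E k \<inter> proj P -` D)) (\<lambda>x. in_chart (total P) k \<eta> x std_frame))"
    by (rule sum.cong[OF refl piece])
  finally show ?thesis unfolding IG by (simp add: f_def T_def \<eta>_def)
qed

end

section \<open>Global fibre integration\<close>

context surface_bundle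
begin

text \<open>Base pieces must lie in a chart and in a trivializing set, pieces of the total space
  only in a chart. The base is cut by pairs \<open>(c, x)\<close>, the preimages \<open>F\<close>
  cut the pieces of the total space, and the double sums are exchanged.\<close>

lemma fibre_integration:
  assumes g: "continuous_on UNIV g"
  shows "form_integral (base P) (\<lambda>x vs. g x * riem_vol h x vs)
       = form_integral (total P) (\<lambda>z vs. g (proj P z) * total_vol P h A z vs)"
proof -
  let ?\<eta>B = "\<lambda>x vs. g x * riem_vol h x vs"
  let ?\<eta>T = "\<lambda>z vs. g (proj P z) * total_vol P h A z vs"
  let ?fB = "\<lambda>c x. in_chart (base P) c ?\<eta>B x std_frame"
  let ?fT = "\<lambda>c x. in_chart (total P) c ?\<eta>T x std_frame"
  have gp: "continuous_on UNIV (\<lambda>z. g (proj P z))"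
    by (rule continuous_on_compose2[OF g]) (use proj_smooth in \<open>auto simp: smooth_map_on_def\<close>)
  have "\<exists>I. has_form_integral (base P) ?\<eta>B I"
  proof (rule has_form_integral_exists[OF base_manifold base_compact])
    fix c assume c: "c \<in> base P"
    have "continuous_on (cmap c ` cdom c) (\<lambda>x. g (cinv c x) * area_density c x)"
      by (intro continuous_on_mult smooth_on_imp_continuous_on[OF smooth_on_area_density[OF c]]
          continuous_on_compose2[OF g chart_homeo(4)[OF base_manifold c]]) simp
    then show "continuous_on (cmap c ` cdom c) (?fB c)"
      by (simp add: area_density_def in_chart_param)
  qed
  then obtain I where I: "has_form_integral (base P) ?\<eta>B I" ..
  have "\<exists>I. has_form_integral (total P) ?\<eta>T I"
  proof (rule has_form_integral_exists[OF total_manifold total_compact])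
    fix c assume c: "c \<in> total P"
    have "continuous_on (cmap c ` cdom c) (\<lambda>x. g (proj P (cinv c x)) * volume_density c x)"
      by (intro continuous_on_mult smooth_on_imp_continuous_on[OF smooth_on_volume_density[OF c]]
          continuous_on_compose2[OF gp chart_homeo(4)[OF total_manifold c]]) simp
    then show "continuous_on (cmap c ` cdom c) (?fT c)"
      by (simp add: volume_density_def in_chart_param)
  qed
  then obtain I' where I': "has_form_integral (total P) ?\<eta>T I'" ..
  obtain cs E where E: "finite cs" "cs \<subseteq> base P" "\<forall>c\<in>cs. E c \<in> sets borel \<and> E c \<subseteq> cdom c"
    "disjoint_family_on E cs" "(\<Union>c\<in>cs. E c) = UNIV"
    "\<forall>c\<in>cs. ?fB c absolutely_integrable_on (cmap c ` E c)"
    "I = (\<Sum>c\<in>cs. integral (cmap c ` E c) (?fB c))"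
    using I unfolding has_form_integral_def by (elim exE conjE) (rule that)
  obtain J E' where E': "finite J" "J \<subseteq> total P" "\<forall>k\<in>J. E' k \<in> sets borel \<and> E' k \<subseteq> cdom k"
    "disjoint_family_on E' J" "(\<Union>k\<in>J. E' k) = UNIV"
    "\<forall>k\<in>J. ?fT k absolutely_integrable_on (cmap k ` E' k)"
    "I' = (\<Sum>k\<in>J. integral (cmap k ` E' k) (?fT k))"
    using I' unfolding has_form_integral_def by (elim exE conjE) (rule that)
  have "\<forall>x. \<exists>U s \<tau>. x \<in> U \<and> local_trivialization P U s \<tau>" using ex_trivialization by blast
  then obtain U s \<tau> where U: "\<And>x. x \<in> U x" "\<And>x. local_trivialization P (U x) (s x) (\<tau> x)" by metis
  have opU: "open (U x)" for x using trivializationD(1)[OF U(2)] .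
  have "UNIV \<subseteq> (\<Union>x\<in>UNIV. U x)" using U(1) by blast
  then obtain N where N: "finite N" "UNIV \<subseteq> (\<Union>x\<in>N. U x)"
    using opU compactE_image[OF base_compact, of UNIV U] by metis
  have "\<exists>G. (\<forall>x\<in>N. G x \<in> sets borel \<and> G x \<subseteq> U x) \<and> disjoint_family_on G N \<and> (\<Union>x\<in>N. G x) = (\<Union>x\<in>N. U x)"
    by (rule disjointify_borel[OF N(1)]) (use opU in simp)
  then obtain G where G: "\<forall>x\<in>N. G x \<in> sets borel \<and> G x \<subseteq> U x" "disjoint_family_on G N" "UNIV \<subseteq> (\<Union>x\<in>N. G x)"
    using N(2) by auto
  define F where "F = (\<lambda>(c, x). proj P -` (E c \<inter> G x))"
  have EA: "c \<in> base P" "E c \<in> sets borel" "E c \<subseteq> cdom c" "?fB c absolutely_integrable_on (cmap c ` E c)"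
    if "c \<in> cs" for c using E(2,3,6) that by auto
  have E'A: "k \<in> total P" "E' k \<in> sets borel" "E' k \<subseteq> cdom k" "?fT k absolutely_integrable_on (cmap k ` E' k)"
    if "k \<in> J" for k using E'(2,3,6) that by auto
  have GA: "G x \<in> sets borel" "G x \<subseteq> U x" if "x \<in> N" for x using G(1) that by auto
  have subG: "X \<subseteq> (\<Union>x\<in>N. G x)" for X using G(3) by blast
  have sB: "integral (cmap c ` E c) (?fB c) = (\<Sum>x\<in>N. integral (cmap c ` (E c \<inter> G x)) (?fB c))"
    "\<And>x. x \<in> N \<Longrightarrow> ?fB c absolutely_integrable_on (cmap c ` (E c \<inter> G x))" if c: "c \<in> cs" for c
    using integral_chart_split[OF base_manifold EA(1-3)[OF c] N(1) GA(1) G(2) subG EA(4)[OF c]] by blast+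
  have piece: "integral (cmap c ` (E c \<inter> G x)) (?fB c) = (\<Sum>k\<in>J. integral (cmap k ` (E' k \<inter> F (c, x))) (?fT k))"
    if cx: "c \<in> cs" "x \<in> N" for c x
  proof -
    interpret trivialized_bundle P h A c "U x" "s x" "\<tau> x"
      by unfold_locales (rule EA(1)[OF cx(1)], rule U(2))
    have "E c \<inter> G x \<in> sets borel" "E c \<inter> G x \<subseteq> cdom c \<inter> U x"
      using EA(2,3)[OF cx(1)] GA[OF cx(2)] by auto
    from fibre_integral_piece[OF g this sB(2)[OF cx] E'(1,2) E'A(2,3) E'(4,5)]
    show ?thesis by (simp add: F_def)
  qed
  have Fb: "F j \<in> sets borel" if "j \<in> cs \<times> N" for j
  proof -
    have "continuous_on UNIV (proj P)" using proj_smooth by (simp add: smooth_map_on_def)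
    then have "proj P -` (E (fst j) \<inter> G (snd j)) \<in> sets borel"
      using borel_vimage_continuous[OF open_UNIV, of "proj P" "E (fst j) \<inter> G (snd j)"] EA(2) GA(1) that by auto
    then show ?thesis by (simp add: F_def case_prod_unfold)
  qed
  have Fd: "disjoint_family_on F (cs \<times> N)"
    unfolding disjoint_family_on_def
  proof (intro ballI impI)
    fix i j assume ij: "i \<in> cs \<times> N" "j \<in> cs \<times> N" "i \<noteq> j"
    then have "E (fst i) \<inter> E (fst j) = {} \<or> G (snd i) \<inter> G (snd j) = {}"
      using E(4) G(2) unfolding disjoint_family_on_def by (metis mem_Times_iff prod_eqI)
    then show "F i \<inter> F j = {}" by (auto simp: F_def case_prod_unfold)
  qed
  have Fc: "X \<subseteq> (\<Union>j\<in>cs \<times> N. F j)" for X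
  proof
    fix z :: 'z
    have "proj P z \<in> (\<Union>c\<in>cs. E c)" "proj P z \<in> (\<Union>x\<in>N. G x)" using E(5) G(3) by blast+
    then show "z \<in> (\<Union>j\<in>cs \<times> N. F j)" by (auto simp: F_def)
  qed
  have sT: "integral (cmap k ` E' k) (?fT k) = (\<Sum>j\<in>cs \<times> N. integral (cmap k ` (E' k \<inter> F j)) (?fT k))" if k: "k \<in> J" for k
    by (rule integral_chart_split(2)[OF total_manifold E'A(1-3)[OF k] finite_cartesian_product[OF E(1) N(1)] Fb Fd Fc E'A(4)[OF k]])
  have "I = (\<Sum>c\<in>cs. \<Sum>x\<in>N. integral (cmap c ` (E c \<inter> G x)) (?fB c))"
    unfolding E(7) by (rule sum.cong[OF refl sB(1)])
  also have "\<dots> = (\<Sum>c\<in>cs. \<Sum>x\<in>N. \<Sum>k\<in>J. integral (cmap k ` (E' k \<inter> F (c, x))) (?fT k))"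
    by (intro sum.cong refl piece)
  also have "\<dots> = (\<Sum>j\<in>cs \<times> N. \<Sum>k\<in>J. integral (cmap k ` (E' k \<inter> F j)) (?fT k))"
    using sum.cartesian_product[of "\<lambda>c x. \<Sum>k\<in>J. integral (cmap k ` (E' k \<inter> F (c, x))) (?fT k)" N cs]
    by (simp only: case_prod_unfold prod.collapse)
  also have "\<dots> = (\<Sum>k\<in>J. \<Sum>j\<in>cs \<times> N. integral (cmap k ` (E' k \<inter> F j)) (?fT k))"
    by (rule sum.swap)
  also have "\<dots> = I'"
    unfolding E'(7) by (rule sum.cong[OF refl sT[symmetric]])
  finally have "I = I'" .
  then show ?thesis
    using form_integral_eq[OF base_manifold base_oriented density_base I]
      form_integral_eq[OF total_manifold total_oriented density_total[of "\<lambda>z. g (proj P z)"] I'] by simp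
qed

text \<open>The integral is a definite description, so even here existence comes first.\<close>

lemma form_integral_zero: "form_integral (base P) (\<lambda>x vs. 0) = 0"
proof -
  have "\<exists>I. has_form_integral (base P) (\<lambda>x vs. 0) I"
    by (rule has_form_integral_exists[OF base_manifold base_compact]) (simp add: in_chart_def)
  then obtain I where I: "has_form_integral (base P) (\<lambda>x vs. 0) I" ..
  have "density_form (\<lambda>x vs. 0 :: real) (\<lambda>x :: 's. 0)" by (simp add: density_form_def)
  then have "form_integral (base P) (\<lambda>x vs. 0) = I"
    using form_integral_eq[OF base_manifold base_oriented _ I] by blast
  also have "I = 0" using I unfolding has_form_integral_def by (auto simp: in_chart_def)
  finally show ?thesis .
qed

section \<open>Invariant functions on the total space\<close>

lemma continuous_on_total:
  fixes f :: "'z \<Rightarrow> real"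
  assumes "\<And>c. c \<in> total P \<Longrightarrow> continuous_on (cmap c ` cdom c) (f \<circ> cinv c)"
  shows "continuous_on UNIV f"
proof -
  have "isCont f z" for z
  proof -
    define c where "c = chart_at (total P) z"
    have c: "c \<in> total P" "z \<in> cdom c" using chart_at[OF total_manifold] by (auto simp: c_def)
    have "continuous_on (cdom c) ((f \<circ> cinv c) \<circ> cmap c)"
      by (rule continuous_on_compose[OF chart_homeo(3)[OF total_manifold c(1)] assms[OF c(1)]])
    then have "continuous_on (cdom c) f"
      by (rule continuous_on_eq) (simp add: chart_homeo(6)[OF total_manifold c(1)])
    then show ?thesis
      using continuous_on_eq_continuous_at[OF chart_homeo(1)[OF total_manifold c(1)]] c(2) by blast
  qed
  then show ?thesis by (simp add: continuous_at_imp_continuous_on)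
qed

text \<open>The function is well defined because the action is transitive on fibres, and continuous
  because over a trivializing set it is \<open>f\<close> along the local section.\<close>

lemma invariant_function_descends:
  fixes f :: "'z \<Rightarrow> real"
  assumes "continuous_on UNIV f" "\<And>t z. f (act P t z) = f z"
  obtains g where "continuous_on UNIV g" "\<And>z. g (proj P z) = f z"
proof -
  define g where "g x = f (SOME z. proj P z = x)" for x
  have g: "g (proj P z) = f z" for z
  proof -
    have "proj P (SOME z'. proj P z' = proj P z) = proj P z" by (rule someI) (rule refl)
    from fibre_transitive[OF this] show ?thesis using assms(2) by (metis g_def)
  qed
  have "isCont g x" for x
  proof -
    obtain U s \<tau> where U: "x \<in> U" "local_trivialization P U s \<tau>" using ex_trivialization by blast
    note triv = trivializationD[OF U(2)]
    have "continuous_on U s" using triv(2) by (simp add: smooth_map_on_def)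
    then have "continuous_on U (\<lambda>x. f (s x))" by (rule continuous_on_compose2[OF assms(1)]) simp
    then have "continuous_on U g"
      by (rule continuous_on_eq) (metis g triv(3))
    then show ?thesis using continuous_on_eq_continuous_at[OF triv(1)] U(1) by blast
  qed
  then show thesis using g by (intro that[of g]) (simp_all add: continuous_at_imp_continuous_on)
qed

text \<open>The generator is written in preferred charts, so continuity is read off from a
  flowed-out chart \<open>(t, y)\<close>, where it is the derivative in direction
  \<open>(1, 0)\<close>, restricted to \<open>t = 0\<close>.\<close>

lemma one_form_generator_continuous:
  assumes \<omega>: "smooth_form_on (total P) UNIV 1 \<omega>"
  shows "continuous_on UNIV (\<lambda>z. \<omega> z [generator P z])"
proof (rule continuous_on_total)
  fix c assume c: "c \<in> total P"
  let ?W = "cmap c ` cdom c"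
  let ?\<Phi> = "\<lambda>(t, y). act P t (cinv c y)"
  have ci: "smooth_param (total P) ?W (cinv c)" by (rule smooth_param_cinv[OF total_manifold c])
  have "continuous_on (UNIV \<times> ?W) (\<lambda>p. \<omega> (?\<Phi> p) [param_deriv (total P) ?\<Phi> p (1, 0)])"
    by (rule smooth_on_imp_continuous_on[OF smooth_on_one_form_param[OF total_manifold \<omega> smooth_param_act[OF ci]]])
  then have "continuous_on ?W (\<lambda>y. \<omega> (?\<Phi> (0, y)) [param_deriv (total P) ?\<Phi> (0, y) (1, 0)])"
    by (rule continuous_on_compose2) (auto intro!: continuous_intros)
  then show "continuous_on ?W ((\<lambda>z. \<omega> z [generator P z]) \<circ> cinv c)"
  proof (rule continuous_on_eq)
    fix y assume "y \<in> ?W"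
    from param_deriv_act_vertical[OF ci this, of 0]
    show "\<omega> (?\<Phi> (0, y)) [param_deriv (total P) ?\<Phi> (0, y) (1, 0)] = ((\<lambda>z. \<omega> z [generator P z]) \<circ> cinv c) y"
      by (simp add: act_0)
  qed
qed

lemma invariant_one_form_generator:
  assumes "invariant_on P UNIV \<omega>"
  shows "\<omega> (act P t z) [generator P (act P t z)] = \<omega> z [generator P z]"
proof -
  have "pullback (total P) (total P) (act P t) \<omega> z [generator P z] = \<omega> z [generator P z]"
    using assms by (simp add: invariant_on_def)
  then show ?thesis by (simp add: pullback_def dact_generator)
qed

end

subsection \<open>The flux and the moment map\<close>

locale flux_bundle = surface_bundle +
  fixes H
  assumes H_smooth: "smooth_form_on (total P) UNIV 3 H" and H_inv: "invariant_on P UNIV H"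
begin

text \<open>Evaluated in the preferred chart at \<open>z\<close>, but a ratio of top forms is the
  same in every frame; any chart computes the same value, which is how \<open>smooth_\<phi>\<close>
  works.\<close>

definition \<phi> :: "'b \<Rightarrow> real" where "\<phi> z = H z std_frame / total_vol P h A z std_frame"

lemma H_eq: "H z = (\<lambda>vs. \<phi> z * total_vol P h A z vs)"
proof
  fix vs
  have "alt_form 3 (H z)" using H_smooth by (simp add: smooth_form_on_def)
  then show "H z vs = \<phi> z * total_vol P h A z vs"
    unfolding \<phi>_def using total_vol_std_pos[of z] by (intro alt_form_3_top[OF _ alt_total_vol]) auto
qed

lemma \<phi>_invariant: "\<phi> (act P t z) = \<phi> z"
proof -
  have "pullback (total P) (total P) (act P t) H z std_frame = H z std_frame"
    using H_inv by (simp add: invariant_on_def)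
  then have "\<phi> (act P t z) * total_vol P h A z std_frame = \<phi> z * total_vol P h A z std_frame"
    by (simp only: pullback_def fun_cong[OF H_eq] total_vol_dact)
  then show ?thesis using total_vol_std_pos[of z] by simp
qed

lemma smooth_\<phi>:
  assumes c: "c \<in> total P"
  shows "smooth_on (cmap c ` cdom c) (\<phi> \<circ> cinv c)"
proof -
  have op: "open (cmap c ` cdom c)" by (rule chart_homeo(2)[OF total_manifold c])
  have l: "length (std_frame :: (real^3) list) = 3" by (simp add: std_frame_3)
  have H: "smooth_on (cmap c ` cdom c) (\<lambda>x. in_chart (total P) c H x std_frame)"
    using H_smooth c l unfolding smooth_form_on_def by simp
  have eq: "(\<phi> \<circ> cinv c) y = in_chart (total P) c H y std_frame / volume_density c y" if "y \<in> cmap c ` cdom c" for y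
    using volume_density_pos[OF c that] by (simp add: in_chart_param H_eq volume_density_def)
  show ?thesis
    by (subst smooth_on_cong[OF op eq], assumption)
      (rule smooth_on_divide[OF op H smooth_on_volume_density[OF c] volume_density_pos[OF c]])
qed

lemma continuous_\<phi>: "continuous_on UNIV \<phi>"
  by (rule continuous_on_total) (rule smooth_on_imp_continuous_on[OF smooth_\<phi>])

lemma \<phi>_A_in_g2: "(\<lambda>z vs. \<phi> z * A z vs) \<in> g2 P"
  unfolding g2_def mem_Collect_eq smooth_form_on_def
proof (intro conjI ballI allI impI)
  show "alt_form 1 (\<lambda>vs. \<phi> z * A z vs)" for z by (rule alt_form_scale[OF alt_A])
  show "smooth_on (cmap c ` (cdom c \<inter> UNIV)) (\<lambda>x. in_chart (total P) c (\<lambda>z vs. \<phi> z * A z vs) x vs)"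
    if c: "c \<in> total P" and l: "length vs = 1" for c vs
  proof -
    have A: "smooth_on (cmap c ` cdom c) (\<lambda>x. in_chart (total P) c A x vs)"
      using connection(1) c l unfolding smooth_form_on_def by simp
    have "smooth_on (cmap c ` cdom c) (\<lambda>x. (\<phi> \<circ> cinv c) x * in_chart (total P) c A x vs)"
      by (rule smooth_on_mult[OF chart_homeo(2)[OF total_manifold c] smooth_\<phi>[OF c] A])
    then show ?thesis by (simp add: in_chart_def)
  qed
  show "invariant_on P UNIV (\<lambda>z vs. \<phi> z * A z vs)"
    using connection(2) unfolding invariant_on_def pullback_def by (simp add: \<phi>_invariant fun_eq_iff)
qed

lemma l2_\<phi>_A:
  assumes "\<omega> \<in> g2 P"
  shows "l2_one_form P h A (\<lambda>z vs. \<phi> z * A z vs) \<omega> =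
    form_integral (total P) (\<lambda>z vs. \<phi> z * \<omega> z [generator P z] * total_vol P h A z vs)"
proof -
  have "alt_form 1 (\<omega> z)" for z using assms by (simp add: g2_def smooth_form_on_def)
  then show ?thesis
    unfolding l2_one_form_def total_metric_split by (simp only: split.form_inner_connection)
qed

lemma wedge_hodge_H:
  "(\<lambda>z. wedge 3 0 (H z) (hodge (total_metric P h A z) (total_vol P h A z) 3 (H z)))
    = (\<lambda>z vs. \<phi> z * \<phi> z * total_vol P h A z vs)"
proof
  fix z
  have "wedge 3 0 (H z) (hodge (total_metric P h A z) (total_vol P h A z) 3 (H z)) =
      wedge 3 0 (\<lambda>vs. \<phi> z * split.vol z vs) (hodge (split.g z) (split.vol z) 3 (\<lambda>vs. \<phi> z * split.vol z vs))"
    using H_eq[of z] by (simp only: total_metric_split total_vol_split)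
  also have "\<dots> = (\<lambda>vs. \<phi> z * \<phi> z * split.vol z vs)" by (rule ext) (rule split.wedge_hodge_vol)
  finally show "wedge 3 0 (H z) (hodge (total_metric P h A z) (total_vol P h A z) 3 (H z)) =
      (\<lambda>vs. \<phi> z * \<phi> z * total_vol P h A z vs)" by (simp only: total_vol_split)
qed

lemma form_integral_descend:
  assumes "\<omega> \<in> g2 P"
  shows "form_integral (base P) (descend P 2 (\<lambda>z vs. contract (generator P) H z vs * \<omega> z [generator P z]))
    = l2_one_form P h A (\<lambda>z vs. \<phi> z * A z vs) \<omega>"
proof -
  have \<omega>: "smooth_form_on (total P) UNIV 1 \<omega>" "invariant_on P UNIV \<omega>" using assms by (auto simp: g2_def)
  have "continuous_on UNIV (\<lambda>z. \<phi> z * \<omega> z [generator P z])"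
    by (intro continuous_on_mult continuous_\<phi> one_form_generator_continuous \<omega>)
  moreover have "\<phi> (act P t z) * \<omega> (act P t z) [generator P (act P t z)] = \<phi> z * \<omega> z [generator P z]" for t z
    by (simp add: \<phi>_invariant invariant_one_form_generator[OF \<omega>(2)])
  \<comment> \<open>The pairing of the flux coefficient with \<omega> is an invariant function,
    hence a function \<open>g\<close> of the base point; the contracted form is \<open>g\<close>
    times the pulled back area form.\<close>
  ultimately obtain g where g: "continuous_on UNIV g" "\<And>z. g (proj P z) = \<phi> z * \<omega> z [generator P z]"
    by (rule invariant_function_descends[of "\<lambda>z. \<phi> z * \<omega> z [generator P z]"]) blast+
  have v: "H z (generator P z # vs) = \<phi> z * riem_vol h (proj P z) (map (dproj z) vs)" for z vs
    unfolding \<phi>_def total_vol_split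
    by (rule split.two_form_eq) (use H_smooth total_vol_std_pos[of z] in \<open>auto simp: smooth_form_on_def total_vol_split\<close>)
  have "(\<lambda>z vs. contract (generator P) H z vs * \<omega> z [generator P z]) =
      pullback (total P) (base P) (proj P) (\<lambda>x vs. g x * riem_vol h x vs)"
    by (intro ext) (simp add: contract_def v pullback_def g(2))
  moreover have "descend P 2 (pullback (total P) (base P) (proj P) (\<lambda>x vs. g x * riem_vol h x vs))
      = (\<lambda>x vs. g x * riem_vol h x vs)"
    by (rule descend_pullback) (rule alt_form_scale[OF alt_form_riem_vol])
  ultimately show ?thesis
    by (simp only: fibre_integration[OF g(1)] g(2) l2_\<phi>_A[OF assms])
qed

end

section \<open>Dual norms, the flux and the final identity\<close>

text \<open>Pairing two representatives with each other in both orders shows, by symmetry, that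
  their squares agree.\<close>

lemma dual_norm_sq_eq:
  assumes "u \<in> V" "\<And>w. w \<in> V \<Longrightarrow> \<phi> w = ip u w" "\<And>v w. ip v w = ip w v"
  shows "dual_norm_sq V ip \<phi> = ip u u"
  unfolding dual_norm_sq_def
proof (rule the_equality)
  show "\<exists>v\<in>V. (\<forall>w\<in>V. \<phi> w = ip v w) \<and> ip u u = ip v v" using assms by blast
  fix r assume "\<exists>v\<in>V. (\<forall>w\<in>V. \<phi> w = ip v w) \<and> r = ip v v"
  then obtain v where v: "v \<in> V" "\<And>w. w \<in> V \<Longrightarrow> \<phi> w = ip v w" "r = ip v v" by blast
  have "ip v v = ip u v" using v(2)[OF v(1)] assms(2)[OF v(1)] by simp
  also have "\<dots> = ip v u" by (rule assms(3))
  also have "\<dots> = ip u u" using v(2)[OF assms(1)] assms(2)[OF assms(1)] by simp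
  finally show "r = ip u u" using v(3) by simp
qed

text \<open>The cover reaches every point of the base, so the local equations determine the flux
  everywhere.\<close>

lemma flux_eqI:
  assumes "good_cover (cover B)" "\<And>i z. z \<in> proj P -` cover B i \<Longrightarrow> H z = ext_d (total P) (curving B i) z"
  shows "flux P B = H"
  unfolding flux_def
proof (rule the_equality)
  fix H' assume H': "\<forall>i. \<forall>z\<in>proj P -` cover B i. H' z = ext_d (total P) (curving B i) z"
  show "H' = H"
  proof
    fix z
    obtain i where "proj P z \<in> cover B i" using assms(1) unfolding good_cover_def by blast
    then show "H' z = H z" using H' assms(2)[of z i] by simp
  qed
qed (use assms(2) in blast)

theorem proposition2p7:
  fixes P :: "('s::{t2_space, second_countable_topology},
               'z::{t2_space, second_countable_topology}) circle_bundle"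
    and h :: "('s, 2) metric"
    and A :: "('z, 3) form"
    and B :: "('i, 's, 'z) gerbe_field"
  assumes "closed_oriented_surface_bundle P"
    and "riemannian_metric (base P) h"
    and "mixed_field P A B"
  shows "YM P h A B = moment_norm_sq P h A B"
proof -
  have gerbe: "invariant_b_field P B" and conn: "connection_form P A"
    using assms(3) by (auto simp: mixed_field_def)
  obtain H where H: "smooth_form_on (total P) UNIV 3 H" "invariant_on P UNIV H"
    "\<forall>i. \<forall>z \<in> proj P -` cover B i. H z = ext_d (total P) (curving B i) z"
    using gerbe unfolding invariant_b_field_def by blast
  have flux: "flux P B = H"
    by (rule flux_eqI) (use gerbe H(3) in \<open>auto simp: invariant_b_field_def invariant_gerbe_def\<close>)
  interpret flux_bundle P h A H
    by unfold_locales (use assms(1,2) conn H in auto)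
  let ?f = "curvature_coeff" and ?u = "\<lambda>z vs. \<phi> z * A z vs"
  have f: "?f \<in> g1 P" by (simp add: g1_def smooth_curvature_coeff)
  have "moment_map P A B (f, \<lambda>z vs. 0) = l2_fun P h ?f f" for f
  proof -
    \<comment> \<open>The vanishing second summand still contains \<open>descend\<close>, which is
      evaluated with the zero form on the base as candidate.\<close>
    have "descend P 2 (pullback (total P) (base P) (proj P) (\<lambda>x vs. 0)) = (\<lambda>x vs. 0)"
      by (rule descend_pullback) (simp add: alt_form_def linear_zero)
    then have "descend P 2 (\<lambda>z vs. 0) = (\<lambda>x vs. 0)" by (simp add: pullback_def[abs_def])
    then show ?thesis
      unfolding moment_map_def l2_fun_def curvature_eq by (simp add: form_integral_zero mult_ac)
  qed
  then have 1: "dual_norm_sq (g1 P) (l2_fun P h) (\<lambda>f. moment_map P A B (f, \<lambda>z vs. 0)) = l2_fun P h ?f ?f"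
    by (intro dual_norm_sq_eq f) (auto simp: l2_fun_def mult_ac)
  have "moment_map P A B (\<lambda>x. 0, \<omega>) = l2_one_form P h A ?u \<omega>" if "\<omega> \<in> g2 P" for \<omega>
    using form_integral_descend[OF that] unfolding moment_map_def flux by (simp add: form_integral_zero)
  then have 2: "dual_norm_sq (g2 P) (l2_one_form P h A) (\<lambda>\<omega>. moment_map P A B (\<lambda>x. 0, \<omega>)) = l2_one_form P h A ?u ?u"
    by (intro dual_norm_sq_eq \<phi>_A_in_g2) (auto simp: l2_one_form_def form_inner_def mult_ac)
  have "form_integral (base P) (\<lambda>x vs. form_inner (h x) 2 (curvature P A x) (curvature P A x) * riem_vol h x vs)
      = l2_fun P h ?f ?f"
    unfolding curvature_eq l2_fun_def form_inner_riem_vol[where h = h, OF inner_h] ..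
  \<comment> \<open>For \<omega> equal to \<open>\<phi> A\<close> the pairing of \<phi> with the
    value on the generator becomes the square of \<phi>, matching the Hodge term.\<close>
  moreover have "form_integral (total P)
       (\<lambda>z. wedge 3 0 (flux P B z) (hodge (total_metric P h A z) (total_vol P h A z) 3 (flux P B z)))
      = l2_one_form P h A ?u ?u"
    unfolding flux wedge_hodge_H l2_\<phi>_A[OF \<phi>_A_in_g2] by (simp add: connection(3))
  ultimately show ?thesis
    unfolding YM_def moment_norm_sq_def 1 2 by simp
qed

end
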